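(* Assume conditions D.1, D.2, D.3, D.4 hold, let $\alpha\in(0,1)$, and let $$C>2C_\Lambda\sqrt{1+\log(1/\alpha)/\log p}\ \vee\ \left[C_E\sqrt{1\vee[C_L+C_f+1/2]}\right].$$ Let $\lambda_0=\frac{c_0+3}{c_0-3}\Lambda(1-\alpha|X)$. Let $A>1$ and suppose that $s$ obeys the growth condition $$2C(1+c_0)W_{\mathcal U}A\sqrt{s\log(p\vee n)}<q\,\underline f^{1/2}\kappa_0\sqrt n.$$ Then with probability at least $1-\alpha-4\gamma-3p^{-A^2}$, uniformly in the penalty level $\lambda$ such that $\lambda_0\le\lambda\le C\,W_{\mathcal U}\sqrt{n\log p}$, we have $$\sup_{u\in\mathcal U}\|J_u^{1/2}(\hat\beta(u)-\beta(u))\|\le 8C\,\frac{(1+c_0)W_{\mathcal U}A}{\underline f^{1/2}\kappa_0}\sqrt{\frac{s\log(p\vee n)}{n}},$$ $$\sup_{u\in\mathcal U}\sqrt{\mathrm E_x[x'(\hat\beta(u)-\beta(u))]^2}\le 8C\,\frac{(1+c_0)W_{\mathcal U}A}{\underline f\kappa_0}\sqrt{\frac{s\log(p\vee n)}{n}},$$ $$\sup_{u\in\mathcal U}\|\hat\beta(u)-\beta(u)\|\le\frac{1+c_0\sqrt{s/m}}{\kappa_m}\cdot 8C\,\frac{(1+c_0)W_{\mathcal U}A}{\underline f\kappa_0}\sqrt{\frac{s\log(p\vee n)}{n}}.$$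
   Context: Notation: $a\vee b=\max$, $a\wedge b=\min$; $\|\cdot\|,\|\cdot\|_1,\|\cdot\|_0$ are the $\ell_2$-norm, $\ell_1$-norm and number of non-zero components; $\mathbb E_n f(Z_i)=\frac1n\sum_i f(Z_i)$. For $T\subset\{1,\dots,p\}$, $\delta_T$ has components $\delta_j$ for $j\in T$ and $0$ otherwise. $\mathcal U\subset(0,1)$ is a compact set of quantile indices; $W_{\mathcal U}=\max_{u\in\mathcal U}1/\sqrt{u(1-u)}$. Model: the $u$-th conditional quantile of $y_i$ given $x_i\in\mathbb R^p$ is $x_i'\beta(u)$ for all $u\in\mathcal U$; $T_u=\mathrm{support}(\beta(u))$, $|T_u|\le s\le n/\log(n\vee p)$. $\rho_u(t)=(u-1\{t\le0\})t$, $\hat Q_u(\beta)=\mathbb E_n[\rho_u(y_i-x_i'\beta)]$, $Q_u(\beta)=\mathrm E[\rho_u(y_i-x_i'\beta)]$, $J_u=\mathrm E[f_{y_i|x_i}(x_i'\beta(u)|x_i)x_ix_i']$. Estimator: for penalty level $\lambda$ (possibly depending on $X=[x_1,\dots,x_n]'$), $\hat\beta(u)$ minimizes over $\beta\in\mathbb R^p$ the function $\hat Q_u(\beta)+\frac{\lambda\sqrt{u(1-u)}}n\sum_{j=1}^p\hat\sigma_j|\beta_j|$, $\hat\sigma_j^2=\mathbb E_n[x_{ij}^2]$; if the solution is not unique, $\hat\beta(u)$ is any optimal basic feasible solution of the equivalent linear program $\min \mathbb E_n[u\xi_i^++(1-u)\xi_i^-]+\frac{\lambda\sqrt{u(1-u)}}n\sum_j\hat\sigma_j(\beta_j^++\beta_j^-)$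 subject to $\xi_i^+-\xi_i^-=y_i-x_i'(\beta^+-\beta^-)$, all variables nonnegative, with $\hat\beta=\beta^+-\beta^-$. $\mathrm E_x$ denotes expectation over a copy $x$ of $x_i$ independent of the data (with $\hat\beta(u)$ held fixed). $\Lambda=n\sup_{u\in\mathcal U}\max_{j\le p}|\mathbb E_n[x_{ij}(u-1\{u_i\le u\})/(\hat\sigma_j\sqrt{u(1-u)})]|$ with $u_1,\dots,u_n$ i.i.d. uniform$(0,1)$ independent of $X$; $\Lambda(1-\alpha|X)$ is its $(1-\alpha)$-quantile conditional on $X$. D.1: $(y_i,x_i')'$, $i=1,\dots,n$, are i.i.d. with the $u$-th conditional quantile of $y_i$ given $x_i$ equal to $x_i'\beta(u)$ for each $u\in\mathcal U$, first component of $x_i$ equal to one, $n\wedge p\ge3$. For each $x$ in the support of $x_i$, $f_{y_i|x_i}(y|x)$ is continuously differentiable in $y\in\mathbb R$; $f_{y_i|x_i}(y|x)$ and $\frac{\partial}{\partial y}f_{y_i|x_i}(y|x)$ are bounded in absolute value by constants $\bar f$ and $\bar f'$ uniformly in $y$ and $x$; and $f_{y_i|x_i}(x'\beta(u)|x)>\underline f>0$ uniformly in $u\in\mathcal U$ and $x$ in the support. D.2: $\sup_{u\in\mathcal U}\|\beta(u)\|_0\le s$, $\|\beta(u)-\beta(u')\|\le L|u-u'|$ for all $u,u'\in\mathcal U$, with $s\ge1$ and $\log L\le C_L\log(p\vee n)$ for a constant $C_L$. D.3: $\mathrm E[x_{ij}^2]=1$ for all $j$, and $P(\max_{j\le p}|\hat\sigma_j-1|\le1/2)\ge1-\gamma\to1$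 as $n\to\infty$. D.4: with $A_u=\{\delta\in\mathbb R^p:\|\delta_{T_u^c}\|_1\le c_0\|\delta_{T_u}\|_1,\ \|\delta_{T_u^c}\|_0\le n\}$ and $\overline T_u(\delta,m)\subset T_u^c$ the support of the $m$ largest in absolute value components of $\delta$ outside $T_u$ (empty if $m=0$), for some $m\ge0$ and $c_0\ge9$, $$\kappa_m^2:=\inf_{u\in\mathcal U}\inf_{\delta\in A_u,\delta\ne0}\frac{\delta'\mathrm E[x_ix_i']\delta}{\|\delta_{T_u\cup\overline T_u(\delta,m)}\|^2}>0,$$ $\log(\underline f\kappa_0^2)\le C_f\log(n\vee p)$ for a constant $C_f$ ($\kappa_0$ is $\kappa_m$ with $m=0$), and $$q:=\frac38\frac{\underline f^{3/2}}{\bar f'}\inf_{u\in\mathcal U}\inf_{\delta\in A_u,\delta\ne0}\frac{\mathrm E[|x_i'\delta|^2]^{3/2}}{\mathrm E[|x_i'\delta|^3]}>0.$$ If $m=0$, $1+c_0\sqrt{s/m}$ is read as $+\infty$. Constants: $C_\Lambda$ is a universal constant such that always $\Lambda(1-\alpha|X)\le\sqrt{1+\log(1/\alpha)/\log p}\,C_\Lambda W_{\mathcal U}\sqrt{n\log p}$ with probability 1 and $P(\Lambda\ge kC_\Lambda W_{\mathcal U}\sqrt{n\log p}|X)\le p^{-k^2+1}$ for $k\ge1$. $C_E$ is a universal constant such that under D.1–D.4, for any $t>0$ and $A>1$, with probability at least $1-3\gamma-3p^{-A^2}$, $$\sup_{u\in\mathcal U,\delta\in A_u,\|J_u^{1/2}\delta\|\le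 t}\left|\hat Q_u(\beta(u)+\delta)-Q_u(\beta(u)+\delta)-(\hat Q_u(\beta(u))-Q_u(\beta(u)))\right|\le t\,C_E\frac{(1+c_0)A}{\underline f^{1/2}\kappa_0}\sqrt{\frac{s\log(p\vee[L\underline f^{1/2}\kappa_0/t])}{n}}.$$ *)

theory Defs
  imports "HOL-Probability.Probability"
begin

text \<open>
  The dimension \<open>p\<close> is \<open>CARD('p)\<close>, a sample is a pair of functions \<open>X :: nat \<Rightarrow> real ^ 'p\<close> and
  \<open>Y :: nat \<Rightarrow> real\<close> of which only the values at \<open>i < n\<close> are used.
\<close>

section \<open>Vectors\<close>

definition vsupport :: "real ^ 'p \<Rightarrow> 'p set" where
  "vsupport d = {j. d $ j \<noteq> 0}"

definition norm0 :: "real ^ 'p::finite \<Rightarrow> nat" where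
  "norm0 d = card (vsupport d)"

definition norm1 :: "real ^ 'p::finite \<Rightarrow> real" where
  "norm1 d = (\<Sum>j\<in>UNIV. \<bar>d $ j\<bar>)"

definition restrict_vec :: "'p set \<Rightarrow> real ^ 'p \<Rightarrow> real ^ 'p::finite" where
  "restrict_vec T d = (\<chi> j. if j \<in> T then d $ j else 0)"

text \<open>The index set of the \<open>m\<close> largest components outside \<open>T\<close>. Ties are broken arbitrarily, and
  all of \<open>- T\<close> is taken if it has fewer than \<open>m\<close> elements.\<close>

definition top_outside :: "'p::finite set \<Rightarrow> nat \<Rightarrow> real ^ 'p \<Rightarrow> 'p set" where
  "top_outside T m d = (SOME S. S \<subseteq> - T \<and> card S = min m (card (- T)) \<and>
     (\<forall>j\<in>S. \<forall>k\<in>- T - S. \<bar>d $ k\<bar> \<le> \<bar>d $ j\<bar>))"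

text \<open>The set \<open>A\<^sub>u\<close>, with \<open>T\<close> in place of \<open>T\<^sub>u\<close>.\<close>

definition restricted_set :: "'p set \<Rightarrow> real \<Rightarrow> nat \<Rightarrow> (real ^ 'p::finite) set" where
  "restricted_set T c n = {d. norm1 (restrict_vec (- T) d) \<le> c * norm1 (restrict_vec T d) \<and>
                              norm0 (restrict_vec (- T) d) \<le> n}"

text \<open>For a symmetric positive semidefinite \<open>J\<close> such a root exists and is unique.\<close>

definition psd_sqrt :: "real ^ 'p ^ 'p \<Rightarrow> real ^ 'p ^ 'p::finite" where
  "psd_sqrt J = (SOME R. transpose R = R \<and> (\<forall>d. 0 \<le> d \<bullet> (R *v d)) \<and> R ** R = J)"

section \<open>Probability\<close>

text \<open>``With probability at least \<open>r\<close>, \<open>Q\<close> holds'', with no measurability claim about \<open>Q\<close>.\<close>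

definition with_prob_ge :: "'w measure \<Rightarrow> real \<Rightarrow> ('w \<Rightarrow> bool) \<Rightarrow> bool" where
  "with_prob_ge M r Q \<longleftrightarrow> (\<exists>E\<in>sets M. r \<le> measure M E \<and> (\<forall>\<omega>\<in>E. Q \<omega>))"

definition quantile :: "real measure \<Rightarrow> real \<Rightarrow> real" where
  "quantile N \<tau> = Inf {t. \<tau> \<le> cdf N t}"

definition law_support :: "'a::metric_space measure \<Rightarrow> 'a set" where
  "law_support N = {v. \<forall>e>0. 0 < measure N (ball v e)}"

section \<open>The estimator\<close>

definition check_loss :: "real \<Rightarrow> real \<Rightarrow> real" where
  "check_loss u t = (u - of_bool (t \<le> 0)) * t"

definition emp_mean :: "nat \<Rightarrow> (nat \<Rightarrow> real) \<Rightarrow> real" where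
  "emp_mean n g = (\<Sum>i<n. g i) / real n"

definition sigma_hat :: "nat \<Rightarrow> (nat \<Rightarrow> real ^ 'p) \<Rightarrow> 'p \<Rightarrow> real" where
  "sigma_hat n X j = sqrt (emp_mean n (\<lambda>i. (X i $ j)\<^sup>2))"

definition emp_loss ::
  "nat \<Rightarrow> (nat \<Rightarrow> real ^ 'p::finite) \<Rightarrow> (nat \<Rightarrow> real) \<Rightarrow> real \<Rightarrow> real ^ 'p \<Rightarrow> real" where
  "emp_loss n X Y u b = emp_mean n (\<lambda>i. check_loss u (Y i - X i \<bullet> b))"

definition pen_loss ::
  "nat \<Rightarrow> (nat \<Rightarrow> real ^ 'p::finite) \<Rightarrow> (nat \<Rightarrow> real) \<Rightarrow> real \<Rightarrow> real \<Rightarrow> real ^ 'p \<Rightarrow> real" where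
  "pen_loss n X Y lam u b = emp_loss n X Y u b +
     lam * sqrt (u * (1 - u)) / real n * (\<Sum>j\<in>UNIV. sigma_hat n X j * \<bar>b $ j\<bar>)"

datatype 'p lp_var = XiPlus nat | XiMinus nat | BetaPlus 'p | BetaMinus 'p

definition lp_vars :: "nat \<Rightarrow> 'p lp_var set" where
  "lp_vars n = XiPlus ` {..<n} \<union> XiMinus ` {..<n} \<union> range BetaPlus \<union> range BetaMinus"

definition lp_beta :: "('p lp_var \<Rightarrow> real) \<Rightarrow> real ^ 'p::finite" where
  "lp_beta z = (\<chi> j. z (BetaPlus j) - z (BetaMinus j))"

definition lp_cost ::
  "nat \<Rightarrow> (nat \<Rightarrow> real ^ 'p::finite) \<Rightarrow> real \<Rightarrow> real \<Rightarrow> ('p lp_var \<Rightarrow> real) \<Rightarrow> real" where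
  "lp_cost n X lam u z = emp_mean n (\<lambda>i. u * z (XiPlus i) + (1 - u) * z (XiMinus i)) +
     lam * sqrt (u * (1 - u)) / real n *
       (\<Sum>j\<in>UNIV. sigma_hat n X j * (z (BetaPlus j) + z (BetaMinus j)))"

definition lp_feasible ::
  "nat \<Rightarrow> (nat \<Rightarrow> real ^ 'p::finite) \<Rightarrow> (nat \<Rightarrow> real) \<Rightarrow> ('p lp_var \<Rightarrow> real) \<Rightarrow> bool" where
  "lp_feasible n X Y z \<longleftrightarrow> (\<forall>v\<in>lp_vars n. 0 \<le> z v) \<and>
     (\<forall>i<n. z (XiPlus i) - z (XiMinus i) = Y i - X i \<bullet> lp_beta z)"

text \<open>Column \<open>v\<close> of the \<open>n\<close>-row constraint matrix, all variables being moved to the left-hand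
  side of the equality constraints.\<close>

fun lp_column :: "(nat \<Rightarrow> real ^ 'p::finite) \<Rightarrow> 'p lp_var \<Rightarrow> nat \<Rightarrow> real" where
  "lp_column X (XiPlus k) i = of_bool (i = k)"
| "lp_column X (XiMinus k) i = - of_bool (i = k)"
| "lp_column X (BetaPlus j) i = X i $ j"
| "lp_column X (BetaMinus j) i = - X i $ j"

definition lp_basic :: "nat \<Rightarrow> (nat \<Rightarrow> real ^ 'p::finite) \<Rightarrow> ('p lp_var \<Rightarrow> real) \<Rightarrow> bool" where
  "lp_basic n X z \<longleftrightarrow> (\<exists>B\<subseteq>lp_vars n. card B = n \<and>
     (\<forall>c. (\<forall>i<n. (\<Sum>v\<in>B. c v * lp_column X v i) = 0) \<longrightarrow> (\<forall>v\<in>B. c v = 0)) \<and>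
     (\<forall>v\<in>lp_vars n - B. z v = 0))"

definition is_qr_estimator ::
  "nat \<Rightarrow> (nat \<Rightarrow> real ^ 'p::finite) \<Rightarrow> (nat \<Rightarrow> real) \<Rightarrow> real \<Rightarrow> real \<Rightarrow> real ^ 'p \<Rightarrow> bool" where
  "is_qr_estimator n X Y lam u b \<longleftrightarrow>
     is_arg_min (pen_loss n X Y lam u) (\<lambda>_. True) b \<and>
     ((\<exists>b'. b' \<noteq> b \<and> is_arg_min (pen_loss n X Y lam u) (\<lambda>_. True) b') \<longrightarrow>
      (\<exists>z. is_arg_min (lp_cost n X lam u) (lp_feasible n X Y) z \<and> lp_basic n X z \<and>
           b = lp_beta z))"

section \<open>The penalty level\<close>

definition W_max :: "real set \<Rightarrow> real" where
  "W_max U = (SUP u\<in>U. 1 / sqrt (u * (1 - u)))"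

text \<open>If \<open>sigma_hat n X j = 0\<close> then \<open>X i $ j = 0\<close> for all \<open>i < n\<close>, and the \<open>j\<close>-th term is \<open>0\<close>.\<close>

definition Lambda_stat ::
  "real set \<Rightarrow> nat \<Rightarrow> (nat \<Rightarrow> real ^ 'p::finite) \<Rightarrow> (nat \<Rightarrow> real) \<Rightarrow> real" where
  "Lambda_stat U n X v = real n * (SUP u\<in>U. MAX j\<in>UNIV.
     \<bar>emp_mean n (\<lambda>i. X i $ j * (u - of_bool (v i \<le> u)) /
                      (sigma_hat n X j * sqrt (u * (1 - u))))\<bar>)"

text \<open>The uniform variables are independent of \<open>X\<close>, so the conditional law of \<open>\<Lambda>\<close> given \<open>X\<close> is
  the law of \<open>Lambda_stat\<close> at the fixed design \<open>X\<close>.\<close>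

definition Lambda_law :: "real set \<Rightarrow> nat \<Rightarrow> (nat \<Rightarrow> real ^ 'p::finite) \<Rightarrow> real measure" where
  "Lambda_law U n X =
     distr (Pi\<^sub>M {..<n} (\<lambda>_. uniform_measure lborel {0<..<1})) borel (Lambda_stat U n X)"

definition is_C_Lambda :: "'p::finite itself \<Rightarrow> real \<Rightarrow> bool" where
  "is_C_Lambda _ C \<longleftrightarrow> (\<forall>n\<ge>3. \<forall>U. \<forall>X :: nat \<Rightarrow> real ^ 'p.
     compact U \<and> U \<noteq> {} \<and> U \<subseteq> {0<..<1} \<longrightarrow>
     (\<forall>\<alpha>. 0 < \<alpha> \<and> \<alpha> < 1 \<longrightarrow>
        quantile (Lambda_law U n X) (1 - \<alpha>)
          \<le> sqrt (1 + ln (1 / \<alpha>) / ln (real CARD('p))) * C * W_max U * sqrt (n * ln (real CARD('p)))) \<and>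
     (\<forall>k\<ge>1. measure (Lambda_law U n X) {k * C * W_max U * sqrt (n * ln (real CARD('p)))..}
        \<le> real CARD('p) powr (- k\<^sup>2 + 1)))"

section \<open>The model\<close>

record ('w, 'p) qr_model =
  prob_of :: "'w measure"
  nobs :: nat                           \<comment> \<open>\<open>n\<close>\<close>
  quants :: "real set"                  \<comment> \<open>the set of quantile indices\<close>
  resp :: "nat \<Rightarrow> 'w \<Rightarrow> real"           \<comment> \<open>\<open>y\<^sub>i\<close>, \<open>i < n\<close>\<close>
  regr :: "nat \<Rightarrow> 'w \<Rightarrow> real ^ 'p"      \<comment> \<open>\<open>x\<^sub>i\<close>, \<open>i < n\<close>\<close>
  fstidx :: 'p                          \<comment> \<open>index of the first component\<close>
  coef :: "real \<Rightarrow> real ^ 'p"           \<comment> \<open>\<open>\<beta>(u)\<close>\<close>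
  cdens :: "real ^ 'p \<Rightarrow> real \<Rightarrow> real"  \<comment> \<open>\<open>cdens v t\<close> is the density of \<open>y\<^sub>i\<close> at \<open>t\<close> given \<open>x\<^sub>i = v\<close>\<close>
  fbar :: real
  fbar' :: real
  flow :: real                          \<comment> \<open>lower bound for the conditional density at the quantiles\<close>
  spars :: nat                          \<comment> \<open>\<open>s\<close>\<close>
  lip :: real                           \<comment> \<open>\<open>L\<close>\<close>
  CL :: real
  Cf :: real
  gam :: "nat \<Rightarrow> real"                  \<comment> \<open>\<open>\<gamma>\<close> as a sequence in the sample size\<close>
  mtop :: nat                           \<comment> \<open>\<open>m\<close>\<close>
  czero :: real                         \<comment> \<open>\<open>c\<^sub>0\<close>\<close>

definition dim_of :: "('w, 'p::finite) qr_model \<Rightarrow> real" where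
  "dim_of D = real CARD('p)"

definition log_pn :: "('w, 'p::finite) qr_model \<Rightarrow> real" where
  "log_pn D = ln (max (dim_of D) (real (nobs D)))"

definition gamma_n :: "('w, 'p::finite) qr_model \<Rightarrow> real" where
  "gamma_n D = gam D (nobs D)"

definition W_of :: "('w, 'p::finite) qr_model \<Rightarrow> real" where
  "W_of D = W_max (quants D)"

definition design :: "('w, 'p::finite) qr_model \<Rightarrow> 'w \<Rightarrow> nat \<Rightarrow> real ^ 'p" where
  "design D \<omega> = (\<lambda>i. regr D i \<omega>)"

definition response :: "('w, 'p::finite) qr_model \<Rightarrow> 'w \<Rightarrow> nat \<Rightarrow> real" where
  "response D \<omega> = (\<lambda>i. resp D i \<omega>)"

definition x_law :: "('w, 'p::finite) qr_model \<Rightarrow> (real ^ 'p) measure" where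
  "x_law D = distr (prob_of D) borel (regr D 0)"

definition T_of :: "('w, 'p::finite) qr_model \<Rightarrow> real \<Rightarrow> 'p set" where
  "T_of D u = vsupport (coef D u)"

definition A_of :: "('w, 'p::finite) qr_model \<Rightarrow> real \<Rightarrow> (real ^ 'p) set" where
  "A_of D u = restricted_set (T_of D u) (czero D) (nobs D)"

definition Gram :: "('w, 'p::finite) qr_model \<Rightarrow> real ^ 'p ^ 'p" where
  "Gram D = (\<chi> i j. \<integral>v. v $ i * v $ j \<partial>x_law D)"

definition J_of :: "('w, 'p::finite) qr_model \<Rightarrow> real \<Rightarrow> real ^ 'p ^ 'p" where
  "J_of D u = (\<chi> i j. \<integral>v. cdens D v (v \<bullet> coef D u) * (v $ i * v $ j) \<partial>x_law D)"

definition J_norm :: "('w, 'p::finite) qr_model \<Rightarrow> real \<Rightarrow> real ^ 'p \<Rightarrow> real" where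
  "J_norm D u d = norm (psd_sqrt (J_of D u) *v d)"

text \<open>The infimum is taken in the extended reals: it is \<open>\<infinity>\<close> if every \<open>A\<^sub>u\<close> is \<open>{0}\<close>.\<close>

definition kappa_sq :: "('w, 'p::finite) qr_model \<Rightarrow> nat \<Rightarrow> ereal" where
  "kappa_sq D m = (INF u\<in>quants D. INF d\<in>A_of D u - {0}.
     ereal (d \<bullet> (Gram D *v d) /
            (norm (restrict_vec (T_of D u \<union> top_outside (T_of D u) m d) d))\<^sup>2))"

definition kappa :: "('w, 'p::finite) qr_model \<Rightarrow> nat \<Rightarrow> real" where
  "kappa D m = sqrt (real_of_ereal (kappa_sq D m))"

text \<open>If the third moment is infinite, the Bochner integral in the denominator is \<open>0\<close> and the
  quotient is \<open>0\<close>, which is its value with the denominator \<open>\<infinity>\<close>.\<close>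

definition q_of :: "('w, 'p::finite) qr_model \<Rightarrow> real" where
  "q_of D = 3 / 8 * (flow D powr (3 / 2) / fbar' D) *
     real_of_ereal (INF u\<in>quants D. INF d\<in>A_of D u - {0}.
       ereal ((\<integral>v. \<bar>v \<bullet> d\<bar> ^ 2 \<partial>x_law D) powr (3 / 2) / (\<integral>v. \<bar>v \<bullet> d\<bar> ^ 3 \<partial>x_law D)))"

definition pop_loss :: "('w, 'p::finite) qr_model \<Rightarrow> real \<Rightarrow> real ^ 'p \<Rightarrow> real" where
  "pop_loss D u b = (\<integral>\<omega>. check_loss u (resp D 0 \<omega> - regr D 0 \<omega> \<bullet> b) \<partial>prob_of D)"

text \<open>The difference \<open>Q\<^sub>u(b') - Q\<^sub>u(b)\<close>, written as the expectation of the difference of the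
  losses, which exists even if \<open>y\<^sub>i\<close> has no first moment.\<close>

definition pop_loss_diff ::
  "('w, 'p::finite) qr_model \<Rightarrow> real \<Rightarrow> real ^ 'p \<Rightarrow> real ^ 'p \<Rightarrow> real" where
  "pop_loss_diff D u b' b = (\<integral>\<omega>. check_loss u (resp D 0 \<omega> - regr D 0 \<omega> \<bullet> b') -
                               check_loss u (resp D 0 \<omega> - regr D 0 \<omega> \<bullet> b) \<partial>prob_of D)"

lemma pop_loss_diff_eq:
  assumes "integrable (prob_of D) (\<lambda>\<omega>. check_loss u (resp D 0 \<omega> - regr D 0 \<omega> \<bullet> b'))"
    and "integrable (prob_of D) (\<lambda>\<omega>. check_loss u (resp D 0 \<omega> - regr D 0 \<omega> \<bullet> b))"
  shows "pop_loss_diff D u b' b = pop_loss D u b' - pop_loss D u b"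
  using assms unfolding pop_loss_diff_def pop_loss_def by simp

section \<open>The conditions\<close>

definition cond_setup :: "('w, 'p::finite) qr_model \<Rightarrow> bool" where
  "cond_setup D \<longleftrightarrow> prob_space (prob_of D) \<and>
     (\<forall>i<nobs D. resp D i \<in> borel_measurable (prob_of D) \<and> regr D i \<in> borel_measurable (prob_of D)) \<and>
     compact (quants D) \<and> quants D \<noteq> {} \<and> quants D \<subseteq> {0<..<1} \<and>
     real (spars D) \<le> real (nobs D) / log_pn D"

definition cond_D1 :: "('w, 'p::finite) qr_model \<Rightarrow> bool" where
  "cond_D1 D \<longleftrightarrow>
     3 \<le> nobs D \<and> 3 \<le> CARD('p) \<and>
     prob_space.indep_vars (prob_of D) (\<lambda>_. borel) (\<lambda>i \<omega>. (resp D i \<omega>, regr D i \<omega>)) {..<nobs D} \<and>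
     (\<forall>i<nobs D. distr (prob_of D) borel (\<lambda>\<omega>. (resp D i \<omega>, regr D i \<omega>)) =
                 distr (prob_of D) borel (\<lambda>\<omega>. (resp D 0 \<omega>, regr D 0 \<omega>))) \<and>
     (\<forall>v t. 0 \<le> cdens D v t) \<and>
     distributed (prob_of D) (x_law D \<Otimes>\<^sub>M lborel)
       (\<lambda>\<omega>. (regr D 0 \<omega>, resp D 0 \<omega>)) (\<lambda>(v, t). ennreal (cdens D v t)) \<and>
     (\<forall>u\<in>quants D. AE v in x_law D.
        quantile (density lborel (\<lambda>t. ennreal (cdens D v t))) u = v \<bullet> coef D u) \<and>
     (\<forall>i<nobs D. AE \<omega> in prob_of D. regr D i \<omega> $ fstidx D = 1) \<and>
     (\<forall>v\<in>law_support (x_law D).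
        cdens D v C1_differentiable_on UNIV \<and>
        (\<forall>t. \<bar>cdens D v t\<bar> \<le> fbar D \<and> \<bar>deriv (cdens D v) t\<bar> \<le> fbar' D) \<and>
        (\<forall>u\<in>quants D. flow D < cdens D v (v \<bullet> coef D u))) \<and>
     0 < flow D"

definition cond_D2 :: "('w, 'p::finite) qr_model \<Rightarrow> bool" where
  "cond_D2 D \<longleftrightarrow>
     (\<forall>u\<in>quants D. norm0 (coef D u) \<le> spars D) \<and>
     (\<forall>u\<in>quants D. \<forall>u'\<in>quants D. norm (coef D u - coef D u') \<le> lip D * \<bar>u - u'\<bar>) \<and>
     1 \<le> spars D \<and> 0 < lip D \<and> ln (lip D) \<le> CL D * log_pn D"

definition cond_D3 :: "('w, 'p::finite) qr_model \<Rightarrow> bool" where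
  "cond_D3 D \<longleftrightarrow>
     (\<forall>j. (\<integral>v. (v $ j)\<^sup>2 \<partial>x_law D) = 1) \<and>
     1 - gamma_n D \<le> measure (prob_of D) {\<omega>\<in>space (prob_of D).
        (MAX j\<in>UNIV. \<bar>sigma_hat (nobs D) (design D \<omega>) j - 1\<bar>) \<le> 1 / 2} \<and>
     (\<lambda>n. 1 - gam D n) \<longlonglongrightarrow> 1"

text \<open>The bound on the logarithm of \<open>flow D * (kappa D 0)\<^sup>2\<close> entails that \<open>kappa D 0\<close> is finite.\<close>

definition cond_D4 :: "('w, 'p::finite) qr_model \<Rightarrow> bool" where
  "cond_D4 D \<longleftrightarrow>
     9 \<le> czero D \<and> 0 < kappa_sq D (mtop D) \<and>
     kappa_sq D 0 < \<infinity> \<and> ln (flow D * (kappa D 0)\<^sup>2) \<le> Cf D * log_pn D \<and>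
     0 < q_of D"

definition is_C_E :: "('w, 'p::finite) qr_model itself \<Rightarrow> real \<Rightarrow> bool" where
  "is_C_E _ C \<longleftrightarrow> (\<forall>D :: ('w, 'p) qr_model.
     cond_setup D \<and> cond_D1 D \<and> cond_D2 D \<and> cond_D3 D \<and> cond_D4 D \<longrightarrow>
     (\<forall>t>0. \<forall>A>1. with_prob_ge (prob_of D) (1 - 3 * gamma_n D - 3 * dim_of D powr (- A\<^sup>2)) (\<lambda>\<omega>.
        (SUP (u, d)\<in>{(u, d). u \<in> quants D \<and> d \<in> A_of D u \<and> J_norm D u d \<le> t}.
           ereal \<bar>emp_loss (nobs D) (design D \<omega>) (response D \<omega>) u (coef D u + d)
                  - emp_loss (nobs D) (design D \<omega>) (response D \<omega>) u (coef D u)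
                  - pop_loss_diff D u (coef D u + d) (coef D u)\<bar>)
        \<le> ereal (t * C * ((1 + czero D) * A / (sqrt (flow D) * kappa D 0)) *
             sqrt (spars D * ln (max (dim_of D) (lip D * sqrt (flow D) * kappa D 0 / t)) / nobs D)))))"

definition lambda0 :: "('w, 'p::finite) qr_model \<Rightarrow> real \<Rightarrow> 'w \<Rightarrow> real" where
  "lambda0 D \<alpha> \<omega> = (czero D + 3) / (czero D - 3) *
     quantile (Lambda_law (quants D) (nobs D) (design D \<omega>)) (1 - \<alpha>)"

text \<open>The factor \<open>(1 + c\<^sub>0 sqrt (s / m)) / \<kappa>\<^sub>m\<close>, which is \<open>\<infinity>\<close> for \<open>m = 0\<close>.\<close>

definition l2_factor :: "('w, 'p::finite) qr_model \<Rightarrow> ereal" where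
  "l2_factor D = (if mtop D = 0 then \<infinity>
     else ereal ((1 + czero D * sqrt (spars D / mtop D)) / kappa D (mtop D)))"

end

theory Submission
  imports Defs
begin

text \<open>On an event of the required probability the penalty dominates the score \<open>\<Lambda>\<close> at the true coefficients,
  all \<open>\<sigma>\<^sub>j\<close> estimates lie in \<open>[1/2, 3/2]\<close>, and the empirical process bound with constant \<open>C\<^sub>E\<close> holds at the
  radius \<open>t\<close> of the claim. The first two facts and the subgradient inequality put every estimation error in the
  cone \<open>A\<^sub>u\<close>. If the error were larger than \<open>t\<close> in the norm of \<open>J\<^sub>u\<close>, convexity of the penalized
  loss would give an element of \<open>A\<^sub>u\<close> of norm exactly \<open>t\<close> at which the penalized loss does not exceed its
  value at the truth. There the population loss has grown by at least \<open>t\<^sup>2/4\<close> (a second order expansion, whose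
  remainder is controlled by \<open>q\<close>), which the growth condition makes larger than the empirical process term plus the
  penalty term. The constant \<open>C\<close> is bounded away from \<open>0\<close>, as needed for the logarithmic factor, because a
  small \<open>C\<^sub>\<Lambda>\<close> violates its own tail bound.\<close>


section \<open>Square roots of positive semidefinite matrices\<close>

text \<open>The empirical process bound enters through the constant \<open>C_E\<close>, so the
  probabilistic work lies in the score. Given x_i, the rank F(y_i|x_i) is uniform, hence independent
  of the design, and y_i \<le> x_i'\<beta>(u) is almost surely the same event as F(y_i|x_i) \<le> u;
  so the score at the truth has the law of \<Lambda>. This must hold for all u off a single null
  set, while the quantile condition gives one null set per u; countable subsets of U and the
  Lipschitz condition on \<beta> bridge the gap. Once the event is fixed everything is
  deterministic, and the event involves neither the penalty level nor the estimator, which makes the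
  bounds uniform in both. Membership in A_u has a second half, at most n non-zero components; this
  is where the choice of basic solutions enters. The factor 8 leaves slack: with a = 1 + c_0, r =
  sqrt(s log(p v n) / n) and K = \<open>sqrt (flow D) * kappa D 0\<close>, the growth t^2/4 at
  radius t is 2 a W A times C t r / K, whereas noise and penalty together cost at most a A + 3 W / 4
  times the same quantity.\<close>

lemma symmetric_eigenvector_in_invariant_subspace:
  fixes A :: "real ^ 'n ^ 'n::finite"
  assumes sym: "transpose A = A" and S: "subspace S" "S \<noteq> {0}"
    and inv: "\<And>x. x \<in> S \<Longrightarrow> A *v x \<in> S"
  obtains v where "v \<in> S" "norm v = 1" "A *v v = (v \<bullet> (A *v v)) *\<^sub>R v"
proof -
  have sa: "x \<bullet> (A *v y) = (A *v x) \<bullet> y" for x y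
    by (metis sym dot_lmul_matrix transpose_matrix_vector)
  have "compact (S \<inter> sphere 0 1)"
    by (simp add: closed_subspace S(1) closed_Int_compact)
  moreover obtain w where w: "w \<in> S" "w \<noteq> 0"
    using S subspace_0 by blast
  then have "w /\<^sub>R norm w \<in> S \<inter> sphere 0 1"
    using S(1) by (auto simp: subspace_scale)
  then have "S \<inter> sphere 0 1 \<noteq> {}" by blast
  moreover have "continuous_on (S \<inter> sphere 0 1) (\<lambda>x. x \<bullet> (A *v x))"
    by (intro continuous_intros)
  ultimately obtain v where v: "v \<in> S \<inter> sphere 0 1"
    and mx: "\<And>x. x \<in> S \<inter> sphere 0 1 \<Longrightarrow> x \<bullet> (A *v x) \<le> v \<bullet> (A *v v)"
    using continuous_attains_sup[of "S \<inter> sphere 0 1" "\<lambda>x. x \<bullet> (A *v x)"] by blast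
  define l where "l = v \<bullet> (A *v v)"
  have vS: "v \<in> S" and nv: "norm v = 1" using v by auto
  have vv: "v \<bullet> v = 1" using nv by (simp add: dot_square_norm)
  have q: "x \<bullet> (A *v x) \<le> l * (x \<bullet> x)" if "x \<in> S" for x
  proof (cases "x = 0")
    case False
    have "(x /\<^sub>R norm x) \<bullet> (A *v (x /\<^sub>R norm x)) \<le> l"
      unfolding l_def using False that S(1) by (intro mx) (auto simp: subspace_scale)
    then have "(x \<bullet> (A *v x)) / (norm x)\<^sup>2 \<le> l"
      by (simp add: matrix_vector_mult_scaleR power2_eq_square field_simps)
    then show ?thesis using False by (simp add: dot_square_norm field_simps)
  qed simp
  \<comment> \<open>First variation at the maximizer: along v + t w the bound \<open>q\<close> gives
    2 t a \<le> t^2 K, and t = a / K turns this into a^2 \<le> 0.\<close>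
  have orth: "w \<bullet> (A *v v) = 0" if "w \<in> S" "w \<bullet> v = 0" for w
  proof (rule ccontr)
    assume ne: "w \<bullet> (A *v v) \<noteq> 0"
    define a where "a = w \<bullet> (A *v v)"
    define K where "K = \<bar>l * (w \<bullet> w) - w \<bullet> (A *v w)\<bar> + 1"
    have K: "K > 0" "l * (w \<bullet> w) - w \<bullet> (A *v w) < K" unfolding K_def by auto
    define t where "t = a / K"
    have "v + t *\<^sub>R w \<in> S" using vS that(1) S(1) by (simp add: subspace_add subspace_scale)
    from q[OF this] have "2 * t * a \<le> t * t * (l * (w \<bullet> w) - w \<bullet> (A *v w))"
      using that(2) vv sa[of v w] unfolding a_def l_def
      by (simp add: matrix_vector_right_distrib matrix_vector_mult_scaleR inner_add_left inner_add_right
          inner_commute[of v w] inner_commute[of "A *v v" w] algebra_simps)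
    also have "\<dots> \<le> t * t * K" using K(2) by (intro mult_left_mono) auto
    also have "\<dots> = t * a" using K(1) unfolding t_def by simp
    finally have "t * a \<le> 0" by (simp add: mult.commute)
    moreover have "t * a > 0" using ne K(1) unfolding t_def a_def by (auto simp: zero_less_mult_iff zero_less_divide_iff linorder_neq_iff)
    ultimately show False by simp
  qed
  \<comment> \<open>Invariance keeps the residual in S, and the choice of l makes it orthogonal to
    v; so \<open>orth\<close> applies to the residual itself and shows that it vanishes.\<close>
  define w where "w = A *v v - l *\<^sub>R v"
  have wS: "w \<in> S" unfolding w_def using inv vS S(1) by (simp add: subspace_diff subspace_scale)
  have wv: "w \<bullet> v = 0" unfolding w_def
    by (simp add: inner_diff_left vv l_def inner_commute[of "A *v v" v])
  have "w \<bullet> w = w \<bullet> (A *v v) - l * (w \<bullet> v)"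
    by (metis inner_diff_right inner_scaleR_right w_def)
  then have "w = 0" using orth[OF wS wv] wv by simp
  then have "A *v v = l *\<^sub>R v" unfolding w_def by simp
  then show ?thesis using that vS nv unfolding l_def by blast
qed

text \<open>Induction on the dimension: a unit eigenvector is split off, and by symmetry its
  orthogonal complement within S is invariant again. Invariant subspaces in place of the whole space
  are what makes the induction close.\<close>

lemma symmetric_orthonormal_eigenbasis_on:
  fixes A :: "real ^ 'n ^ 'n::finite"
  assumes sym: "transpose A = A"
  shows "subspace S \<Longrightarrow> (\<And>x. x \<in> S \<Longrightarrow> A *v x \<in> S) \<Longrightarrow>
    \<exists>B. finite B \<and> B \<subseteq> S \<and> pairwise orthogonal B \<and> (\<forall>b\<in>B. norm b = 1 \<and> A *v b = (b \<bullet> (A *v b)) *\<^sub>R b) \<and>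
        (\<forall>x\<in>S. x = (\<Sum>b\<in>B. (b \<bullet> x) *\<^sub>R b))"
proof (induction "dim S" arbitrary: S rule: less_induct)
  case less
  show ?case
  proof (cases "S = {0}")
    case True
    then show ?thesis by (intro exI[of _ "{}"]) auto
  next
    case False
    obtain v where v: "v \<in> S" "norm v = 1" "A *v v = (v \<bullet> (A *v v)) *\<^sub>R v"
      using symmetric_eigenvector_in_invariant_subspace[OF sym less.prems(1) False less.prems(2)] by metis
    have vv: "v \<bullet> v = 1" using v(2) by (simp add: dot_square_norm)
    define S' where "S' = S \<inter> {x. v \<bullet> x = 0}"
    have sS': "subspace S'" unfolding S'_def using less.prems(1) subspace_hyperplane[of v] by (rule subspace_inter)
    have "v \<notin> S'" unfolding S'_def using vv by simp
    then have "S' \<subset> S" using v(1) unfolding S'_def by blast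
    then have "dim S' < dim S"
      by (metis dim_psubset less.prems(1) sS' span_eq_iff)
    moreover have "A *v x \<in> S'" if "x \<in> S'" for x
    proof -
      have "v \<bullet> (A *v x) = (A *v v) \<bullet> x"
        by (metis sym dot_lmul_matrix transpose_matrix_vector)
      also have "\<dots> = (v \<bullet> (A *v v)) * (v \<bullet> x)" by (subst v(3)) simp
      finally show ?thesis using that less.prems(2) unfolding S'_def by simp
    qed
    ultimately obtain B where B: "finite B" "B \<subseteq> S'" "pairwise orthogonal B"
      "\<forall>b\<in>B. norm b = 1 \<and> A *v b = (b \<bullet> (A *v b)) *\<^sub>R b"
      "\<forall>x\<in>S'. x = (\<Sum>b\<in>B. (b \<bullet> x) *\<^sub>R b)"
      using less.hyps[OF _ sS'] by blast
    have vB: "v \<bullet> b = 0" if "b \<in> B" for b using that B(2) unfolding S'_def by blast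
    have nB: "v \<notin> B" using \<open>v \<notin> S'\<close> B(2) by blast
    have "x = (\<Sum>b\<in>insert v B. (b \<bullet> x) *\<^sub>R b)" if "x \<in> S" for x
    proof -
      have "x - (v \<bullet> x) *\<^sub>R v \<in> S'" unfolding S'_def using that v(1) less.prems(1)
        by (simp add: subspace_diff subspace_scale inner_diff_right vv)
      with B(5) have "x - (v \<bullet> x) *\<^sub>R v = (\<Sum>b\<in>B. (b \<bullet> (x - (v \<bullet> x) *\<^sub>R v)) *\<^sub>R b)" by blast
      also have "\<dots> = (\<Sum>b\<in>B. (b \<bullet> x) *\<^sub>R b)"
        by (intro sum.cong refl) (simp add: inner_diff_right inner_commute[of _ v] vB)
      finally show ?thesis using nB B(1) by (simp add: algebra_simps)
    qed
    moreover have "pairwise orthogonal (insert v B)"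
      using B(3) vB unfolding pairwise_insert by (auto simp: orthogonal_def inner_commute)
    ultimately show ?thesis using B v unfolding S'_def
      by (intro exI[of _ "insert v B"]) auto
  qed
qed

text \<open>The root multiplies each eigenvector by the square root of its eigenvalue. Since
  \<open>psd_sqrt\<close> is a Hilbert choice, its defining properties become available only through
  this existence statement.\<close>

lemma psd_sqrt_exists:
  fixes J :: "real ^ 'n ^ 'n::finite"
  assumes sym: "transpose J = J" and psd: "\<And>d. 0 \<le> d \<bullet> (J *v d)"
  shows "\<exists>R. transpose R = R \<and> (\<forall>d. 0 \<le> d \<bullet> (R *v d)) \<and> R ** R = J"
proof -
  obtain B where B: "finite B" "pairwise orthogonal B"
    "\<And>b. b \<in> B \<Longrightarrow> norm b = 1" "\<And>b. b \<in> B \<Longrightarrow> J *v b = (b \<bullet> (J *v b)) *\<^sub>R b"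
    "\<And>x. x = (\<Sum>b\<in>B. (b \<bullet> x) *\<^sub>R b)"
    using symmetric_orthonormal_eigenbasis_on[OF sym, of UNIV] by auto
  define l where "l b = b \<bullet> (J *v b)" for b
  have l0: "0 \<le> l b" for b unfolding l_def by (rule psd)
  define r where "r x = (\<Sum>b\<in>B. (sqrt (l b) * (b \<bullet> x)) *\<^sub>R b)" for x
  have lin: "linear r" unfolding r_def
    by (intro linearI) (simp_all add: inner_add_right algebra_simps sum.distrib scaleR_sum_right)
  define R where "R = matrix r"
  have Rv: "R *v x = r x" for x unfolding R_def using lin by (simp add: matrix_works)
  have rin: "y \<bullet> r x = (\<Sum>b\<in>B. sqrt (l b) * (b \<bullet> x) * (b \<bullet> y))" for x y
    unfolding r_def by (simp add: inner_sum_right inner_commute)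
  have bb: "b \<bullet> c = of_bool (b = c)" if "b \<in> B" "c \<in> B" for b c
    using that B(2,3) by (auto simp: pairwise_def orthogonal_def dot_square_norm)
  have "c \<bullet> r x = sqrt (l c) * (c \<bullet> x)" if "c \<in> B" for c x
  proof -
    have "c \<bullet> r x = (\<Sum>b\<in>B. if b = c then sqrt (l b) * (b \<bullet> x) else 0)"
      unfolding rin using that by (intro sum.cong) (auto simp: bb)
    then show ?thesis using that B(1) by simp
  qed
  then have "r (r x) = (\<Sum>b\<in>B. (l b * (b \<bullet> x)) *\<^sub>R b)" for x
    unfolding r_def[of "r x"] using l0 by (intro sum.cong) (auto simp flip: mult.assoc)
  also have "\<dots> x = J *v x" for x
  proof -
    have "J *v x = J *v (\<Sum>b\<in>B. (b \<bullet> x) *\<^sub>R b)" using B(5) by metis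
    also have "\<dots> = (\<Sum>b\<in>B. (b \<bullet> x) *\<^sub>R (J *v b))"
      by (simp add: linear_sum[OF matrix_vector_mul_linear] matrix_vector_mult_scaleR)
    also have "\<dots> = (\<Sum>b\<in>B. (l b * (b \<bullet> x)) *\<^sub>R b)"
      by (intro sum.cong refl) (metis B(4) l_def mult.commute scaleR_scaleR)
    finally show ?thesis by simp
  qed
  finally have "(R ** R) *v x = J *v x" for x by (simp add: Rv flip: matrix_vector_mul_assoc)
  then have "R ** R = J" by (simp add: matrix_eq)
  moreover have "transpose R = R"
  proof -
    have "(transpose R *v x) \<bullet> y = (R *v x) \<bullet> y" for x y
    proof -
      have "(transpose R *v x) \<bullet> y = x \<bullet> (R *v y)"
        by (metis dot_lmul_matrix transpose_matrix_vector)
      then show ?thesis unfolding Rv by (simp add: rin inner_commute[of "r x"] mult_ac)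
    qed
    then have "transpose R *v x = R *v x" for x by (metis vector_eq_ldot inner_commute)
    then show ?thesis by (simp add: matrix_eq)
  qed
  moreover have "0 \<le> d \<bullet> (R *v d)" for d
    unfolding Rv rin using l0 by (intro sum_nonneg) (simp add: mult.assoc)
  ultimately show ?thesis by blast
qed

lemma norm_psd_sqrt_mult_vec:
  fixes J :: "real ^ 'n ^ 'n::finite"
  assumes "transpose J = J" "\<And>d. 0 \<le> d \<bullet> (J *v d)"
  shows "(norm (psd_sqrt J *v d))\<^sup>2 = d \<bullet> (J *v d)"
proof -
  have R: "transpose (psd_sqrt J) = psd_sqrt J" "psd_sqrt J ** psd_sqrt J = J"
    using someI_ex[OF psd_sqrt_exists[OF assms]] unfolding psd_sqrt_def by auto
  have "(norm (psd_sqrt J *v d))\<^sup>2 = d \<bullet> (transpose (psd_sqrt J) *v (psd_sqrt J *v d))"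
    by (metis dot_lmul_matrix dot_square_norm inner_commute transpose_matrix_vector)
  then show ?thesis by (simp add: R matrix_vector_mul_assoc)
qed

section \<open>Restricted vectors\<close>

text \<open>\<open>top_outside\<close> is a Hilbert choice, so a suitable set must be exhibited: a
  largest remaining component is added at each step until the complement of T is exhausted.\<close>

lemma top_outside_spec:
  fixes d :: "real ^ 'p::finite"
  shows "top_outside T m d \<subseteq> - T" "card (top_outside T m d) = min m (card (- T))"
    "\<And>j k. j \<in> top_outside T m d \<Longrightarrow> k \<in> - T - top_outside T m d \<Longrightarrow> \<bar>d $ k\<bar> \<le> \<bar>d $ j\<bar>"
proof -
  have "\<exists>S. S \<subseteq> - T \<and> card S = min m (card (- T)) \<and> (\<forall>j\<in>S. \<forall>k\<in>- T - S. \<bar>d $ k\<bar> \<le> \<bar>d $ j\<bar>)"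
  proof (induction m)
    case 0
    then show ?case by (intro exI[of _ "{}"]) auto
  next
    case (Suc m)
    then obtain S where S: "S \<subseteq> - T" "card S = min m (card (- T))"
      "\<forall>j\<in>S. \<forall>k\<in>- T - S. \<bar>d $ k\<bar> \<le> \<bar>d $ j\<bar>" by blast
    show ?case
    proof (cases "- T - S = {}")
      case True
      then have "S = - T" using S(1) by blast
      then show ?thesis using S by (intro exI[of _ S]) auto
    next
      case False
      then obtain k where k: "k \<in> - T - S" "(MAX l\<in>- T - S. \<bar>d $ l\<bar>) = \<bar>d $ k\<bar>"
        by (rule obtains_MAX[OF finite])
      then have kmax: "\<bar>d $ l\<bar> \<le> \<bar>d $ k\<bar>" if "l \<in> - T - S" for l
        using that by (metis Max_ge finite finite_imageI imageI)
      have "card S < card (- T)" using S(1) k(1) by (intro psubset_card_mono) auto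
      then have "card (insert k S) = min (Suc m) (card (- T))" using S(2) k(1) by simp
      then show ?thesis using S(1,3) k(1) kmax by (intro exI[of _ "insert k S"]) auto
    qed
  qed
  from someI_ex[OF this]
  show "top_outside T m d \<subseteq> - T" "card (top_outside T m d) = min m (card (- T))"
    "\<And>j k. j \<in> top_outside T m d \<Longrightarrow> k \<in> - T - top_outside T m d \<Longrightarrow> \<bar>d $ k\<bar> \<le> \<bar>d $ j\<bar>"
    unfolding top_outside_def by blast+
qed

lemma norm_restrict_vec_sq: "(norm (restrict_vec T d))\<^sup>2 = (\<Sum>j\<in>T. (d $ j)\<^sup>2)"
proof -
  have "(norm (restrict_vec T d))\<^sup>2 = (\<Sum>j\<in>UNIV. if j \<in> T then (d $ j)\<^sup>2 else 0)"
    unfolding power2_norm_eq_inner inner_vec_def restrict_vec_def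
    by (intro sum.cong) (auto simp: power2_eq_square)
  then show ?thesis by (simp add: sum.If_cases)
qed

lemma norm1_restrict_vec: "norm1 (restrict_vec T d) = (\<Sum>j\<in>T. \<bar>d $ j\<bar>)"
proof -
  have "norm1 (restrict_vec T d) = (\<Sum>j\<in>UNIV. if j \<in> T then \<bar>d $ j\<bar> else 0)"
    unfolding norm1_def restrict_vec_def by (intro sum.cong) auto
  then show ?thesis by (simp add: sum.If_cases)
qed

lemma norm1_restrict_vec_le_norm: "norm1 (restrict_vec T d) \<le> sqrt (card T) * norm (restrict_vec T d)"
proof -
  have "(norm1 (restrict_vec T d))\<^sup>2 \<le> card T * (\<Sum>j\<in>T. \<bar>d $ j\<bar>\<^sup>2)"
    unfolding norm1_restrict_vec
    using sum_squared_le_sum_of_squares[of "\<lambda>j. \<bar>d $ j\<bar>" T] by (simp add: mult.commute)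
  also have "\<dots> = (sqrt (card T) * norm (restrict_vec T d))\<^sup>2"
    by (simp add: power_mult_distrib norm_restrict_vec_sq)
  finally show ?thesis by (rule power2_le_imp_le) simp
qed

lemma norm_restrict_vec_mono: "S \<subseteq> T \<Longrightarrow> norm (restrict_vec S d) \<le> norm (restrict_vec T d)"
proof (rule power2_le_imp_le)
  assume "S \<subseteq> T"
  then show "(norm (restrict_vec S d))\<^sup>2 \<le> (norm (restrict_vec T d))\<^sup>2"
    unfolding norm_restrict_vec_sq by (intro sum_mono2) auto
qed simp

text \<open>Let N be the l1-norm of d outside T. A component beyond the m largest is at most their
  average, hence at most N / m, so the squares of these components sum to at most N^2 / m. The cone
  condition and Cauchy-Schwarz bound N by c sqrt(s) times the l2-norm of d on T.\<close>

lemma norm_le_top_outside: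
  fixes d :: "real ^ 'p::finite"
  assumes cone: "norm1 (restrict_vec (- T) d) \<le> c * norm1 (restrict_vec T d)"
    and c: "0 \<le> c" and T: "card T \<le> s" and m: "0 < m"
  shows "norm d \<le> (1 + c * sqrt (s / m)) * norm (restrict_vec (T \<union> top_outside T m d) d)"
proof -
  define S where "S = top_outside T m d"
  note S = top_outside_spec[where T = T and m = m and d = d, folded S_def]
  define V where "V = - (T \<union> S)"
  define N where "N = norm1 (restrict_vec (- T) d)"
  have N0: "0 \<le> N" unfolding N_def norm1_restrict_vec by (simp add: sum_nonneg)
  have a: "m * \<bar>d $ k\<bar> \<le> N" if "k \<in> V" for k
  proof -
    \<comment> \<open>With fewer than m elements S would exhaust the complement of T, and no index k
      in \<open>V\<close> would be left.\<close>
    have "card S = m"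
    proof (rule ccontr)
      assume "card S \<noteq> m"
      then have "card S = card (- T)" using S(2) by auto
      then have "S = - T" using S(1) by (simp add: card_subset_eq)
      then show False using that unfolding V_def by simp
    qed
    then have "m * \<bar>d $ k\<bar> = (\<Sum>j\<in>S. \<bar>d $ k\<bar>)" by simp
    also have "\<dots> \<le> (\<Sum>j\<in>S. \<bar>d $ j\<bar>)" using that S(3) unfolding V_def by (intro sum_mono) auto
    also have "\<dots> \<le> N" unfolding N_def norm1_restrict_vec using S(1) by (intro sum_mono2) auto
    finally show ?thesis .
  qed
  have "m * (\<Sum>k\<in>V. (d $ k)\<^sup>2) = (\<Sum>k\<in>V. (m * \<bar>d $ k\<bar>) * \<bar>d $ k\<bar>)"
    by (simp add: sum_distrib_left power2_eq_square mult.assoc)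
  also have "\<dots> \<le> (\<Sum>k\<in>V. N * \<bar>d $ k\<bar>)" using a by (intro sum_mono mult_right_mono) auto
  also have "\<dots> \<le> N * N" unfolding sum_distrib_left[symmetric] using N0
    by (intro mult_left_mono) (auto simp: N_def norm1_restrict_vec V_def intro!: sum_mono2)
  finally have "(norm (restrict_vec V d))\<^sup>2 \<le> (N / sqrt m)\<^sup>2"
    using m by (simp add: norm_restrict_vec_sq power_divide pos_le_divide_eq mult.commute power2_eq_square[of N])
  then have "norm (restrict_vec V d) \<le> N / sqrt m" by (rule power2_le_imp_le) (use N0 in simp)
  also have "N / sqrt m \<le> c * (sqrt s * norm (restrict_vec T d)) / sqrt m"
  proof (intro divide_right_mono)
    have "norm1 (restrict_vec T d) \<le> sqrt s * norm (restrict_vec T d)"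
      using norm1_restrict_vec_le_norm[of T d] T
      by (meson dual_order.trans mult_right_mono norm_ge_zero of_nat_le_iff real_sqrt_le_mono)
    then show "N \<le> c * (sqrt s * norm (restrict_vec T d))"
      using cone c unfolding N_def by (meson mult_left_mono order_trans)
  qed simp
  also have "\<dots> = c * sqrt (s / m) * norm (restrict_vec T d)" by (simp add: real_sqrt_divide)
  also have "\<dots> \<le> c * sqrt (s / m) * norm (restrict_vec (T \<union> S) d)"
    using c by (intro mult_left_mono norm_restrict_vec_mono) auto
  finally have "norm (restrict_vec V d) \<le> c * sqrt (s / m) * norm (restrict_vec (T \<union> S) d)" .
  moreover have "d = restrict_vec (T \<union> S) d + restrict_vec V d"
    unfolding V_def restrict_vec_def by (simp add: vec_eq_iff)
  then have "norm d \<le> norm (restrict_vec (T \<union> S) d) + norm (restrict_vec V d)"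
    by (metis norm_triangle_ineq)
  ultimately show ?thesis unfolding S_def by (simp add: algebra_simps)
qed


section \<open>Supports, quantiles and the probability integral transform\<close>

text \<open>The complement of the support is a union of null balls, and by Lindelof countably many
  of them already cover it. The bounds on the conditional density are assumed on the support only,
  so this makes them available almost everywhere.\<close>

lemma AE_law_support:
  fixes N :: "'a::{metric_space, second_countable_topology} measure"
  assumes "finite_measure N" and sets[measurable_cong]: "sets N = sets borel"
  shows "AE v in N. v \<in> law_support N"
proof -
  interpret finite_measure N by fact
  define F where "F = {ball v e | v e. e > 0 \<and> measure N (ball v e) = 0}"
  obtain F' where F': "F' \<subseteq> F" "countable F'" "\<Union>F' = \<Union>F"
    using Lindelof[of F] unfolding F_def by blast
  have "AE v in N. \<forall>B\<in>F'. v \<notin> B"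
    unfolding AE_ball_countable[OF F'(2)]
  proof
    fix B assume "B \<in> F'"
    then obtain v e where "B = ball v e" "measure N (ball v e) = 0" using F'(1) unfolding F_def by blast
    then have "B \<in> null_sets N" by (intro null_setsI) (auto simp: emeasure_eq_measure sets)
    then show "AE v in N. v \<notin> B" by (rule AE_not_in)
  qed
  then show ?thesis
  proof (rule AE_mp, intro AE_I2 impI)
    fix v assume v: "\<forall>B\<in>F'. v \<notin> B"
    show "v \<in> law_support N" unfolding law_support_def
    proof (intro CollectI allI impI, rule ccontr)
      fix e :: real assume "e > 0" "\<not> 0 < measure N (ball v e)"
      then have "ball v e \<in> F" unfolding F_def
        using measure_nonneg[of N "ball v e"] by (force simp: not_less)
      then have "v \<in> \<Union>F'" unfolding F'(3) using \<open>e > 0\<close> centre_in_ball by blast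
      with v show False by blast
    qed
  qed
qed

context real_distribution
begin

text \<open>The infimum defining the quantile is attained, by right-continuity of the cdf; the
  limits at both infinities make the set nonempty and bounded below for \<tau> strictly between 0
  and 1. This equivalence is the only access to conditional quantiles of \<Lambda>.\<close>

lemma quantile_le_iff:
  assumes \<tau>: "0 < \<tau>" "\<tau> < 1"
  shows "quantile M \<tau> \<le> c \<longleftrightarrow> \<tau> \<le> cdf M c"
proof -
  define S where "S = {t. \<tau> \<le> cdf M t}"
  have "eventually (\<lambda>t. \<tau> < cdf M t) at_top"
    using cdf_lim_at_top_prob \<tau>(2) by (rule order_tendstoD)
  then obtain t1 where "\<tau> < cdf M t1" by (meson eventually_happens trivial_limit_at_top_linorder)
  then have ne: "S \<noteq> {}" unfolding S_def by (auto intro: less_imp_le)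
  have "eventually (\<lambda>t. cdf M t < \<tau>) at_bot"
    using cdf_lim_at_bot \<tau>(1) by (rule order_tendstoD)
  then obtain t0 where t0: "cdf M t0 < \<tau>" by (meson eventually_happens trivial_limit_at_bot_linorder)
  have bdd: "bdd_below S"
  proof (rule bdd_belowI)
    fix t assume "t \<in> S"
    then show "t0 \<le> t" using t0 cdf_nondecreasing[of t t0] unfolding S_def by force
  qed
  have q: "quantile M \<tau> = Inf S" unfolding quantile_def S_def ..
  have gt: "\<tau> \<le> cdf M x" if x: "Inf S < x" for x
  proof -
    obtain t where "t \<in> S" "t < x" using x[unfolded cInf_less_iff[OF ne bdd]] by blast
    then show ?thesis using cdf_nondecreasing[of t x] unfolding S_def by simp
  qed
  have "\<tau> \<le> cdf M (Inf S)"
  proof (rule tendsto_lowerbound)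
    show "(cdf M \<longlongrightarrow> cdf M (Inf S)) (at_right (Inf S))"
      using cdf_is_right_cont unfolding continuous_within by blast
    show "eventually (\<lambda>x. \<tau> \<le> cdf M x) (at_right (Inf S))"
      using gt by (auto simp: eventually_at_filter)
  qed simp
  then have "\<tau> \<le> cdf M c" if "Inf S \<le> c" using cdf_nondecreasing[OF that] by simp
  moreover have "Inf S \<le> c" if "\<tau> \<le> cdf M c" using that bdd unfolding S_def by (intro cInf_lower) auto
  ultimately show ?thesis unfolding q by blast
qed

text \<open>Left of the quantile the cdf is below \<tau>, so continuity from the left excludes a
  jump over \<tau>.\<close>

lemma cdf_quantile:
  assumes \<tau>: "0 < \<tau>" "\<tau> < 1" and cont: "isCont (cdf M) (quantile M \<tau>)"
  shows "cdf M (quantile M \<tau>) = \<tau>"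
proof (rule antisym)
  show "\<tau> \<le> cdf M (quantile M \<tau>)" using quantile_le_iff[OF \<tau>] by blast
  show "cdf M (quantile M \<tau>) \<le> \<tau>"
  proof (rule tendsto_upperbound)
    show "(cdf M \<longlongrightarrow> cdf M (quantile M \<tau>)) (at_left (quantile M \<tau>))"
      using cont by (simp add: isCont_def filterlim_at_split)
    show "eventually (\<lambda>x. cdf M x \<le> \<tau>) (at_left (quantile M \<tau>))"
      using quantile_le_iff[OF \<tau>] unfolding eventually_at_filter
      by (intro always_eventually) (metis leI lessThan_iff less_imp_le not_le)
  qed simp
qed

text \<open>The value \<open>t\<close> of \<open>P (F \<le> t)\<close> is squeezed between the measures of \<open>{..x}\<close> for
  \<open>F x = t\<close> and for \<open>F x\<close> slightly larger than \<open>t\<close>, so that flat parts of \<open>F\<close> do no harm.\<close>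

lemma probability_integral_transform:
  assumes cont: "\<And>x. isCont (cdf M) x"
  shows "distr M borel (cdf M) = uniform_measure lborel {0<..<1}"
proof (rule cdf_unique)
  have F[measurable]: "cdf M \<in> borel_measurable M"
    by (simp add: borel_measurable_mono cdf_nondecreasing mono_def)
  show "real_distribution (distr M borel (cdf M))" by simp
  show "real_distribution (uniform_measure lborel {0<..<1})"
    unfolding real_distribution_def real_distribution_axioms_def
    by (auto intro!: prob_space_uniform_measure)
  have ivt: "\<exists>x. cdf M x = t" if t: "0 < t" "t < 1" for t
  proof -
    obtain a where "cdf M a < t"
      using order_tendstoD(2)[OF cdf_lim_at_bot t(1)]
      by (meson eventually_happens trivial_limit_at_bot_linorder)
    moreover obtain b where "t < cdf M b"
      using order_tendstoD(1)[OF cdf_lim_at_top_prob t(2)]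
      by (meson eventually_happens trivial_limit_at_top_linorder)
    moreover have "a \<le> b" using cdf_nondecreasing[of b a] calculation by force
    ultimately show ?thesis using IVT[of "cdf M" a t b] cont by (meson less_imp_le)
  qed
  have upper: "measure M {x. cdf M x \<le> t} \<le> t" if t: "0 \<le> t" "t < 1" for t
  proof (rule field_le_epsilon)
    fix e :: real assume e: "e > 0"
    \<comment> \<open>Capping at the midpoint of t and 1 keeps t' below 1, so that
      \<open>ivt\<close> realizes it as a value of the cdf.\<close>
    define t' where "t' = min (t + e) ((t + 1) / 2)"
    have t': "t < t'" "t' < 1" "t' \<le> t + e" unfolding t'_def using that e by (auto simp: min_less_iff_disj)
    then obtain x where x: "cdf M x = t'" using ivt[of t'] t by fastforce
    have "y \<le> x" if "cdf M y \<le> t" for y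
      using that cdf_nondecreasing[of x y] t'(1) x by linarith
    then have "{x. cdf M x \<le> t} \<subseteq> {..x}" by blast
    then have "measure M {x. cdf M x \<le> t} \<le> measure M {..x}" by (rule finite_measure_mono) simp
    then show "measure M {x. cdf M x \<le> t} \<le> t + e" using x t'(3) by (simp add: cdf_def)
  qed
  have lower: "t \<le> measure M {x. cdf M x \<le> t}" if t: "0 < t" "t < 1" for t
  proof -
    obtain x where x: "cdf M x = t" using ivt t by blast
    have "{y. cdf M y \<le> t} \<in> sets M" using F by measurable
    then have "measure M {..x} \<le> measure M {y. cdf M y \<le> t}"
      using cdf_nondecreasing x by (intro finite_measure_mono) auto
    then show ?thesis using x by (simp add: cdf_def)
  qed
  show "cdf (distr M borel (cdf M)) = cdf (uniform_measure lborel {0<..<1})"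
  proof
    fix t :: real
    have "cdf (distr M borel (cdf M)) t = measure M {x. cdf M x \<le> t}"
      using F by (simp add: cdf_def2[of "distr M borel (cdf M)"] measure_distr vimage_def)
    moreover have "cdf (uniform_measure lborel {0<..<1}) t = measure lborel ({0<..<1} \<inter> {..t})"
      by (simp add: cdf_def2 measure_uniform_measure)
    moreover consider "t < 0" | "t = 0" | "0 < t" "t < 1" | "1 \<le> t" by linarith
    then have "measure M {x. cdf M x \<le> t} = measure lborel ({0<..<1} \<inter> {..t})"
    proof cases
      case 1
      then have "\<not> cdf M x \<le> t" for x using cdf_nonneg[of x] by linarith
      moreover have "{0<..<1} \<inter> {..t} = {}" using 1 by auto
      ultimately have "{x. cdf M x \<le> t} = {}" "{0<..<1} \<inter> {..t} = {}" by blast+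
      then show ?thesis by simp
    next
      case 2
      then have "{0<..<1} \<inter> {..t} = {}" by auto
      then show ?thesis using upper[of t] 2 by (simp add: order_antisym)
    next
      case 3
      then have "{0<..<1} \<inter> {..t} = {0<..t}" by auto
      then show ?thesis using upper[of t] lower[of t] 3 by simp
    next
      case 4
      then have "cdf M x \<le> t" for x using cdf_bounded_prob[of x] by linarith
      then have "{x. cdf M x \<le> t} = UNIV" by blast
      moreover have "{0<..<1} \<inter> {..t} = {0<..<1}" using 4 by auto
      ultimately show ?thesis using prob_space by simp
    qed
    ultimately show "cdf (distr M borel (cdf M)) t = cdf (uniform_measure lborel {0<..<1}) t" by simp
  qed
qed

end

section \<open>Products of pairs\<close>

text \<open>This regroups an i.i.d. sample of pairs into a design and an independent noise vector,
  so that the design can be held fixed. It suffices to compare boxes: the slice of a box at a fixed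
  x is again a box in v, and both integrations factorize.\<close>

lemma distr_zip_PiM:
  assumes I: "finite I" and N: "prob_space N" and V: "prob_space V"
  shows "distr ((\<Pi>\<^sub>M i\<in>I. N) \<Otimes>\<^sub>M (\<Pi>\<^sub>M i\<in>I. V)) (\<Pi>\<^sub>M i\<in>I. N \<Otimes>\<^sub>M V) (\<lambda>(x, v). \<lambda>i\<in>I. (x i, v i))
    = (\<Pi>\<^sub>M i\<in>I. N \<Otimes>\<^sub>M V)"
proof -
  interpret N: prob_space N by fact
  interpret V: prob_space V by fact
  interpret NV: pair_prob_space N V ..
  interpret PN: product_prob_space "\<lambda>_. N" I ..
  interpret PV: product_prob_space "\<lambda>_. V" I ..
  interpret PNV: product_prob_space "\<lambda>_. N \<Otimes>\<^sub>M V" I ..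
  show ?thesis
  proof (rule PNV.PiM_eqI[OF I])
    let ?Z = "\<lambda>(x, v). \<lambda>i\<in>I. (x i, v i)"
    fix A assume A[measurable]: "A i \<in> sets (N \<Otimes>\<^sub>M V)" if "i \<in> I" for i
    define W where "W = ?Z -` (Pi\<^sub>E I A) \<inter> space ((\<Pi>\<^sub>M i\<in>I. N) \<Otimes>\<^sub>M (\<Pi>\<^sub>M i\<in>I. V))"
    have Z: "?Z \<in> (\<Pi>\<^sub>M i\<in>I. N) \<Otimes>\<^sub>M (\<Pi>\<^sub>M i\<in>I. V) \<rightarrow>\<^sub>M (\<Pi>\<^sub>M i\<in>I. N \<Otimes>\<^sub>M V)" by measurable
    have PA: "Pi\<^sub>E I A \<in> sets (\<Pi>\<^sub>M i\<in>I. N \<Otimes>\<^sub>M V)" using A by (intro sets_PiM_I_finite[OF I])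
    have W: "W \<in> sets ((\<Pi>\<^sub>M i\<in>I. N) \<Otimes>\<^sub>M (\<Pi>\<^sub>M i\<in>I. V))" unfolding W_def by (rule measurable_sets[OF Z PA])
    have sl: "Pair x -` A i \<in> sets V" if "i \<in> I" for x i using A[OF that] by (rule sets_Pair1)
    have "emeasure (distr ((\<Pi>\<^sub>M i\<in>I. N) \<Otimes>\<^sub>M (\<Pi>\<^sub>M i\<in>I. V)) (\<Pi>\<^sub>M i\<in>I. N \<Otimes>\<^sub>M V) ?Z) (Pi\<^sub>E I A)
      = emeasure ((\<Pi>\<^sub>M i\<in>I. N) \<Otimes>\<^sub>M (\<Pi>\<^sub>M i\<in>I. V)) W"
      unfolding W_def by (rule emeasure_distr[OF Z PA])
    also have "\<dots> = (\<integral>\<^sup>+x. emeasure (\<Pi>\<^sub>M i\<in>I. V) (Pair x -` W) \<partial>(\<Pi>\<^sub>M i\<in>I. N))"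
      by (rule PV.emeasure_pair_measure_alt[OF W])
    also have "\<dots> = (\<integral>\<^sup>+x. (\<Prod>i\<in>I. emeasure V (Pair (x i) -` A i)) \<partial>(\<Pi>\<^sub>M i\<in>I. N))"
    proof (rule nn_integral_cong)
      fix x assume x: "x \<in> space (\<Pi>\<^sub>M i\<in>I. N)"
      have "Pair x -` W = (\<Pi>\<^sub>E i\<in>I. Pair (x i) -` A i)"
      proof (rule set_eqI)
        fix v
        have "v i \<in> space V" if "i \<in> I" "(x i, v i) \<in> A i" for i
          using that sets.sets_into_space[OF A[OF that(1)]] by (auto simp: space_pair_measure)
        then have "(\<forall>i\<in>I. (x i, v i) \<in> A i) \<longleftrightarrow> (\<forall>i\<in>I. (x i, v i) \<in> A i \<and> v i \<in> space V)" by blast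
        then show "v \<in> Pair x -` W \<longleftrightarrow> v \<in> (\<Pi>\<^sub>E i\<in>I. Pair (x i) -` A i)"
          using x unfolding W_def by (auto simp: space_pair_measure space_PiM PiE_iff)
      qed
      then show "emeasure (\<Pi>\<^sub>M i\<in>I. V) (Pair x -` W) = (\<Prod>i\<in>I. emeasure V (Pair (x i) -` A i))"
        by (simp only: PV.emeasure_PiM[OF I sl])
    qed
    also have "\<dots> = (\<Prod>i\<in>I. \<integral>\<^sup>+x. emeasure V (Pair x -` A i) \<partial>N)"
      by (rule PN.product_nn_integral_prod[OF I]) (rule V.measurable_emeasure_Pair[OF A])
    also have "\<dots> = (\<Prod>i\<in>I. emeasure (N \<Otimes>\<^sub>M V) (A i))"
      by (rule prod.cong[OF refl]) (rule V.emeasure_pair_measure_alt[OF A, symmetric])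
    finally show "emeasure (distr ((\<Pi>\<^sub>M i\<in>I. N) \<Otimes>\<^sub>M (\<Pi>\<^sub>M i\<in>I. V)) (\<Pi>\<^sub>M i\<in>I. N \<Otimes>\<^sub>M V) ?Z) (Pi\<^sub>E I A)
      = (\<Prod>i\<in>I. emeasure (N \<Otimes>\<^sub>M V) (A i))" .
  qed simp
qed


section \<open>The penalty level\<close>

text \<open>The witnesses are the largest elements of U below the rationals, which exist by
  compactness. Approximation from the right is essential because the indicator of v \<le> u is
  right-continuous in u, but not left-continuous.\<close>

lemma countable_right_dense_subset:
  fixes U :: "real set"
  assumes "compact U"
  obtains U0 where "countable U0" "U0 \<subseteq> U"
    "\<And>u. u \<in> U \<Longrightarrow> \<exists>w. (\<forall>k::nat. w k \<in> U0 \<and> u \<le> w k) \<and> w \<longlonglongrightarrow> u"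
proof -
  define U0 where "U0 = (\<lambda>r. Sup (U \<inter> {..r})) ` {r \<in> \<rat>. U \<inter> {..r} \<noteq> {}}"
  have cl: "closed (U \<inter> {..r})" and bd: "bdd_above (U \<inter> {..r})" for r
    using assms by (auto simp: compact_imp_closed closed_Int intro: bdd_aboveI[of _ r])
  have Sup: "Sup (U \<inter> {..r}) \<in> U \<inter> {..r}" if "U \<inter> {..r} \<noteq> {}" for r
    using that cl bd by (intro closed_contains_Sup) auto
  show ?thesis
  proof
    show "countable U0" unfolding U0_def using countable_rat
      by (intro countable_image) (rule countable_subset[of _ \<rat>], auto)
    show "U0 \<subseteq> U" unfolding U0_def using Sup by blast
    fix u assume u: "u \<in> U"
    have "\<exists>w\<in>U0. u \<le> w \<and> w < u + e" if e: "0 < e" for e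
    proof -
      obtain r where r: "r \<in> \<rat>" "u < r" "r < u + e" using Rats_dense_in_real[of u "u + e"] e by auto
      have ne: "U \<inter> {..r} \<noteq> {}" using u r(2) by force
      have "u \<le> Sup (U \<inter> {..r})" using u r(2) bd by (intro cSup_upper) auto
      moreover have "Sup (U \<inter> {..r}) < u + e" using Sup[OF ne] r(3) by simp
      moreover have "Sup (U \<inter> {..r}) \<in> U0" unfolding U0_def using ne r(1) by blast
      ultimately show ?thesis by blast
    qed
    then have "\<exists>w\<in>U0. u \<le> w \<and> w < u + 1 / real (Suc k)" for k by simp
    then obtain w where w: "\<And>k. w k \<in> U0" "\<And>k. u \<le> w k" "\<And>k. w k < u + 1 / real (Suc k)" by metis
    have "w \<longlonglongrightarrow> u"
    proof (rule tendsto_sandwich[of "\<lambda>_. u" _ _ "\<lambda>k. u + 1 / real (Suc k)"])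
      show "(\<lambda>k. u + 1 / real (Suc k)) \<longlonglongrightarrow> u"
        using tendsto_add[OF tendsto_const[of u] LIMSEQ_inverse_real_of_nat] by (simp add: inverse_eq_divide)
    qed (use w in \<open>auto intro!: always_eventually less_imp_le\<close>)
    with w show "\<exists>w. (\<forall>k::nat. w k \<in> U0 \<and> u \<le> w k) \<and> w \<longlonglongrightarrow> u" by blast
  qed
qed

lemma sqrt_var_lower_bound:
  fixes U :: "real set"
  assumes "compact U" "U \<subseteq> {0<..<1}"
  obtains b where "0 < b" "\<And>u. u \<in> U \<Longrightarrow> b \<le> sqrt (u * (1 - u))"
proof (cases "U = {}")
  case False
  have "continuous_on U (\<lambda>u. sqrt (u * (1 - u)))" by (intro continuous_intros)
  from continuous_attains_inf[OF assms(1) False this]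
  obtain w where w: "w \<in> U" "\<And>u. u \<in> U \<Longrightarrow> sqrt (w * (1 - w)) \<le> sqrt (u * (1 - u))" by blast
  moreover have "0 < sqrt (w * (1 - w))" using w(1) assms(2) by auto
  ultimately show ?thesis using that by blast
qed (use that[of 1] in auto)

section \<open>The score process whose supremum is the penalty statistic\<close>

definition score ::
  "nat \<Rightarrow> (nat \<Rightarrow> real ^ 'p::finite) \<Rightarrow> (nat \<Rightarrow> real) \<Rightarrow> 'p \<Rightarrow> real \<Rightarrow> real" where
  "score n X v j u = \<bar>\<Sum>i<n. X i $ j * (u - of_bool (v i \<le> u)) / (sigma_hat n X j * sqrt (u * (1 - u)))\<bar>"

text \<open>A supremum of reals says something only for a bounded family; this bound is what gives
  the supremum in \<open>Lambda_stat\<close> its meaning. Compactness keeps sqrt(u (1 - u)) away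
  from 0, and a vanishing \<open>sigma_hat\<close> is harmless since division by 0 gives 0.\<close>

lemma score_bounded:
  assumes "compact U" "U \<subseteq> {0<..<1}"
  obtains K where "\<And>u j. u \<in> U \<Longrightarrow> score n X v j u \<le> K"
proof -
  obtain b where b: "0 < b" "\<And>u. u \<in> U \<Longrightarrow> b \<le> sqrt (u * (1 - u))"
    using sqrt_var_lower_bound[OF assms] by blast
  define k where "k j = (\<Sum>i<n. \<bar>X i $ j\<bar> / (\<bar>sigma_hat n X j\<bar> * b))" for j
  have k: "score n X v j u \<le> k j" if u: "u \<in> U" for u j
  proof -
    have "score n X v j u \<le> (\<Sum>i<n. \<bar>X i $ j * (u - of_bool (v i \<le> u)) / (sigma_hat n X j * sqrt (u * (1 - u)))\<bar>)"
      unfolding score_def by (rule sum_abs)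
    also have "\<dots> \<le> k j" unfolding k_def
    proof (rule sum_mono)
      fix i
      have su: "0 < sqrt (u * (1 - u))" using b u by (meson less_le_trans)
      have "\<bar>X i $ j * (u - of_bool (v i \<le> u)) / (sigma_hat n X j * sqrt (u * (1 - u)))\<bar>
        = \<bar>X i $ j\<bar> * \<bar>u - of_bool (v i \<le> u)\<bar> * (1 / \<bar>sigma_hat n X j\<bar>) * (1 / sqrt (u * (1 - u)))"
        using su by (simp add: abs_mult abs_divide)
      also have "\<dots> \<le> \<bar>X i $ j\<bar> * 1 * (1 / \<bar>sigma_hat n X j\<bar>) * (1 / b)"
      proof (intro mult_mono order_refl)
        show "\<bar>u - of_bool (v i \<le> u)\<bar> \<le> 1" using u assms(2) by auto
        show "1 / sqrt (u * (1 - u)) \<le> 1 / b" using b(1) b(2)[OF u] by (simp add: frac_le)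
      qed (use su in auto)
      finally show "\<bar>X i $ j * (u - of_bool (v i \<le> u)) / (sigma_hat n X j * sqrt (u * (1 - u)))\<bar>
        \<le> \<bar>X i $ j\<bar> / (\<bar>sigma_hat n X j\<bar> * b)" by simp
    qed
    finally show ?thesis .
  qed
  have "score n X v j u \<le> (MAX j\<in>UNIV. k j)" if "u \<in> U" for u j
    using k[OF that, of j] by (rule order_trans) (rule Max_ge, auto)
  then show ?thesis using that by blast
qed

lemma Lambda_stat_le_iff:
  fixes X :: "nat \<Rightarrow> real ^ 'p::finite"
  assumes U: "compact U" "U \<noteq> {}" "U \<subseteq> {0<..<1}" and n: "0 < n"
  shows "Lambda_stat U n X v \<le> c \<longleftrightarrow> (\<forall>u\<in>U. \<forall>j. score n X v j u \<le> c)"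
proof -
  have eq: "\<bar>emp_mean n (\<lambda>i. X i $ j * (u - of_bool (v i \<le> u)) / (sigma_hat n X j * sqrt (u * (1 - u))))\<bar>
    = score n X v j u / n" for u j
    unfolding emp_mean_def score_def using n by (simp add: abs_divide)
  obtain K where K: "\<And>u j. u \<in> U \<Longrightarrow> score n X v j u \<le> K"
    using score_bounded[OF U(1,3)] by blast
  have bdd: "bdd_above ((\<lambda>u. MAX j\<in>UNIV. score n X v j u / n) ` U)"
    using K n by (intro bdd_aboveI2[of _ _ "K / n"]) (auto simp: divide_right_mono)
  have "Lambda_stat U n X v \<le> c \<longleftrightarrow> (SUP u\<in>U. MAX j\<in>UNIV. score n X v j u / n) \<le> c / n"
    unfolding Lambda_stat_def eq using n by (simp add: field_simps)
  also have "\<dots> \<longleftrightarrow> (\<forall>u\<in>U. (MAX j\<in>UNIV. score n X v j u / n) \<le> c / n)"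
    using cSUP_le_iff[OF U(2) bdd] by blast
  also have "\<dots> \<longleftrightarrow> (\<forall>u\<in>U. \<forall>j. score n X v j u \<le> c)"
    using n by (simp add: divide_le_cancel)
  finally show ?thesis .
qed

text \<open>Along w k \<ge> u tending to u every indicator is eventually constant: if v i \<le> u it
  is 1 throughout, and if u < v i then eventually w k < v i.\<close>

lemma score_le_of_right_dense:
  assumes U: "U \<subseteq> {0<..<1}" and U0: "U0 \<subseteq> U"
    and dense: "\<And>u. u \<in> U \<Longrightarrow> \<exists>w. (\<forall>k::nat. w k \<in> U0 \<and> u \<le> w k) \<and> w \<longlonglongrightarrow> u"
    and le: "\<And>w. w \<in> U0 \<Longrightarrow> score n X v j w \<le> c" and u: "u \<in> U"
  shows "score n X v j u \<le> c"
proof -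
  obtain w where w: "\<And>k::nat. w k \<in> U0" "\<And>k. u \<le> w k" and lim: "w \<longlonglongrightarrow> u"
    using dense[OF u] by blast
  have "eventually (\<lambda>k. of_bool (v i \<le> w k) = (of_bool (v i \<le> u) :: real)) sequentially" for i
  proof (cases "v i \<le> u")
    case True
    then show ?thesis using order_trans[OF True w(2)] by simp
  next
    case False
    then have "eventually (\<lambda>k. w k < v i) sequentially" using lim by (intro order_tendstoD) auto
    then show ?thesis using False by (auto elim: eventually_mono)
  qed
  then have ev: "eventually (\<lambda>k. \<forall>i\<in>{..<n}. of_bool (v i \<le> w k) = (of_bool (v i \<le> u) :: real)) sequentially"
    by (simp only: eventually_ball_finite_distrib finite_lessThan ball_simps) simp
  have u01: "0 < sqrt (u * (1 - u))" using u U by auto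
  \<comment> \<open>\<open>g\<close> freezes the indicators at their values at u; what remains is
    continuous in x and eventually agrees with the score along w.\<close>
  define g where "g x = \<bar>\<Sum>i<n. X i $ j * (x - of_bool (v i \<le> u)) * (1 / sigma_hat n X j) * (1 / sqrt (x * (1 - x)))\<bar>" for x
  have "(\<lambda>k. g (w k)) \<longlonglongrightarrow> g u"
    unfolding g_def using u01 by (intro tendsto_intros lim) auto
  moreover have "eventually (\<lambda>k. g (w k) = score n X v j (w k)) sequentially"
    using ev
  proof eventually_elim
    case (elim k)
    then show ?case unfolding g_def score_def by (intro arg_cong[where f = abs] sum.cong) auto
  qed
  then have "eventually (\<lambda>k. g (w k) \<le> c) sequentially"
    using le[OF w(1)] by (auto elim: eventually_mono)
  ultimately have "g u \<le> c" by (rule tendsto_upperbound) simp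
  then show ?thesis unfolding g_def score_def by simp
qed

text \<open>Points of a finite product space are undefined beyond index n, whereas samples are
  arbitrary there. This congruence allows passing between the two.\<close>

lemma Lambda_stat_cong:
  assumes "\<And>i. i < n \<Longrightarrow> X i = X' i" "\<And>i. i < n \<Longrightarrow> v i = v' i"
  shows "Lambda_stat U n X v = Lambda_stat U n X' v'"
  unfolding Lambda_stat_def sigma_hat_def emp_mean_def using assms by (simp cong: sum.cong_simp)

lemma Lambda_law_cong:
  assumes "\<And>i. i < n \<Longrightarrow> X i = X' i"
  shows "Lambda_law U n X = Lambda_law U n X'"
  using Lambda_stat_cong[OF assms refl] unfolding Lambda_law_def by presburger

section \<open>Measurability of the statistic and of its conditional quantile\<close>

lemma borel_measurable_vec_component [measurable]: "(\<lambda>x :: real ^ 'p::finite. x $ j) \<in> borel_measurable borel"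
  by (intro borel_measurable_continuous_onI continuous_intros)

lemma borel_measurable_sigma_hat:
  fixes X :: "nat \<Rightarrow> 'a \<Rightarrow> real ^ 'p::finite"
  assumes [measurable]: "\<And>i. i < n \<Longrightarrow> X i \<in> borel_measurable M"
  shows "(\<lambda>\<omega>. sigma_hat n (\<lambda>i. X i \<omega>) j) \<in> borel_measurable M"
proof -
  have "(\<lambda>\<omega>. (X i \<omega> $ j)\<^sup>2) \<in> borel_measurable M" if [simp]: "i < n" for i by measurable
  then have [measurable]: "(\<lambda>\<omega>. \<Sum>i<n. (X i \<omega> $ j)\<^sup>2) \<in> borel_measurable M"
    by (intro borel_measurable_sum) auto
  show ?thesis unfolding sigma_hat_def emp_mean_def by measurable
qed

text \<open>An uncountable supremum need not be measurable; by right-continuity the sublevel sets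
  involve only the indices in a countable right-dense subset.\<close>

lemma borel_measurable_Lambda_stat:
  fixes X :: "nat \<Rightarrow> 'a \<Rightarrow> real ^ 'p::finite"
  assumes U: "compact U" "U \<noteq> {}" "U \<subseteq> {0<..<1}" and n: "0 < n"
    and X[measurable]: "\<And>i. i < n \<Longrightarrow> X i \<in> borel_measurable M"
    and v[measurable]: "\<And>i. i < n \<Longrightarrow> v i \<in> borel_measurable M"
  shows "(\<lambda>\<omega>. Lambda_stat U n (\<lambda>i. X i \<omega>) (\<lambda>i. v i \<omega>)) \<in> borel_measurable M"
proof (rule borel_measurableI_le)
  fix c
  obtain U0 where U0: "countable U0" "U0 \<subseteq> U"
    "\<And>u. u \<in> U \<Longrightarrow> \<exists>w. (\<forall>k::nat. w k \<in> U0 \<and> u \<le> w k) \<and> w \<longlonglongrightarrow> u"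
    using countable_right_dense_subset[OF U(1)] by blast
  have "Lambda_stat U n (\<lambda>i. X i \<omega>) (\<lambda>i. v i \<omega>) \<le> c \<longleftrightarrow>
      (\<forall>u\<in>U0. \<forall>j\<in>UNIV. score n (\<lambda>i. X i \<omega>) (\<lambda>i. v i \<omega>) j u \<le> c)" for \<omega>
    unfolding Lambda_stat_le_iff[OF U n] using score_le_of_right_dense[OF U(3) U0(2,3)] U0(2) by blast
  moreover have "(\<lambda>\<omega>. score n (\<lambda>i. X i \<omega>) (\<lambda>i. v i \<omega>) j u) \<in> borel_measurable M" for j u
  proof -
    have [measurable]: "(\<lambda>\<omega>. sigma_hat n (\<lambda>i. X i \<omega>) j) \<in> borel_measurable M"
      using X by (rule borel_measurable_sigma_hat)
    have "(\<lambda>\<omega>. X i \<omega> $ j * (u - of_bool (v i \<omega> \<le> u)) /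
        (sigma_hat n (\<lambda>i. X i \<omega>) j * sqrt (u * (1 - u)))) \<in> borel_measurable M" if [simp]: "i < n" for i
    proof -
      have [measurable]: "X i \<in> borel_measurable M" "v i \<in> borel_measurable M" by auto
      show ?thesis by measurable
    qed
    then show ?thesis unfolding score_def by (intro borel_measurable_abs borel_measurable_sum) auto
  qed
  then have "{\<omega> \<in> space M. \<forall>j\<in>UNIV. score n (\<lambda>i. X i \<omega>) (\<lambda>i. v i \<omega>) j u \<le> c} \<in> sets M" for u
    by (intro sets.sets_Collect_finite_All) auto
  then have "{\<omega> \<in> space M. \<forall>u\<in>U0. \<forall>j\<in>UNIV. score n (\<lambda>i. X i \<omega>) (\<lambda>i. v i \<omega>) j u \<le> c} \<in> sets M"
    by (rule sets.sets_Collect_countable_All'[OF _ U0(1)])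
  ultimately show "{\<omega> \<in> space M. Lambda_stat U n (\<lambda>i. X i \<omega>) (\<lambda>i. v i \<omega>) \<le> c} \<in> sets M" by simp
qed


lemma prob_space_uniform01: "prob_space (uniform_measure lborel {0<..<1::real})"
  by (rule prob_space_uniform_measure) auto

lemma borel_measurable_PiM_component:
  assumes "i \<in> I" "sets (N i) = sets borel"
  shows "(\<lambda>x. x i) \<in> borel_measurable (Pi\<^sub>M I N)"
  using measurable_component_singleton[OF assms(1), of N] measurable_cong_sets[OF refl assms(2)] by blast

context
  fixes U :: "real set" and n :: nat
  assumes U: "compact U" "U \<noteq> {}" "U \<subseteq> {0<..<1}" and n: "0 < n"
begin

private abbreviation "unifs \<equiv> Pi\<^sub>M {..<n} (\<lambda>_. uniform_measure lborel {0<..<1::real})"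

interpretation unifs: prob_space unifs
  by (intro prob_space_PiM prob_space_uniform01)

lemma borel_measurable_Lambda_stat_unifs:
  fixes X :: "nat \<Rightarrow> 'a \<Rightarrow> real ^ 'p::finite"
  assumes "\<And>i. i < n \<Longrightarrow> X i \<in> borel_measurable M"
  shows "(\<lambda>(\<omega>, v). Lambda_stat U n (\<lambda>i. X i \<omega>) v) \<in> borel_measurable (M \<Otimes>\<^sub>M unifs)"
  unfolding split_beta
proof (rule borel_measurable_Lambda_stat[OF U n])
  fix i assume i: "i < n"
  show "(\<lambda>x. X i (fst x)) \<in> borel_measurable (M \<Otimes>\<^sub>M unifs)"
    using measurable_compose[OF measurable_fst assms[OF i]] .
  have "(\<lambda>x. x i) \<in> borel_measurable unifs"
    using i by (intro borel_measurable_PiM_component) auto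
  then show "(\<lambda>x. snd x i) \<in> borel_measurable (M \<Otimes>\<^sub>M unifs)"
    using measurable_compose[OF measurable_snd] by blast
qed

lemma
  fixes X :: "nat \<Rightarrow> real ^ 'p::finite"
  shows borel_measurable_Lambda_stat_fixed: "Lambda_stat U n X \<in> borel_measurable unifs"
    and real_distribution_Lambda_law: "real_distribution (Lambda_law U n X)"
    and measure_Lambda_law: "S \<in> sets borel \<Longrightarrow>
      measure (Lambda_law U n X) S = measure unifs {v \<in> space unifs. Lambda_stat U n X v \<in> S}"
proof -
  show L: "Lambda_stat U n X \<in> borel_measurable unifs"
    using measurable_Pair_compose_split[OF borel_measurable_Lambda_stat_unifs[of "\<lambda>i _. X i" unifs]
        measurable_ident measurable_ident] by (simp add: id_def)
  then show "real_distribution (Lambda_law U n X)"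
    unfolding Lambda_law_def by (rule unifs.real_distribution_distr)
  show "measure (Lambda_law U n X) S = measure unifs {v \<in> space unifs. Lambda_stat U n X v \<in> S}"
    if "S \<in> sets borel"
    unfolding Lambda_law_def measure_distr[OF L that] by (rule arg_cong[where f = "measure unifs"]) auto
qed

text \<open>By \<open>quantile_le_iff\<close> the quantile is at most c exactly if the slice of the
  event \<Lambda> \<le> c at the given design has probability at least \<tau>, and slice
  probabilities are measurable by Fubini.\<close>

lemma borel_measurable_quantile_Lambda_law:
  fixes X :: "nat \<Rightarrow> 'a \<Rightarrow> real ^ 'p::finite"
  assumes \<tau>: "0 < \<tau>" "\<tau> < 1" and X: "\<And>i. i < n \<Longrightarrow> X i \<in> borel_measurable M"
  shows "(\<lambda>\<omega>. quantile (Lambda_law U n (\<lambda>i. X i \<omega>)) \<tau>) \<in> borel_measurable M"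
proof (rule borel_measurableI_le)
  fix c
  define Q where "Q = {x \<in> space (M \<Otimes>\<^sub>M unifs). (\<lambda>(\<omega>, v). Lambda_stat U n (\<lambda>i. X i \<omega>) v) x \<le> c}"
  have "Q \<in> sets (M \<Otimes>\<^sub>M unifs)"
    unfolding Q_def by (intro borel_measurable_le borel_measurable_Lambda_stat_unifs X borel_measurable_const)
  then have "(\<lambda>\<omega>. emeasure unifs (Pair \<omega> -` Q)) \<in> borel_measurable M"
    by (rule unifs.measurable_emeasure_Pair)
  then have "{\<omega> \<in> space M. \<tau> \<le> measure unifs (Pair \<omega> -` Q)} \<in> sets M"
    unfolding measure_def by measurable
  moreover have "quantile (Lambda_law U n (\<lambda>i. X i \<omega>)) \<tau> \<le> c \<longleftrightarrow> \<tau> \<le> measure unifs (Pair \<omega> -` Q)"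
    if \<omega>: "\<omega> \<in> space M" for \<omega>
  proof -
    have "Pair \<omega> -` Q = {v \<in> space unifs. Lambda_stat U n (\<lambda>i. X i \<omega>) v \<in> {..c}}"
      unfolding Q_def using \<omega> by (auto simp: space_pair_measure)
    then show ?thesis
      using real_distribution.quantile_le_iff[OF real_distribution_Lambda_law \<tau>]
      by (simp add: cdf_def measure_Lambda_law)
  qed
  ultimately show "{\<omega> \<in> space M. quantile (Lambda_law U n (\<lambda>i. X i \<omega>)) \<tau> \<le> c} \<in> sets M"
    by (simp cong: conj_cong)
qed

text \<open>For a frozen design the inequality has probability at least \<tau> by the definition of
  the quantile; integrating over the design keeps the bound. The product form of the law of each
  pair expresses that the noise is uniform and independent of the design.\<close>

lemma Lambda_le_quantile_prob:
  fixes X :: "nat \<Rightarrow> 'a \<Rightarrow> real ^ 'p::finite" and v :: "nat \<Rightarrow> 'a \<Rightarrow> real"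
  assumes \<tau>: "0 < \<tau>" "\<tau> < 1" and M: "prob_space M"
    and X: "\<And>i. i < n \<Longrightarrow> X i \<in> borel_measurable M"
    and v: "\<And>i. i < n \<Longrightarrow> v i \<in> borel_measurable M"
    and indep: "prob_space.indep_vars M (\<lambda>_. borel) (\<lambda>i \<omega>. (X i \<omega>, v i \<omega>)) {..<n}"
    and N: "prob_space N" "sets N = sets borel"
    and law: "\<And>i. i < n \<Longrightarrow> distr M borel (\<lambda>\<omega>. (X i \<omega>, v i \<omega>)) = N \<Otimes>\<^sub>M uniform_measure lborel {0<..<1}"
  shows "{\<omega> \<in> space M. Lambda_stat U n (\<lambda>i. X i \<omega>) (\<lambda>i. v i \<omega>) \<le> quantile (Lambda_law U n (\<lambda>i. X i \<omega>)) \<tau>} \<in> sets M"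
    and "\<tau> \<le> measure M {\<omega> \<in> space M. Lambda_stat U n (\<lambda>i. X i \<omega>) (\<lambda>i. v i \<omega>) \<le> quantile (Lambda_law U n (\<lambda>i. X i \<omega>)) \<tau>}"
proof -
  interpret M: prob_space M by fact
  interpret N: prob_space N by fact
  let ?V = "uniform_measure lborel {0<..<1::real}"
  let ?PN = "Pi\<^sub>M {..<n} (\<lambda>_. N)" and ?K = "Pi\<^sub>M {..<n} (\<lambda>_. N \<Otimes>\<^sub>M ?V)"
  let ?Z = "\<lambda>(x, v). \<lambda>i\<in>{..<n}. (x i :: real ^ 'p, v i :: real)"
  interpret PN: prob_space ?PN by (intro prob_space_PiM N)
  define S where "S x w \<longleftrightarrow> Lambda_stat U n x w \<le> quantile (Lambda_law U n x) \<tau>"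
    for x :: "nat \<Rightarrow> real ^ 'p" and w
  \<comment> \<open>Stated for an arbitrary measure space because it serves both the original space
    and the product space of pairs.\<close>
  have S_sets: "{\<omega> \<in> space M. S (\<lambda>i. X i \<omega>) (\<lambda>i. v i \<omega>)} \<in> sets M"
    if "\<And>i. i < n \<Longrightarrow> X i \<in> borel_measurable M" "\<And>i. i < n \<Longrightarrow> v i \<in> borel_measurable M"
    for M :: "'c measure" and X :: "nat \<Rightarrow> 'c \<Rightarrow> real ^ 'p" and v
    unfolding S_def using that
    by (intro borel_measurable_le borel_measurable_Lambda_stat[OF U n] borel_measurable_quantile_Lambda_law \<tau>)
  show "{\<omega> \<in> space M. Lambda_stat U n (\<lambda>i. X i \<omega>) (\<lambda>i. v i \<omega>) \<le> quantile (Lambda_law U n (\<lambda>i. X i \<omega>)) \<tau>} \<in> sets M"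
    using S_sets[OF X v] unfolding S_def .
  have S_cong: "S x w \<longleftrightarrow> S x' w'" if "\<And>i. i < n \<Longrightarrow> x i = x' i" "\<And>i. i < n \<Longrightarrow> w i = w' i" for x x' w w'
    unfolding S_def using Lambda_stat_cong[OF that] Lambda_law_cong[OF that(1)] by simp
  have sV: "sets (N \<Otimes>\<^sub>M ?V) = sets (borel :: ((real ^ 'p) \<times> real) measure)"
    unfolding borel_prod[symmetric] by (intro sets_pair_measure_cong N) simp
  have comp: "(\<lambda>z. z i) \<in> borel_measurable ?K" if "i < n" for i
    using that by (intro borel_measurable_PiM_component sV) auto
  have compf: "(\<lambda>z. fst (z i)) \<in> borel_measurable ?K" "(\<lambda>z. snd (z i)) \<in> borel_measurable ?K" if "i < n" for i
    using measurable_compose[OF comp[OF that], of fst borel] measurable_compose[OF comp[OF that], of snd borel]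
    by (auto simp: borel_measurable_continuous_onI continuous_on_fst continuous_on_snd)
  define SK where "SK = {z \<in> space ?K. S (\<lambda>i. fst (z i)) (\<lambda>i. snd (z i))}"
  have SK: "SK \<in> sets ?K" unfolding SK_def by (rule S_sets) (use compf in auto)
  have Z: "?Z \<in> ?PN \<Otimes>\<^sub>M unifs \<rightarrow>\<^sub>M ?K" by measurable
  \<comment> \<open>Pulled back to this product, the event can be sliced at a fixed design, where
    the conditional quantile is a constant.\<close>
  define SP where "SP = ?Z -` SK \<inter> space (?PN \<Otimes>\<^sub>M unifs)"
  have SP: "SP \<in> sets (?PN \<Otimes>\<^sub>M unifs)" unfolding SP_def by (rule measurable_sets[OF Z SK])
  have slice: "ennreal \<tau> \<le> emeasure unifs (Pair x -` SP)" if x: "x \<in> space ?PN" for x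
  proof -
    have "Pair x -` SP = {w \<in> space unifs. Lambda_stat U n x w \<in> {..quantile (Lambda_law U n x) \<tau>}}"
    proof (rule set_eqI)
      fix w
      have "S (\<lambda>i. fst ((\<lambda>i\<in>{..<n}. (x i, w i)) i)) (\<lambda>i. snd ((\<lambda>i\<in>{..<n}. (x i, w i)) i)) \<longleftrightarrow> S x w"
        by (rule S_cong) auto
      moreover have "w \<in> space unifs \<Longrightarrow> (\<lambda>i\<in>{..<n}. (x i, w i)) \<in> space ?K"
        using x measurable_space[OF Z, of "(x, w)"] by (simp add: space_pair_measure)
      ultimately show "w \<in> Pair x -` SP \<longleftrightarrow>
          w \<in> {w \<in> space unifs. Lambda_stat U n x w \<in> {..quantile (Lambda_law U n x) \<tau>}}"
        unfolding SP_def SK_def using x by (auto simp: space_pair_measure S_def)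
    qed
    then have "measure unifs (Pair x -` SP) = cdf (Lambda_law U n x) (quantile (Lambda_law U n x) \<tau>)"
      by (simp add: cdf_def measure_Lambda_law)
    moreover have "\<tau> \<le> cdf (Lambda_law U n x) (quantile (Lambda_law U n x) \<tau>)"
      using real_distribution.quantile_le_iff[OF real_distribution_Lambda_law \<tau>] by blast
    ultimately show ?thesis by (simp add: unifs.emeasure_eq_measure ennreal_leI)
  qed
  have "ennreal \<tau> = (\<integral>\<^sup>+x. ennreal \<tau> \<partial>?PN)" by (simp add: PN.emeasure_space_1)
  also have "\<dots> \<le> (\<integral>\<^sup>+x. emeasure unifs (Pair x -` SP) \<partial>?PN)"
    by (rule nn_integral_mono) (rule slice)
  also have "\<dots> = emeasure (?PN \<Otimes>\<^sub>M unifs) SP"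
    by (rule unifs.emeasure_pair_measure_alt[OF SP, symmetric])
  also have "\<dots> = emeasure (distr (?PN \<Otimes>\<^sub>M unifs) ?K ?Z) SK"
    unfolding SP_def by (rule emeasure_distr[OF Z SK, symmetric])
  also have "\<dots> = emeasure ?K SK"
    by (subst distr_zip_PiM) (auto intro: N prob_space_uniform01)
  also have "?K = Pi\<^sub>M {..<n} (\<lambda>i. distr M borel (\<lambda>\<omega>. (X i \<omega>, v i \<omega>)))"
    using law by (intro PiM_cong) auto
  also have "\<dots> = distr M (Pi\<^sub>M {..<n} (\<lambda>_. borel)) (\<lambda>\<omega>. \<lambda>i\<in>{..<n}. (X i \<omega>, v i \<omega>))"
    using indep n X v by (subst (asm) M.indep_vars_iff_distr_eq_PiM') auto
  also have "emeasure \<dots> SK = emeasure M ((\<lambda>\<omega>. \<lambda>i\<in>{..<n}. (X i \<omega>, v i \<omega>)) -` SK \<inter> space M)"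
  proof (rule emeasure_distr)
    show "SK \<in> sets (Pi\<^sub>M {..<n} (\<lambda>_. borel))" using SK sets_PiM_cong[OF refl sV] by blast
    show "(\<lambda>\<omega>. \<lambda>i\<in>{..<n}. (X i \<omega>, v i \<omega>)) \<in> M \<rightarrow>\<^sub>M Pi\<^sub>M {..<n} (\<lambda>_. borel)"
      using X v by (intro measurable_restrict) auto
  qed
  also have "(\<lambda>\<omega>. \<lambda>i\<in>{..<n}. (X i \<omega>, v i \<omega>)) -` SK \<inter> space M = {\<omega> \<in> space M. S (\<lambda>i. X i \<omega>) (\<lambda>i. v i \<omega>)}"
  proof (intro set_eqI)
    fix \<omega>
    have "S (\<lambda>i. fst ((\<lambda>i\<in>{..<n}. (X i \<omega>, v i \<omega>)) i)) (\<lambda>i. snd ((\<lambda>i\<in>{..<n}. (X i \<omega>, v i \<omega>)) i))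
      \<longleftrightarrow> S (\<lambda>i. X i \<omega>) (\<lambda>i. v i \<omega>)"
      by (rule S_cong) auto
    moreover have "(\<lambda>i\<in>{..<n}. (X i \<omega>, v i \<omega>)) \<in> space ?K"
      using sets_eq_imp_space_eq[OF sV] by (auto simp: space_PiM)
    ultimately show "\<omega> \<in> (\<lambda>\<omega>. \<lambda>i\<in>{..<n}. (X i \<omega>, v i \<omega>)) -` SK \<inter> space M \<longleftrightarrow>
        \<omega> \<in> {\<omega> \<in> space M. S (\<lambda>i. X i \<omega>) (\<lambda>i. v i \<omega>)}"
      unfolding SK_def by auto
  qed
  finally show "\<tau> \<le> measure M {\<omega> \<in> space M. Lambda_stat U n (\<lambda>i. X i \<omega>) (\<lambda>i. v i \<omega>) \<le> quantile (Lambda_law U n (\<lambda>i. X i \<omega>)) \<tau>}"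
    unfolding S_def using \<tau> by (simp add: M.emeasure_eq_measure)
qed

end


section \<open>The estimator for a fixed sample\<close>

text \<open>As a maximum of two linear functions the loss is visibly convex, with each of the two
  slopes giving a lower bound everywhere; convexity and the subgradient inequality below rest on
  this.\<close>

lemma check_loss_eq_max: "check_loss u t = max (u * t) ((u - 1) * t)"
proof (cases "t \<le> 0")
  case True
  then have "u * t \<le> (u - 1) * t" by (simp add: left_diff_distrib)
  then show ?thesis using True unfolding check_loss_def by (simp add: max_absorb2)
next
  case False
  then have "(u - 1) * t \<le> u * t" by (simp add: left_diff_distrib)
  then show ?thesis using False unfolding check_loss_def by (simp add: max_absorb1)
qed

lemma check_loss_convex:
  assumes "0 \<le> c" "c \<le> 1"
  shows "check_loss u ((1 - c) * a + c * b) \<le> (1 - c) * check_loss u a + c * check_loss u b"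
proof -
  have "k * ((1 - c) * a + c * b) \<le> (1 - c) * check_loss u a + c * check_loss u b"
    if "k = u \<or> k = u - 1" for k
  proof -
    have "k * a \<le> check_loss u a" "k * b \<le> check_loss u b"
      using that unfolding check_loss_eq_max by auto
    then have "(1 - c) * (k * a) + c * (k * b) \<le> (1 - c) * check_loss u a + c * check_loss u b"
      using assms by (intro add_mono mult_left_mono) auto
    then show ?thesis by (simp add: algebra_simps)
  qed
  from this[of u] this[of "u - 1"] show ?thesis
    by (subst check_loss_eq_max) (rule max.boundedI, auto)
qed

lemma check_loss_subgradient: "- ((u - of_bool (t \<le> 0)) * h) \<le> check_loss u (t - h) - check_loss u t"
proof -
  have "u * (t - h) \<le> check_loss u (t - h)" "(u - 1) * (t - h) \<le> check_loss u (t - h)"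
    unfolding check_loss_eq_max by (rule max.cobounded1 max.cobounded2)+
  then show ?thesis unfolding check_loss_def[of u t] by (cases "t \<le> 0") (simp_all add: algebra_simps)
qed

lemma abs_check_loss_diff_le:
  assumes "0 \<le> u" "u \<le> 1"
  shows "\<bar>check_loss u a - check_loss u b\<bar> \<le> \<bar>a - b\<bar>"
proof -
  have "check_loss u a - check_loss u b \<le> \<bar>a - b\<bar>" for a b
  proof -
    have "\<bar>u - of_bool (a \<le> 0)\<bar> \<le> 1" using assms by auto
    then have "\<bar>(u - of_bool (a \<le> 0)) * (a - b)\<bar> \<le> \<bar>a - b\<bar>"
      by (simp add: abs_mult mult_left_le_one_le)
    then show ?thesis using check_loss_subgradient[of u a "a - b"] by simp
  qed
  from this[of a b] this[of b a] show ?thesis by simp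
qed

lemma pen_loss_convex:
  fixes b b' :: "real ^ 'p::finite"
  assumes c: "0 \<le> c" "c \<le> 1" and lam: "0 \<le> lam" and u: "u \<in> {0<..<1}"
  shows "pen_loss n X Y lam u (b + c *\<^sub>R (b' - b)) \<le> (1 - c) * pen_loss n X Y lam u b + c * pen_loss n X Y lam u b'"
proof -
  have emp: "emp_loss n X Y u (b + c *\<^sub>R (b' - b)) \<le> (1 - c) * emp_loss n X Y u b + c * emp_loss n X Y u b'"
  proof -
    have eq: "Y i - X i \<bullet> (b + c *\<^sub>R (b' - b)) = (1 - c) * (Y i - X i \<bullet> b) + c * (Y i - X i \<bullet> b')" for i
      by (simp add: inner_add_right inner_diff_right algebra_simps)
    have "(\<Sum>i<n. check_loss u (Y i - X i \<bullet> (b + c *\<^sub>R (b' - b)))) / n \<le>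
        (\<Sum>i<n. (1 - c) * check_loss u (Y i - X i \<bullet> b) + c * check_loss u (Y i - X i \<bullet> b')) / n"
      unfolding eq by (intro divide_right_mono sum_mono check_loss_convex c) simp
    then show ?thesis
      unfolding emp_loss_def emp_mean_def by (simp add: sum.distrib sum_distrib_left add_divide_distrib)
  qed
  have "(\<Sum>j\<in>UNIV. sigma_hat n X j * \<bar>(b + c *\<^sub>R (b' - b)) $ j\<bar>) \<le>
      (\<Sum>j\<in>UNIV. sigma_hat n X j * ((1 - c) * \<bar>b $ j\<bar> + c * \<bar>b' $ j\<bar>))"
  proof (intro sum_mono mult_left_mono)
    fix j
    have "(b + c *\<^sub>R (b' - b)) $ j = (1 - c) * b $ j + c * b' $ j" by (simp add: algebra_simps)
    then show "\<bar>(b + c *\<^sub>R (b' - b)) $ j\<bar> \<le> (1 - c) * \<bar>b $ j\<bar> + c * \<bar>b' $ j\<bar>"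
      using c abs_triangle_ineq[of "(1 - c) * b $ j" "c * b' $ j"] by (simp add: abs_mult)
    show "0 \<le> sigma_hat n X j" unfolding sigma_hat_def emp_mean_def by (simp add: sum_nonneg)
  qed
  also have "\<dots> = (1 - c) * (\<Sum>j\<in>UNIV. sigma_hat n X j * \<bar>b $ j\<bar>) + c * (\<Sum>j\<in>UNIV. sigma_hat n X j * \<bar>b' $ j\<bar>)"
    by (simp add: sum.distrib sum_distrib_left ring_distribs mult_ac)
  finally have "lam * sqrt (u * (1 - u)) / n * (\<Sum>j\<in>UNIV. sigma_hat n X j * \<bar>(b + c *\<^sub>R (b' - b)) $ j\<bar>) \<le>
      lam * sqrt (u * (1 - u)) / n * ((1 - c) * (\<Sum>j\<in>UNIV. sigma_hat n X j * \<bar>b $ j\<bar>) + c * (\<Sum>j\<in>UNIV. sigma_hat n X j * \<bar>b' $ j\<bar>))"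
    using lam u by (intro mult_left_mono) auto
  with emp have "pen_loss n X Y lam u (b + c *\<^sub>R (b' - b)) \<le> ((1 - c) * emp_loss n X Y u b + c * emp_loss n X Y u b') +
      lam * sqrt (u * (1 - u)) / n * ((1 - c) * (\<Sum>j\<in>UNIV. sigma_hat n X j * \<bar>b $ j\<bar>) + c * (\<Sum>j\<in>UNIV. sigma_hat n X j * \<bar>b' $ j\<bar>))"
    unfolding pen_loss_def by (rule add_mono)
  also have "\<dots> = (1 - c) * pen_loss n X Y lam u b + c * pen_loss n X Y lam u b'"
    unfolding pen_loss_def by (simp only: ring_distribs mult_ac add_ac)
  finally show ?thesis .
qed

section \<open>Sparsity of the estimator\<close>

text \<open>A dimension count: n rows, restricted to the coordinates in S, cannot span a coordinate
  subspace of dimension above n, so some non-zero vector of it is orthogonal to all of them. The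
  restriction does not change inner products with vectors supported on S.\<close>

lemma exists_null_direction:
  fixes X :: "nat \<Rightarrow> real ^ 'p::finite"
  assumes "n < card S"
  obtains d where "d \<noteq> 0" "\<And>j. j \<notin> S \<Longrightarrow> d $ j = 0" "\<And>i. i < n \<Longrightarrow> X i \<bullet> d = 0"
proof -
  define V where "V = {d :: real ^ 'p. \<forall>j. j \<notin> S \<longrightarrow> d $ j = 0}"
  have dimV: "card S \<le> dim V"
  proof -
    have "inj_on (\<lambda>j. axis j (1 :: real) :: real ^ 'p) S" by (auto simp: inj_on_def axis_eq_axis)
    then have "card S = card ((\<lambda>j. axis j (1 :: real) :: real ^ 'p) ` S)" by (simp add: card_image)
    also have "\<dots> \<le> dim V"
    proof (rule independent_card_le_dim)
      show "(\<lambda>j. axis j (1 :: real)) ` S \<subseteq> V" unfolding V_def by (auto simp: axis_def)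
      show "independent ((\<lambda>j. axis j (1 :: real) :: real ^ 'p) ` S)"
        by (rule independent_mono[OF independent_Basis]) (auto simp: Basis_vec_def)
    qed
    finally show ?thesis .
  qed
  have sV: "span V = V" unfolding span_eq_iff V_def subspace_def by auto
  define F where "F = (\<lambda>i. restrict_vec S (X i)) ` {..<n}"
  have FV: "F \<subseteq> V" unfolding F_def V_def restrict_vec_def by auto
  have "dim F \<le> n" unfolding F_def using dim_le_card'[of "(\<lambda>i. restrict_vec S (X i)) ` {..<n}"] card_image_le[of "{..<n}" "\<lambda>i. restrict_vec S (X i)"] by simp
  then have "span F \<noteq> span V" using assms dimV by (metis dim_span not_le order_trans)
  then have "span F \<subset> span V" using span_mono[OF FV] by blast
  then obtain d where d: "d \<noteq> 0" "d \<in> span V" "\<And>y. y \<in> span F \<Longrightarrow> orthogonal d y"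
    by (rule orthogonal_to_subspace_exists_gen) (rule that)
  have dS: "d $ j = 0" if "j \<notin> S" for j
  proof -
    have "d \<in> V" using d(2) sV by simp
    then show ?thesis using that unfolding V_def by simp
  qed
  have "X i \<bullet> d = 0" if "i < n" for i
  proof -
    have "X i \<bullet> d = restrict_vec S (X i) \<bullet> d"
      unfolding inner_vec_def restrict_vec_def using dS by (intro sum.cong) auto
    also have "\<dots> = 0" using d(3)[of "restrict_vec S (X i)"] that
      by (simp add: F_def span_base orthogonal_def inner_commute)
    finally show ?thesis .
  qed
  with d(1) dS show ?thesis using that by blast
qed

text \<open>A non-zero component needs its positive or its negative part among the n basic
  variables; \<open>g\<close> sends a basic variable to its component.\<close>

lemma norm0_lp_beta_le:
  assumes "lp_basic n X z"
  shows "norm0 (lp_beta z :: real ^ 'p::finite) \<le> n"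
proof -
  obtain B where B: "B \<subseteq> lp_vars n" "card B = n" "\<forall>v\<in>lp_vars n - B. z v = 0"
    using assms unfolding lp_basic_def by blast
  define g :: "'p lp_var \<Rightarrow> 'p" where "g v = (case v of BetaPlus j \<Rightarrow> j | BetaMinus j \<Rightarrow> j | _ \<Rightarrow> undefined)" for v
  have "finite B" using B(1) by (rule finite_subset) (simp add: lp_vars_def)
  have "vsupport (lp_beta z) \<subseteq> g ` B"
  proof
    fix j assume "j \<in> vsupport (lp_beta z)"
    then have "z (BetaPlus j) \<noteq> 0 \<or> z (BetaMinus j) \<noteq> 0" unfolding vsupport_def lp_beta_def by auto
    then have "BetaPlus j \<in> B \<or> BetaMinus j \<in> B" using B(3) unfolding lp_vars_def by blast
    then show "j \<in> g ` B" unfolding g_def by force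
  qed
  then have "norm0 (lp_beta z) \<le> card (g ` B)" unfolding norm0_def using \<open>finite B\<close> by (intro card_mono) auto
  also have "\<dots> \<le> n" using card_image_le[OF \<open>finite B\<close>] B(2) by metis
  finally show ?thesis .
qed

text \<open>A unique minimizer \<open>b\<close> has at most \<open>n\<close> non-zero components: otherwise the fit is constant along
  some direction supported on the support of \<open>b\<close>, along which the penalty is linear near \<open>b\<close>.\<close>

lemma norm0_qr_estimator_le:
  fixes b :: "real ^ 'p::finite"
  assumes est: "is_qr_estimator n X Y lam u b"
  shows "norm0 b \<le> n"
proof (rule ccontr)
  assume "\<not> norm0 b \<le> n"
  then have card: "n < card (vsupport b)" unfolding norm0_def by simp
  have min: "pen_loss n X Y lam u b \<le> pen_loss n X Y lam u b'" for b'
    using est unfolding is_qr_estimator_def is_arg_min_linorder by blast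
  obtain d where d: "d \<noteq> 0" "\<And>j. j \<notin> vsupport b \<Longrightarrow> d $ j = 0" "\<And>i. i < n \<Longrightarrow> X i \<bullet> d = 0"
    using exists_null_direction[OF card] by blast
  have ne: "vsupport b \<noteq> {}" using card by auto
  \<comment> \<open>Moving by at most e along d changes no sign of b, so each absolute value is
    linear on that segment. The summand 1 avoids dividing by a vanishing component of d.\<close>
  define e where "e = (MIN j\<in>vsupport b. \<bar>b $ j\<bar> / (\<bar>d $ j\<bar> + 1))"
  have e0: "0 < e" unfolding e_def using ne
    by (subst Min_gr_iff) (auto simp: vsupport_def intro!: divide_pos_pos add_nonneg_pos)
  have small: "\<bar>e * d $ j\<bar> \<le> \<bar>b $ j\<bar>" for j
  proof (cases "j \<in> vsupport b")
    case True
    then have "e \<le> \<bar>b $ j\<bar> / (\<bar>d $ j\<bar> + 1)" unfolding e_def by (intro Min_le) auto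
    then have "e * (\<bar>d $ j\<bar> + 1) \<le> \<bar>b $ j\<bar>" by (simp add: pos_le_divide_eq add_nonneg_pos)
    then show ?thesis using e0 by (simp add: abs_mult algebra_simps)
  qed (use d(2) in auto)
  define k where "k = lam * sqrt (u * (1 - u)) / n * (\<Sum>j\<in>UNIV. sigma_hat n X j * (sgn (b $ j) * d $ j))"
  have move: "pen_loss n X Y lam u (b + t *\<^sub>R d) = pen_loss n X Y lam u b + t * k" if t: "t = e \<or> t = - e" for t
  proof -
    have "\<bar>(b + t *\<^sub>R d) $ j\<bar> = \<bar>b $ j\<bar> + t * (sgn (b $ j) * d $ j)" for j
    proof -
      have "\<bar>t * d $ j\<bar> \<le> \<bar>b $ j\<bar>" using small[of j] t by (auto simp: abs_mult)
      moreover have "b $ j = 0 \<Longrightarrow> d $ j = 0" using d(2) unfolding vsupport_def by blast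
      ultimately show ?thesis by (cases "b $ j" "0 :: real" rule: linorder_cases) auto
    qed
    moreover have "emp_loss n X Y u (b + t *\<^sub>R d) = emp_loss n X Y u b"
      unfolding emp_loss_def emp_mean_def using d(3) by (simp add: inner_add_right)
    ultimately show ?thesis
      unfolding pen_loss_def k_def by (simp add: algebra_simps sum.distrib sum_distrib_left)
  qed
  \<comment> \<open>Minimality against both b + e d and b - e d forces the slope to vanish. So b + e
    d is a second minimizer, and b must come from a basic solution, which has at most n non-zero
    components.\<close>
  have "0 \<le> e * k" using min[of "b + e *\<^sub>R d"] move[of e] by simp
  moreover have "0 \<le> (- e) * k" using min[of "b + (- e) *\<^sub>R d"] move[OF disjI2[OF refl]] by simp
  ultimately have ek: "e * k = 0" by simp
  have "pen_loss n X Y lam u (b + e *\<^sub>R d) = pen_loss n X Y lam u b" using move[of e] ek by simp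
  then have "is_arg_min (pen_loss n X Y lam u) (\<lambda>_. True) (b + e *\<^sub>R d)"
    using min unfolding is_arg_min_linorder by simp
  moreover have "b + e *\<^sub>R d \<noteq> b" using e0 d(1) by simp
  ultimately obtain z where "lp_basic n X z" "b = lp_beta z"
    using est unfolding is_qr_estimator_def by blast
  then have "norm0 b \<le> n" using norm0_lp_beta_le by blast
  with \<open>\<not> norm0 b \<le> n\<close> show False ..
qed

section \<open>The cone condition for the estimation error\<close>

lemma penalty_diff_ge:
  fixes b d :: "real ^ 'p::finite"
  assumes s: "\<And>j. 0 \<le> s j"
  shows "(\<Sum>j\<in>- vsupport b. s j * \<bar>d $ j\<bar>) - (\<Sum>j\<in>vsupport b. s j * \<bar>d $ j\<bar>)
    \<le> (\<Sum>j\<in>UNIV. s j * \<bar>(b + d) $ j\<bar>) - (\<Sum>j\<in>UNIV. s j * \<bar>b $ j\<bar>)"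
proof -
  have split: "(\<Sum>j\<in>UNIV. f j) = (\<Sum>j\<in>vsupport b. f j) + (\<Sum>j\<in>- vsupport b. f j)" for f :: "'p \<Rightarrow> real"
    by (subst sum.union_disjoint[symmetric]) auto
  have "(\<Sum>j\<in>- vsupport b. s j * \<bar>d $ j\<bar>) = (\<Sum>j\<in>- vsupport b. s j * (\<bar>(b + d) $ j\<bar> - \<bar>b $ j\<bar>))"
    by (intro sum.cong) (auto simp: vsupport_def)
  moreover have "(\<Sum>j\<in>vsupport b. s j * (- \<bar>d $ j\<bar>)) \<le> (\<Sum>j\<in>vsupport b. s j * (\<bar>(b + d) $ j\<bar> - \<bar>b $ j\<bar>))"
    by (intro sum_mono mult_left_mono s) auto
  ultimately show ?thesis
    unfolding split by (simp add: sum_negf algebra_simps sum_subtractf)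
qed

text \<open>Let S and S' be the weighted l1-norms of the error on and off the support. Minimality
  against the penalty gain S' - S, and the score bound with factor r = (c - 3) / (c + 3), give S' -
  S \<le> r (S + S'), that is 3 S' \<le> c S. The factor 3 is then spent on the weights, whose ratio
  is at most (3/2) / (1/2).\<close>

lemma qr_estimator_cone:
  fixes b beta :: "real ^ 'p::finite"
  assumes min: "pen_loss n X Y lam u b \<le> pen_loss n X Y lam u beta"
    and n: "0 < n" and lam: "0 < lam" and u: "u \<in> {0<..<1}" and c: "3 < c"
    and sig: "\<And>j. 1 / 2 \<le> sigma_hat n X j" "\<And>j. sigma_hat n X j \<le> 3 / 2"
    and score: "\<And>j. \<bar>\<Sum>i<n. X i $ j * (u - of_bool (Y i \<le> X i \<bullet> beta))\<bar>
      \<le> sigma_hat n X j * sqrt (u * (1 - u)) * (lam * ((c - 3) / (c + 3)))"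
  shows "norm1 (restrict_vec (- vsupport beta) (b - beta)) \<le> c * norm1 (restrict_vec (vsupport beta) (b - beta))"
proof -
  define d where "d = b - beta"
  define T where "T = vsupport beta"
  define s where "s = sqrt (u * (1 - u))"
  have s: "0 < s" unfolding s_def using u by auto
  define r where "r = (c - 3) / (c + 3)"
  have s0: "0 \<le> sigma_hat n X j" for j using sig(1)[of j] by linarith
  define S where "S = (\<Sum>j\<in>T. sigma_hat n X j * \<bar>d $ j\<bar>)"
  define S' where "S' = (\<Sum>j\<in>- T. sigma_hat n X j * \<bar>d $ j\<bar>)"
  have SS: "(\<Sum>j\<in>UNIV. sigma_hat n X j * \<bar>d $ j\<bar>) = S + S'"
    unfolding S_def S'_def by (subst sum.union_disjoint[symmetric]) auto
  have "- (\<Sum>i<n. (u - of_bool (Y i \<le> X i \<bullet> beta)) * (X i \<bullet> d)) =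
      (\<Sum>i<n. - ((u - of_bool (Y i - X i \<bullet> beta \<le> 0)) * (X i \<bullet> d)))" by (simp add: sum_negf)
  also have "\<dots> \<le> (\<Sum>i<n. check_loss u (Y i - X i \<bullet> beta - X i \<bullet> d) - check_loss u (Y i - X i \<bullet> beta))"
    by (intro sum_mono check_loss_subgradient)
  also have "\<dots> = n * (emp_loss n X Y u b - emp_loss n X Y u beta)"
    unfolding emp_loss_def emp_mean_def d_def using n
    by (simp add: inner_diff_right sum_subtractf right_diff_distrib)
  finally have 1: "- (\<Sum>i<n. (u - of_bool (Y i \<le> X i \<bullet> beta)) * (X i \<bullet> d))
    \<le> n * (emp_loss n X Y u b - emp_loss n X Y u beta)" .
  have "(\<Sum>i<n. (u - of_bool (Y i \<le> X i \<bullet> beta)) * (X i \<bullet> d)) =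
      (\<Sum>j\<in>UNIV. d $ j * (\<Sum>i<n. X i $ j * (u - of_bool (Y i \<le> X i \<bullet> beta))))"
    unfolding inner_vec_def sum_distrib_left by (subst sum.swap) (simp add: mult_ac)
  also have "\<dots> \<le> (\<Sum>j\<in>UNIV. \<bar>d $ j\<bar> * (sigma_hat n X j * s * (lam * r)))"
  proof (rule sum_mono)
    fix j
    have "d $ j * (\<Sum>i<n. X i $ j * (u - of_bool (Y i \<le> X i \<bullet> beta)))
      \<le> \<bar>d $ j\<bar> * \<bar>\<Sum>i<n. X i $ j * (u - of_bool (Y i \<le> X i \<bullet> beta))\<bar>"
      unfolding abs_mult[symmetric] by (rule abs_ge_self)
    also have "\<dots> \<le> \<bar>d $ j\<bar> * (sigma_hat n X j * s * (lam * r))"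
      using score[of j] unfolding s_def r_def by (intro mult_left_mono) auto
    finally show "d $ j * (\<Sum>i<n. X i $ j * (u - of_bool (Y i \<le> X i \<bullet> beta)))
      \<le> \<bar>d $ j\<bar> * (sigma_hat n X j * s * (lam * r))" .
  qed
  also have "\<dots> = lam * s * r * (S + S')" unfolding SS[symmetric] by (simp add: sum_distrib_left mult_ac)
  finally have 2: "(\<Sum>i<n. (u - of_bool (Y i \<le> X i \<bullet> beta)) * (X i \<bullet> d)) \<le> lam * s * r * (S + S')" .
  have 3: "S' - S \<le> (\<Sum>j\<in>UNIV. sigma_hat n X j * \<bar>b $ j\<bar>) - (\<Sum>j\<in>UNIV. sigma_hat n X j * \<bar>beta $ j\<bar>)"
    using penalty_diff_ge[where s = "sigma_hat n X" and b = beta and d = d] s0 unfolding S_def S'_def T_def d_def by simp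
  have pen: "n * pen_loss n X Y lam u w = n * emp_loss n X Y u w + lam * s * (\<Sum>j\<in>UNIV. sigma_hat n X j * \<bar>w $ j\<bar>)" for w
    unfolding pen_loss_def s_def using n by (simp add: distrib_left)
  have "n * pen_loss n X Y lam u b \<le> n * pen_loss n X Y lam u beta" using min by (rule mult_left_mono) simp
  then have "n * (emp_loss n X Y u b - emp_loss n X Y u beta) \<le>
    - (lam * s * ((\<Sum>j\<in>UNIV. sigma_hat n X j * \<bar>b $ j\<bar>) - (\<Sum>j\<in>UNIV. sigma_hat n X j * \<bar>beta $ j\<bar>)))"
    unfolding pen by (simp add: right_diff_distrib)
  also have "\<dots> \<le> - (lam * s * (S' - S))"
    using 3 lam s by (simp add: mult_left_mono)
  finally have "lam * s * (S' - S) \<le> lam * s * (r * (S + S'))" using 1 2 by (simp add: mult.assoc)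
  then have "S' - S \<le> r * (S + S')" using lam s by simp
  then have "(c + 3) * (S' - S) \<le> (c - 3) * (S + S')"
    unfolding r_def using c by (simp add: pos_le_divide_eq mult.commute)
  then have "3 * S' \<le> c * S" by (simp add: algebra_simps)
  moreover have "(\<Sum>j\<in>- T. 1 / 2 * \<bar>d $ j\<bar>) \<le> S'" unfolding S'_def by (intro sum_mono mult_right_mono sig) auto
  moreover have "S \<le> (\<Sum>j\<in>T. 3 / 2 * \<bar>d $ j\<bar>)" unfolding S_def by (intro sum_mono mult_right_mono sig) auto
  then have "c * S \<le> c * (3 / 2 * (\<Sum>j\<in>T. \<bar>d $ j\<bar>))" using c by (intro mult_left_mono) (auto simp: sum_distrib_left)
  ultimately have "(\<Sum>j\<in>- T. \<bar>d $ j\<bar>) \<le> c * (\<Sum>j\<in>T. \<bar>d $ j\<bar>)" by (simp flip: sum_divide_distrib)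
  then show ?thesis unfolding norm1_restrict_vec T_def d_def .
qed


section \<open>A lower bound for the constant of the penalty level\<close>

text \<open>With the constant design and the single quantile index \<open>1 / 2\<close>, the statistic takes its maximal value
  \<open>n\<close> with probability at least \<open>2\<^sup>-\<^sup>n\<close>. For \<open>n\<close> of the order of \<open>ln p\<close> this is incompatible with the tail
  bound for a small (or negative) constant.\<close>

lemma C_Lambda_lower_bound:
  assumes C: "is_C_Lambda TYPE('p::finite) C" and p: "3 \<le> CARD('p)"
  shows "1 / 8 < C"
proof (rule ccontr)
  assume "\<not> 1 / 8 < C"
  then have C8: "8 * C \<le> 1" by simp
  define l where "l = ln (real CARD('p))"
  have "1 \<le> ln (3 :: real)" using exp_le by (subst ln_ge_iff) auto
  also have "\<dots> \<le> l" unfolding l_def using p by simp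
  finally have l1: "1 \<le> l" .
  \<comment> \<open>A sample size between l = ln p and 4 l that is at least 3, as
    \<open>is_C_Lambda\<close> demands; the upper bound uses l \<ge> 1.\<close>
  define n where "n = nat \<lceil>l\<rceil> + 2"
  have n: "3 \<le> n" "l \<le> n" "n \<le> 4 * l" unfolding n_def using l1 by linarith+
  have n0: "0 < n" using n(1) by simp
  define X :: "nat \<Rightarrow> real ^ 'p" where "X = (\<lambda>_. \<chi> _. 1)"
  define U where "U = {1 / 2 :: real}"
  have U: "compact U" "U \<noteq> {}" "U \<subseteq> {0<..<1}" unfolding U_def by auto
  have s: "sqrt (1 / 2 * (1 - 1 / 2)) = (1 / 2 :: real)" by (rule real_sqrt_unique) (auto simp: power2_eq_square)
  have "W_max U = 1 / sqrt (1 / 2 * (1 - 1 / 2))" unfolding W_max_def U_def by simp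
  then have W: "W_max U = 2" unfolding s by simp
  have sig: "sigma_hat n X j = 1" for j unfolding sigma_hat_def emp_mean_def X_def using n0 by simp
  define V where "V = uniform_measure lborel {0<..<1::real}"
  interpret V: prob_space V unfolding V_def by (rule prob_space_uniform01)
  interpret PV: product_prob_space "\<lambda>_. V" "{..<n}" ..
  have "measure V {..1 / 2} = 1 / 2"
  proof -
    have "{0<..<1} \<inter> {..1 / 2} = {0<..1 / 2 :: real}" by auto
    then show ?thesis unfolding V_def by (subst measure_uniform_measure) auto
  qed
  then have hV: "emeasure V {..1 / 2} = ennreal (1 / 2)" by (simp only: V.emeasure_eq_measure)
  define B where "B = Pi\<^sub>E {..<n} (\<lambda>_. {..1 / 2 :: real})"
  have "emeasure (Pi\<^sub>M {..<n} (\<lambda>_. V)) B = (\<Prod>i<n. emeasure V {..1 / 2})"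
    unfolding B_def by (rule PV.emeasure_PiM) (auto simp: V_def)
  also have "\<dots> = ennreal ((1 / 2) ^ n)"
    unfolding hV by (subst ennreal_power[symmetric]) simp_all
  finally have mB: "measure (Pi\<^sub>M {..<n} (\<lambda>_. V)) B = (1 / 2) ^ n" by (simp add: measure_def)
  \<comment> \<open>The tail bound is used with k = 4. As \<open>W_max U\<close> is 2, the threshold
    is 8 C sqrt(n l) \<le> n, so it is reached with probability at least 2^(-n) \<ge> exp (- n); the
    tail bound is p^(-15) = exp (- 15 l), too small because n \<le> 4 l.\<close>
  define thr where "thr = 4 * C * W_max U * sqrt (n * l)"
  have thr: "thr \<le> n"
  proof -
    have "thr = 8 * C * sqrt (n * l)" unfolding thr_def W by simp
    also have "\<dots> \<le> 1 * sqrt (n * l)" using C8 l1 by (intro mult_right_mono) auto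
    also have "\<dots> \<le> sqrt (n * n)" using n(2) by (simp only: mult_1 real_sqrt_le_iff) (simp add: mult_left_mono)
    finally show ?thesis by simp
  qed
  have "B \<subseteq> {v \<in> space (Pi\<^sub>M {..<n} (\<lambda>_. V)). Lambda_stat U n X v \<in> {thr..}}"
  proof
    fix v assume v: "v \<in> B"
    then have le: "v i \<le> 1 / 2" if "i < n" for i using that unfolding B_def by (auto simp: PiE_iff)
    have "(\<Sum>i<n. X i $ j * (1 / 2 - of_bool (v i \<le> 1 / 2)) / (sigma_hat n X j * sqrt (1 / 2 * (1 - 1 / 2)))) = (\<Sum>i<n. - 1)" for j
      unfolding s sig using le by (intro sum.cong) (auto simp: X_def)
    then have "score n X v j (1 / 2) = n" for j unfolding score_def by simp
    moreover have "score n X v undefined (1 / 2) \<le> Lambda_stat U n X v"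
      using Lambda_stat_le_iff[OF U n0, of X v "Lambda_stat U n X v"] unfolding U_def by simp
    ultimately have "n \<le> Lambda_stat U n X v" by simp
    moreover have "v \<in> space (Pi\<^sub>M {..<n} (\<lambda>_. V))"
      using v unfolding B_def by (auto simp: space_PiM V_def PiE_iff)
    ultimately show "v \<in> {v \<in> space (Pi\<^sub>M {..<n} (\<lambda>_. V)). Lambda_stat U n X v \<in> {thr..}}" using thr by simp
  qed
  moreover have "{v \<in> space (Pi\<^sub>M {..<n} (\<lambda>_. V)). Lambda_stat U n X v \<in> {thr..}} \<in> sets (Pi\<^sub>M {..<n} (\<lambda>_. V))"
    unfolding V_def by (rule measurable_sets_Collect[OF borel_measurable_Lambda_stat_fixed[OF U n0]]) auto
  ultimately have "(1 / 2) ^ n \<le> measure (Pi\<^sub>M {..<n} (\<lambda>_. V)) {v \<in> space (Pi\<^sub>M {..<n} (\<lambda>_. V)). Lambda_stat U n X v \<in> {thr..}}"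
    unfolding mB[symmetric] by (rule PV.P.finite_measure_mono)
  also have "\<dots> = measure (Lambda_law U n X) {thr..}"
    unfolding V_def by (rule measure_Lambda_law[OF U n0, symmetric]) simp
  also have "\<dots> \<le> real CARD('p) powr (- 4\<^sup>2 + 1)"
  proof -
    have "\<forall>k\<ge>1. measure (Lambda_law U n X) {k * C * W_max U * sqrt (n * l)..} \<le> real CARD('p) powr (- k\<^sup>2 + 1)"
      using C n(1) U unfolding is_C_Lambda_def l_def by blast
    from this[rule_format, of 4] show ?thesis unfolding thr_def by simp
  qed
  also have "\<dots> = exp (- 15 * l)" using p unfolding l_def powr_def by simp
  finally have "(1 / 2) ^ n \<le> exp (- 15 * l)" .
  moreover have "exp (- real n) \<le> (1 / 2) ^ n"
  proof -
    have "exp (- 1) \<le> (1 / 2 :: real)" using exp_ge_add_one_self[of 1] by (simp add: exp_minus field_simps)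
    then have "exp (- 1 :: real) ^ n \<le> (1 / 2) ^ n" by (rule power_mono) simp
    then show ?thesis by (simp flip: exp_of_nat_mult)
  qed
  ultimately have "exp (- real n) \<le> exp (- 15 * l)" by linarith
  then show False using n(3) l1 by simp
qed

section \<open>The expected check loss\<close>

text \<open>Knight's identity with the remainder integral evaluated: it is non-zero only for w
  between 0 and z. At the kink w = 0 the identity can fail, which later costs only a Lebesgue null
  set.\<close>

lemma check_loss_diff_eq:
  assumes "w \<noteq> 0"
  shows "check_loss u (w - z) - check_loss u w =
    - z * (u - of_bool (w \<le> 0)) + \<bar>z - w\<bar> * of_bool (0 \<le> w \<and> w \<le> z \<or> z \<le> w \<and> w \<le> 0)"
  unfolding check_loss_def using assms
  by (cases "w \<le> 0"; cases "w \<le> z") (auto simp: algebra_simps)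

text \<open>The kernel is the remainder of Knight's identity, a triangle between a and a + z; the
  factor c - K |t - a| is the lower bound for a density with value c at a and slope at most K. The
  two cases are the two sides of a, each with a polynomial antiderivative.\<close>

lemma integral_triangle_kernel:
  fixes z c K a :: real
  shows "has_bochner_integral lborel
    (\<lambda>t. \<bar>z - (t - a)\<bar> * of_bool (0 \<le> t - a \<and> t - a \<le> z \<or> z \<le> t - a \<and> t - a \<le> 0) * (c - K * \<bar>t - a\<bar>))
    (c * z\<^sup>2 / 2 - K * \<bar>z\<bar> ^ 3 / 6)"
proof (cases "0 \<le> z")
  case True
  define G where "G t = c * z * (t - a) - c * (t - a)\<^sup>2 / 2 - K * z * (t - a)\<^sup>2 / 2 + K * (t - a) ^ 3 / 3" for t
  define g where "g t = (z - (t - a)) * (c - K * (t - a))" for t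
  have "has_bochner_integral lborel (\<lambda>t. g t * indicator {a..a + z} t) (G (a + z) - G a)"
  proof (rule has_bochner_integral_FTC_Icc_real)
    show "DERIV G t :> g t" for t unfolding G_def g_def
      by (auto intro!: derivative_eq_intros simp: field_simps power2_eq_square)
    show "isCont g t" for t unfolding g_def by (intro continuous_intros)
  qed (use True in simp)
  moreover have "G (a + z) - G a = c * z\<^sup>2 / 2 - K * \<bar>z\<bar> ^ 3 / 6"
    unfolding G_def using True by (simp add: power2_eq_square power3_eq_cube field_simps)
  moreover have "g t * indicator {a..a + z} t = \<bar>z - (t - a)\<bar> * of_bool (0 \<le> t - a \<and> t - a \<le> z \<or> z \<le> t - a \<and> t - a \<le> 0) * (c - K * \<bar>t - a\<bar>)" for t
    using True unfolding g_def by (auto simp: indicator_def)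
  ultimately show ?thesis by simp
next
  case False
  define G where "G t = c * (t - a)\<^sup>2 / 2 + K * (t - a) ^ 3 / 3 - c * z * (t - a) - K * z * (t - a)\<^sup>2 / 2" for t
  define g where "g t = ((t - a) - z) * (c + K * (t - a))" for t
  have "has_bochner_integral lborel (\<lambda>t. g t * indicator {a + z..a} t) (G a - G (a + z))"
  proof (rule has_bochner_integral_FTC_Icc_real)
    show "DERIV G t :> g t" for t unfolding G_def g_def
      by (auto intro!: derivative_eq_intros simp: field_simps power2_eq_square)
    show "isCont g t" for t unfolding g_def by (intro continuous_intros)
  qed (use False in simp)
  moreover have "G a - G (a + z) = c * z\<^sup>2 / 2 - K * \<bar>z\<bar> ^ 3 / 6"
    unfolding G_def using False by (simp add: power2_eq_square power3_eq_cube field_simps)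
  moreover have "g t * indicator {a + z..a} t = \<bar>z - (t - a)\<bar> * of_bool (0 \<le> t - a \<and> t - a \<le> z \<or> z \<le> t - a \<and> t - a \<le> 0) * (c - K * \<bar>t - a\<bar>)" for t
    using False unfolding g_def by (auto simp: indicator_def algebra_simps)
  ultimately show ?thesis by simp
qed

text \<open>Second order expansion at the quantile a. In Knight's identity the linear term has mean
  zero because the mass left of a is u, and the non-negative remainder is integrated against the
  lower bound f a - K |t - a| for the density.\<close>

lemma expected_check_loss_diff_ge:
  fixes f :: "real \<Rightarrow> real"
  assumes f0: "\<And>t. 0 \<le> f t" and f1: "(\<integral>\<^sup>+t. ennreal (f t) \<partial>lborel) = 1" and u: "0 \<le> u" "u \<le> 1"
    and df: "\<And>t. (f has_real_derivative f' t) (at t)" and K: "\<And>t. \<bar>f' t\<bar> \<le> K"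
    and a: "measure (density lborel (\<lambda>t. ennreal (f t))) {..a} = u"
  shows "f a * z\<^sup>2 / 2 - K * \<bar>z\<bar> ^ 3 / 6 \<le> (\<integral>t. f t * (check_loss u (t - (a + z)) - check_loss u (t - a)) \<partial>lborel)"
proof -
  have "continuous_on UNIV f" using df DERIV_isCont continuous_at_imp_continuous_on by blast
  then have fm[measurable]: "f \<in> borel_measurable borel" by (rule borel_measurable_continuous_onI)
  have int: "has_bochner_integral lborel f 1"
    using f0 f1 by (intro has_bochner_integral_nn_integral) auto
  have "f a - K * \<bar>t - a\<bar> \<le> f t" for t
  proof -
    have "norm (f a - f t) \<le> K * norm (a - t)"
      using df K by (intro field_differentiable_bound[of UNIV f f']) auto
    then show ?thesis by (auto simp: abs_minus_commute)
  qed
  note lower = this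
  have ia: "integrable lborel (\<lambda>t. f t * indicator {..a} t)"
    using int by (intro integrable_real_mult_indicator) (auto simp: has_bochner_integral_iff)
  have Fa: "(\<integral>t. f t * indicator {..a} t \<partial>lborel) = u"
  proof -
    have "u = enn2real (\<integral>\<^sup>+t. ennreal (f t) * indicator {..a} t \<partial>lborel)"
      using a by (simp add: measure_def emeasure_density)
    also have "(\<integral>\<^sup>+t. ennreal (f t) * indicator {..a} t \<partial>lborel) = (\<integral>\<^sup>+t. ennreal (f t * indicator {..a} t) \<partial>lborel)"
      by (intro nn_integral_cong) (auto simp: indicator_def)
    also have "\<dots> = ennreal (\<integral>t. f t * indicator {..a} t \<partial>lborel)"
      using ia f0 by (intro nn_integral_eq_integral) auto
    finally show ?thesis using f0 by (simp add: integral_nonneg_AE)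
  qed
  define k where "k t = \<bar>z - (t - a)\<bar> * of_bool (0 \<le> t - a \<and> t - a \<le> z \<or> z \<le> t - a \<and> t - a \<le> 0)" for t
  \<comment> \<open>Knight's identity times f, with the density in the remainder replaced by its
    lower bound; the linear part integrates to - z (u - u) = 0.\<close>
  define g where "g t = - z * (u * f t - f t * indicator {..a} t) + k t * (f a - K * \<bar>t - a\<bar>)" for t
  have "has_bochner_integral lborel g (- z * (u * 1 - u) + (f a * z\<^sup>2 / 2 - K * \<bar>z\<bar> ^ 3 / 6))"
    unfolding g_def k_def
    by (intro has_bochner_integral_add has_bochner_integral_mult_right has_bochner_integral_diff int
        integral_triangle_kernel) (use ia Fa in \<open>simp add: has_bochner_integral_iff\<close>)
  then have g: "integrable lborel g" "integral\<^sup>L lborel g = f a * z\<^sup>2 / 2 - K * \<bar>z\<bar> ^ 3 / 6"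
    by (simp_all add: has_bochner_integral_iff)
  have "integral\<^sup>L lborel g \<le> (\<integral>t. f t * (check_loss u (t - (a + z)) - check_loss u (t - a)) \<partial>lborel)"
  proof (rule integral_mono_AE[OF g(1)])
    show "integrable lborel (\<lambda>t. f t * (check_loss u (t - (a + z)) - check_loss u (t - a)))"
    proof (rule Bochner_Integration.integrable_bound)
      show "integrable lborel (\<lambda>t. f t * \<bar>z\<bar>)" using int by (auto simp: has_bochner_integral_iff)
      show "(\<lambda>t. f t * (check_loss u (t - (a + z)) - check_loss u (t - a))) \<in> borel_measurable lborel"
        unfolding check_loss_def by measurable
      show "AE t in lborel. norm (f t * (check_loss u (t - (a + z)) - check_loss u (t - a))) \<le> norm (f t * \<bar>z\<bar>)"
      proof (intro always_eventually allI)
        fix t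
        have "\<bar>check_loss u (t - (a + z)) - check_loss u (t - a)\<bar> \<le> \<bar>z\<bar>"
          using abs_check_loss_diff_le[OF u, of "t - (a + z)" "t - a"] by simp
        then show "norm (f t * (check_loss u (t - (a + z)) - check_loss u (t - a))) \<le> norm (f t * \<bar>z\<bar>)"
          by (auto simp: abs_mult intro: mult_left_mono)
      qed
    qed
    show "AE t in lborel. g t \<le> f t * (check_loss u (t - (a + z)) - check_loss u (t - a))"
      using AE_lborel_singleton[of a]
    proof eventually_elim
      case (elim t)
      have eq: "check_loss u (t - (a + z)) - check_loss u (t - a) = - z * (u - of_bool (t \<le> a)) + k t"
        using check_loss_diff_eq[of "t - a" u z] elim unfolding k_def by (simp add: algebra_simps)
      have "k t * (f a - K * \<bar>t - a\<bar>) \<le> k t * f t"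
        using lower[of t] by (intro mult_left_mono) (auto simp: k_def)
      then show ?case unfolding eq g_def by (auto simp: indicator_def algebra_simps)
    qed
  qed
  then show ?thesis unfolding g(2) .
qed


section \<open>The conditional law of the response\<close>

locale sparse_quantile_model =
  fixes D :: "('w, 'p::finite) qr_model"
  assumes D0: "cond_setup D" and D1: "cond_D1 D" and D2: "cond_D2 D" and D3: "cond_D3 D" and D4: "cond_D4 D"
begin

sublocale M: prob_space "prob_of D"
  using D0 unfolding cond_setup_def by blast

lemma nobs_pos: "0 < nobs D" and nobs_ge_3: "3 \<le> nobs D" and card_ge_3: "3 \<le> CARD('p)"
  using D1 unfolding cond_D1_def by auto

lemma quants: "compact (quants D)" "quants D \<noteq> {}" "quants D \<subseteq> {0<..<1}"
  using D0 unfolding cond_setup_def by auto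

lemma resp_measurable: "i < nobs D \<Longrightarrow> resp D i \<in> borel_measurable (prob_of D)"
  and regr_measurable: "i < nobs D \<Longrightarrow> regr D i \<in> borel_measurable (prob_of D)"
  using D0 unfolding cond_setup_def by auto

lemmas [measurable] = resp_measurable[OF nobs_pos] regr_measurable[OF nobs_pos]

lemma sets_x_law [measurable_cong, simp]: "sets (x_law D) = sets borel"
  and space_x_law [simp]: "space (x_law D) = UNIV"
  unfolding x_law_def by auto

sublocale N: prob_space "x_law D"
  unfolding x_law_def by (rule M.prob_space_distr) measurable

lemma cdens_nonneg: "0 \<le> cdens D v t"
  and quantile_cdens: "u \<in> quants D \<Longrightarrow>
    AE v in x_law D. quantile (density lborel (\<lambda>t. ennreal (cdens D v t))) u = v \<bullet> coef D u"
  and cdens_differentiable: "v \<in> law_support (x_law D) \<Longrightarrow> cdens D v C1_differentiable_on UNIV"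
  and cdens_le: "v \<in> law_support (x_law D) \<Longrightarrow> \<bar>cdens D v t\<bar> \<le> fbar D"
  and deriv_cdens_le: "v \<in> law_support (x_law D) \<Longrightarrow> \<bar>deriv (cdens D v) t\<bar> \<le> fbar' D"
  and flow_less: "v \<in> law_support (x_law D) \<Longrightarrow> u \<in> quants D \<Longrightarrow> flow D < cdens D v (v \<bullet> coef D u)"
  and flow_pos: "0 < flow D"
  using D1 unfolding cond_D1_def by auto

lemma distributed_regr_resp:
  "distributed (prob_of D) (x_law D \<Otimes>\<^sub>M lborel) (\<lambda>\<omega>. (regr D 0 \<omega>, resp D 0 \<omega>)) (\<lambda>x. ennreal (cdens D (fst x) (snd x)))"
  using D1 unfolding cond_D1_def by (simp add: case_prod_beta')

lemma cdens_measurable [measurable]: "(\<lambda>x. cdens D (fst x) (snd x)) \<in> borel_measurable (x_law D \<Otimes>\<^sub>M lborel)"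
  by (rule distributed_real_measurable[OF cdens_nonneg distributed_regr_resp])

lemma cdens_measurable2 [measurable]: "cdens D v \<in> borel_measurable borel"
  using measurable_compose[OF measurable_Pair1'[of v "x_law D" lborel] cdens_measurable] by simp

text \<open>With respect to its own law the regressor has density 1. Integrating the response out of
  the joint density yields another density of the same law, so the two agree almost
  everywhere.\<close>

lemma cdens_integral_1: "AE v in x_law D. (\<integral>\<^sup>+t. ennreal (cdens D v t) \<partial>lborel) = 1"
proof -
  have "distributed (prob_of D) (x_law D) (regr D 0) (\<lambda>_. 1)"
    unfolding distributed_def
  proof (intro conjI)
    have "density (x_law D) (\<lambda>_. 1) = x_law D" by (rule density_1)
    then show "distr (prob_of D) (x_law D) (regr D 0) = density (x_law D) (\<lambda>_. 1)"
      unfolding x_law_def by (simp cong: distr_cong)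
  qed measurable
  from M.distributed_marginal_eq_joint1[OF lborel.sigma_finite_measure_axioms N.sigma_finite_measure_axioms this distributed_regr_resp]
  show ?thesis by (auto elim: eventually_mono)
qed

definition cond_law :: "real ^ 'p \<Rightarrow> real measure" where
  "cond_law v = density lborel (\<lambda>t. ennreal (cdens D v t))"

text \<open>Collects the design points at which the conditional law behaves as required for all
  quantile indices at once, so that a single null set is discarded.\<close>

definition regular :: "real ^ 'p \<Rightarrow> bool" where
  "regular v \<longleftrightarrow> v \<in> law_support (x_law D) \<and> (\<integral>\<^sup>+t. ennreal (cdens D v t) \<partial>lborel) = 1 \<and>
     (\<forall>u\<in>quants D. cdf (cond_law v) (v \<bullet> coef D u) = u)"

lemma sets_cond_law [simp, measurable_cong]: "sets (cond_law v) = sets borel"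
  unfolding cond_law_def by simp

lemma real_distribution_cond_law:
  assumes "(\<integral>\<^sup>+t. ennreal (cdens D v t) \<partial>lborel) = 1"
  shows "real_distribution (cond_law v)"
  unfolding real_distribution_def real_distribution_axioms_def
  using assms by (auto intro!: prob_spaceI simp: cond_law_def emeasure_density)

lemma isCont_cdf_cond_law:
  assumes "(\<integral>\<^sup>+t. ennreal (cdens D v t) \<partial>lborel) = 1"
  shows "isCont (cdf (cond_law v)) t"
proof -
  interpret F: real_distribution "cond_law v" using assms by (rule real_distribution_cond_law)
  have "emeasure (cond_law v) {t} = (\<integral>\<^sup>+s. ennreal (cdens D v s) * indicator {t} s \<partial>lborel)"
    unfolding cond_law_def by (subst emeasure_density) auto
  also have "\<dots> = (\<integral>\<^sup>+s. 0 \<partial>(lborel :: real measure))"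
  proof (rule nn_integral_cong_AE)
    show "AE s in lborel. ennreal (cdens D v s) * indicator {t} s = 0"
      using AE_lborel_singleton[of t] by eventually_elim simp
  qed
  finally show ?thesis unfolding F.isCont_cdf by (simp add: measure_def)
qed

text \<open>The quantile condition has an exceptional null set for each u, too many to unite. It is
  imposed on a countable dense set of indices and carried to the others by continuity of the
  conditional cdf and of the coefficients.\<close>

lemma AE_regular: "AE v in x_law D. regular v"
proof -
  obtain U0 where U0: "countable U0" "U0 \<subseteq> quants D"
    "\<And>u. u \<in> quants D \<Longrightarrow> \<exists>w. (\<forall>k::nat. w k \<in> U0 \<and> u \<le> w k) \<and> w \<longlonglongrightarrow> u"
    using countable_right_dense_subset[OF quants(1)] by blast
  have "AE v in x_law D. \<forall>u\<in>U0. quantile (cond_law v) u = v \<bullet> coef D u"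
    unfolding AE_ball_countable[OF U0(1)] cond_law_def using quantile_cdens U0(2) by blast
  moreover have "AE v in x_law D. v \<in> law_support (x_law D)"
    by (rule AE_law_support) (auto simp: N.finite_measure_axioms)
  ultimately show ?thesis using cdens_integral_1
  proof eventually_elim
    case (elim v)
    interpret F: real_distribution "cond_law v" using elim(3) by (rule real_distribution_cond_law)
    have cont: "isCont (cdf (cond_law v)) t" for t using elim(3) by (rule isCont_cdf_cond_law)
    have eq: "cdf (cond_law v) (v \<bullet> coef D w) = w" if "w \<in> U0" for w
      using F.cdf_quantile[of w] cont elim(1) that U0(2) quants(3) by (metis greaterThanLessThan_iff subsetD)
    have "cdf (cond_law v) (v \<bullet> coef D u) = u" if u: "u \<in> quants D" for u
    proof -
      obtain w where w: "\<And>k::nat. w k \<in> U0" "w \<longlonglongrightarrow> u" using U0(3)[OF u] by blast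
      have wq: "w k \<in> quants D" for k using w(1) U0(2) by blast
      have "(\<lambda>k. coef D (w k)) \<longlonglongrightarrow> coef D u"
      proof (rule tendstoI)
        fix e :: real assume e: "0 < e"
        have L: "0 < lip D" using D2 unfolding cond_D2_def by blast
        then have "eventually (\<lambda>k. dist (w k) u < e / lip D) sequentially"
          using e by (intro tendstoD w(2)) simp
        then show "eventually (\<lambda>k. dist (coef D (w k)) (coef D u) < e) sequentially"
        proof eventually_elim
          case (elim k)
          have "dist (coef D (w k)) (coef D u) \<le> lip D * \<bar>w k - u\<bar>"
            using D2 wq u unfolding cond_D2_def dist_norm by blast
          also have "\<dots> < e" using elim L by (simp add: dist_real_def field_simps)
          finally show ?case .
        qed
      qed
      then have "(\<lambda>k. cdf (cond_law v) (v \<bullet> coef D (w k))) \<longlonglongrightarrow> cdf (cond_law v) (v \<bullet> coef D u)"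
        by (intro isCont_tendsto_compose[OF cont] tendsto_intros)
      then have "w \<longlonglongrightarrow> cdf (cond_law v) (v \<bullet> coef D u)" using eq w(1) by simp
      then show ?thesis using w(2) LIMSEQ_unique by blast
    qed
    then show ?case unfolding regular_def using elim by blast
  qed
qed

text \<open>Monotonicity alone allows the cdf to stay flat right of the quantile. There, however,
  the density is continuous and above \<open>flow D\<close> at the quantile, so every interval to
  its right carries mass.\<close>

lemma cdf_cond_law_le_iff:
  assumes v: "regular v" and u: "u \<in> quants D"
  shows "cdf (cond_law v) y \<le> u \<longleftrightarrow> y \<le> v \<bullet> coef D u"
proof -
  interpret F: real_distribution "cond_law v"
    using v by (intro real_distribution_cond_law) (simp add: regular_def)
  define a where "a = v \<bullet> coef D u"
  have a: "cdf (cond_law v) a = u" using v u unfolding regular_def a_def by blast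
  have "u < cdf (cond_law v) y" if "a < y"
  proof -
    have vs: "v \<in> law_support (x_law D)" using v unfolding regular_def by blast
    have "continuous_on UNIV (cdens D v)"
      using cdens_differentiable[OF vs] by (rule C1_differentiable_imp_continuous_on)
    then have "(cdens D v \<longlongrightarrow> cdens D v a) (at a)" by (simp add: continuous_on_eq_continuous_at isCont_def)
    then have "eventually (\<lambda>t. flow D < cdens D v t) (at a)"
      using flow_less[OF vs u] unfolding a_def by (rule order_tendstoD)
    then obtain \<delta> where \<delta>: "0 < \<delta>" "\<And>t. t \<noteq> a \<Longrightarrow> dist t a < \<delta> \<Longrightarrow> flow D < cdens D v t"
      unfolding eventually_at by auto
    define b where "b = min y (a + \<delta> / 2)"
    have b: "a < b" "b \<le> y" "b < a + \<delta>" unfolding b_def using that \<delta>(1) by auto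
    have "0 < ennreal (flow D * (b - a))" using flow_pos b(1) by simp
    also have "\<dots> = (\<integral>\<^sup>+t. ennreal (flow D) * indicator {a<..b} t \<partial>lborel)"
      using b(1) flow_pos by (simp add: nn_integral_cmult_indicator ennreal_mult)
    also have "\<dots> \<le> (\<integral>\<^sup>+t. ennreal (cdens D v t) * indicator {a<..b} t \<partial>lborel)"
      using b(3) \<delta>(2) by (intro nn_integral_mono) (auto simp: indicator_def dist_real_def intro!: ennreal_leI[OF less_imp_le])
    also have "\<dots> = emeasure (cond_law v) {a<..b}"
      unfolding cond_law_def by (subst emeasure_density) auto
    also have "\<dots> \<le> emeasure (cond_law v) {a<..y}"
      using b(2) by (intro emeasure_mono) auto
    finally have "0 < measure (cond_law v) {a<..y}" by (simp add: F.emeasure_eq_measure)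
    then show ?thesis using F.cdf_diff_eq[OF that] a by simp
  qed
  moreover have "cdf (cond_law v) y \<le> u" if "y \<le> a" using F.cdf_nondecreasing[OF that] a by simp
  ultimately show ?thesis unfolding a_def by (meson not_le)
qed

section \<open>Uniform ranks and the score at the true coefficients\<close>

lemma cdf_cond_law_measurable [measurable]:
  "(\<lambda>x. cdf (cond_law (fst x)) (snd x)) \<in> borel_measurable (x_law D \<Otimes>\<^sub>M borel)"
proof -
  have "(\<lambda>x. \<integral>\<^sup>+t. ennreal (cdens D (fst x) t) * of_bool (t \<le> snd x) \<partial>lborel) \<in> borel_measurable (x_law D \<Otimes>\<^sub>M (borel :: real measure))"
  proof -
    have [measurable]: "(\<lambda>z. cdens D (fst (fst z)) (snd z)) \<in> borel_measurable ((x_law D \<Otimes>\<^sub>M (borel :: real measure)) \<Otimes>\<^sub>M lborel)"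
    proof -
      have "(\<lambda>z. (fst (fst z), snd z)) \<in> (x_law D \<Otimes>\<^sub>M (borel :: real measure)) \<Otimes>\<^sub>M lborel \<rightarrow>\<^sub>M x_law D \<Otimes>\<^sub>M lborel"
        by measurable
      from measurable_compose[OF this cdens_measurable] show ?thesis by simp
    qed
    show ?thesis by measurable
  qed
  moreover have "cdf (cond_law v) y = enn2real (\<integral>\<^sup>+t. ennreal (cdens D v t) * of_bool (t \<le> y) \<partial>lborel)" for v y
  proof -
    have "emeasure (cond_law v) {..y} = (\<integral>\<^sup>+t. ennreal (cdens D v t) * indicator {..y} t \<partial>lborel)"
      unfolding cond_law_def by (subst emeasure_density) auto
    then show ?thesis unfolding cdf_def measure_def by (simp add: indicator_def of_bool_def cong: if_cong)
  qed
  ultimately show ?thesis by simp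
qed

lemma cdf_cond_law_measurable':
  assumes [measurable]: "f \<in> borel_measurable M" "g \<in> borel_measurable M"
  shows "(\<lambda>\<omega>. cdf (cond_law (f \<omega>)) (g \<omega>)) \<in> borel_measurable M"
  using measurable_compose[OF _ cdf_cond_law_measurable, of "\<lambda>\<omega>. (f \<omega>, g \<omega>)" M] by simp

text \<open>The variables \<open>F(y\<^sub>i | x\<^sub>i)\<close> play the role of the uniform variables \<open>u\<^sub>i\<close> in the definition of \<open>\<Lambda>\<close>.\<close>

lemma distr_regr_cdf:
  assumes i: "i < nobs D"
  shows "distr (prob_of D) borel (\<lambda>\<omega>. (regr D i \<omega>, cdf (cond_law (regr D i \<omega>)) (resp D i \<omega>)))
    = x_law D \<Otimes>\<^sub>M uniform_measure lborel {0<..<1}" (is "?L i = ?R")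
proof -
  note [measurable] = resp_measurable[OF i] regr_measurable[OF i]
  define h where "h z = (snd z, cdf (cond_law (snd z)) (fst z))" for z :: "real \<times> (real ^ 'p)"
  have h: "h \<in> borel_measurable borel"
    unfolding h_def borel_prod[symmetric]
    by (intro measurable_Pair measurable_snd cdf_cond_law_measurable' measurable_fst)
  have "?L i = distr (distr (prob_of D) borel (\<lambda>\<omega>. (resp D i \<omega>, regr D i \<omega>))) borel h"
    by (subst distr_distr[OF h]) (auto simp: h_def comp_def)
  also have "distr (prob_of D) borel (\<lambda>\<omega>. (resp D i \<omega>, regr D i \<omega>)) = distr (prob_of D) borel (\<lambda>\<omega>. (resp D 0 \<omega>, regr D 0 \<omega>))"
    using D1 i unfolding cond_D1_def by blast
  also have "distr \<dots> borel h = ?L 0"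
    by (subst distr_distr[OF h]) (auto simp: h_def comp_def)
  also have "?L 0 = ?R"
  proof (rule measure_eqI)
    show "sets (?L 0) = sets ?R"
      unfolding borel_prod[symmetric] sets_distr by (intro sets_pair_measure_cong) auto
    fix A assume "A \<in> sets (?L 0)"
    then have A: "A \<in> sets ?R" unfolding \<open>sets (?L 0) = sets ?R\<close> .
    then have A'[measurable]: "A \<in> sets (x_law D \<Otimes>\<^sub>M borel)"
      by (simp cong: sets_pair_measure_cong)
    interpret V: prob_space "uniform_measure lborel {0<..<1::real}" by (rule prob_space_uniform01)
    have k: "(\<lambda>x. (fst x, cdf (cond_law (fst x)) (snd x))) \<in> x_law D \<Otimes>\<^sub>M lborel \<rightarrow>\<^sub>M x_law D \<Otimes>\<^sub>M borel"
      by (intro measurable_Pair measurable_fst cdf_cond_law_measurable') simp_all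
    have ind: "(\<lambda>x. indicator A (fst x, cdf (cond_law (fst x)) (snd x)) :: ennreal) \<in> borel_measurable (x_law D \<Otimes>\<^sub>M lborel)"
      using measurable_compose[OF k borel_measurable_indicator[OF A']] .
    have "emeasure (?L 0) A = (\<integral>\<^sup>+\<omega>. indicator A (regr D 0 \<omega>, cdf (cond_law (regr D 0 \<omega>)) (resp D 0 \<omega>)) \<partial>prob_of D)"
    proof -
      have "emeasure (?L 0) A = (\<integral>\<^sup>+z. indicator A z \<partial>?L 0)"
        using \<open>A \<in> sets (?L 0)\<close> by simp
      also have "\<dots> = (\<integral>\<^sup>+\<omega>. indicator A (regr D 0 \<omega>, cdf (cond_law (regr D 0 \<omega>)) (resp D 0 \<omega>)) \<partial>prob_of D)"
      proof (rule nn_integral_distr)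
        show "(\<lambda>\<omega>. (regr D 0 \<omega>, cdf (cond_law (regr D 0 \<omega>)) (resp D 0 \<omega>))) \<in> prob_of D \<rightarrow>\<^sub>M borel"
          unfolding borel_prod[symmetric] by (intro measurable_Pair cdf_cond_law_measurable') measurable
      qed (use \<open>A \<in> sets (?L 0)\<close> in simp)
      finally show ?thesis .
    qed
    also have "\<dots> = (\<integral>\<^sup>+x. ennreal (cdens D (fst x) (snd x)) * indicator A (fst x, cdf (cond_law (fst x)) (snd x)) \<partial>(x_law D \<Otimes>\<^sub>M lborel))"
      using distributed_nn_integral[OF distributed_regr_resp ind] by simp
    also have "\<dots> = (\<integral>\<^sup>+v. \<integral>\<^sup>+t. ennreal (cdens D v t) * indicator A (v, cdf (cond_law v) t) \<partial>lborel \<partial>x_law D)"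
      using ind by (subst lborel.nn_integral_fst[symmetric]) auto
    \<comment> \<open>For a fixed design point the inner integral is the law of the rank, uniform by
      the probability integral transform. As the result does not depend on the point, the joint law
      is a product.\<close>
    also have "\<dots> = (\<integral>\<^sup>+v. emeasure (uniform_measure lborel {0<..<1}) (Pair v -` A) \<partial>x_law D)"
    proof (rule nn_integral_cong_AE)
      show "AE v in x_law D. (\<integral>\<^sup>+t. ennreal (cdens D v t) * indicator A (v, cdf (cond_law v) t) \<partial>lborel)
          = emeasure (uniform_measure lborel {0<..<1}) (Pair v -` A)"
        using cdens_integral_1
      proof eventually_elim
        case (elim v)
        interpret F: real_distribution "cond_law v" using elim by (rule real_distribution_cond_law)
        have cdfm[measurable]: "cdf (cond_law v) \<in> borel_measurable borel"
          by (simp add: borel_measurable_mono F.cdf_nondecreasing mono_def)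
        have Av[measurable]: "Pair v -` A \<in> sets borel" using A' by (rule sets_Pair1)
        have "(\<integral>\<^sup>+t. ennreal (cdens D v t) * indicator A (v, cdf (cond_law v) t) \<partial>lborel)
          = (\<integral>\<^sup>+t. indicator (Pair v -` A) (cdf (cond_law v) t) \<partial>cond_law v)"
          unfolding cond_law_def[of v, symmetric] by (subst (2) cond_law_def, subst nn_integral_density) (auto simp: indicator_def)
        also have "\<dots> = (\<integral>\<^sup>+t. indicator (Pair v -` A) t \<partial>distr (cond_law v) borel (cdf (cond_law v)))"
          by (rule nn_integral_distr[symmetric]) auto
        also have "\<dots> = emeasure (distr (cond_law v) borel (cdf (cond_law v))) (Pair v -` A)" by simp
        also have "distr (cond_law v) borel (cdf (cond_law v)) = uniform_measure lborel {0<..<1}"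
          using isCont_cdf_cond_law[OF elim] by (rule F.probability_integral_transform)
        finally show ?case .
      qed
    qed
    also have "\<dots> = emeasure ?R A"
      by (rule V.emeasure_pair_measure_alt[OF A, symmetric])
    finally show "emeasure (?L 0) A = emeasure ?R A" .
  qed
  finally show ?thesis .
qed

lemma distr_regr: "i < nobs D \<Longrightarrow> distr (prob_of D) borel (regr D i) = x_law D"
proof -
  assume i: "i < nobs D"
  note [measurable] = resp_measurable[OF i] regr_measurable[OF i]
  have s: "(snd :: real \<times> (real ^ 'p) \<Rightarrow> _) \<in> borel_measurable borel"
    unfolding borel_prod[symmetric] by measurable
  have "distr (prob_of D) borel (regr D i) = distr (distr (prob_of D) borel (\<lambda>\<omega>. (resp D i \<omega>, regr D i \<omega>))) borel snd"
    by (subst distr_distr[OF s]) (auto simp: comp_def)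
  also have "distr (prob_of D) borel (\<lambda>\<omega>. (resp D i \<omega>, regr D i \<omega>)) = distr (prob_of D) borel (\<lambda>\<omega>. (resp D 0 \<omega>, regr D 0 \<omega>))"
    using D1 i unfolding cond_D1_def by blast
  also have "distr \<dots> borel snd = x_law D"
    unfolding x_law_def by (subst distr_distr[OF s]) (auto simp: comp_def)
  finally show ?thesis .
qed

text \<open>Off the null set of non-regular design points the indicators of the response below its
  quantile are those of the rank below u, for all u simultaneously. The score at the truth is
  therefore the one in \<Lambda> with the ranks as uniform variables.\<close>

lemma score_event:
  assumes \<alpha>: "0 < \<alpha>" "\<alpha> < 1"
  obtains E where "E \<in> sets (prob_of D)" "1 - \<alpha> \<le> measure (prob_of D) E"
    "\<And>\<omega> u j. \<omega> \<in> E \<Longrightarrow> u \<in> quants D \<Longrightarrow>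
      \<bar>\<Sum>i<nobs D. design D \<omega> i $ j * (u - of_bool (response D \<omega> i \<le> design D \<omega> i \<bullet> coef D u)) /
        (sigma_hat (nobs D) (design D \<omega>) j * sqrt (u * (1 - u)))\<bar>
      \<le> quantile (Lambda_law (quants D) (nobs D) (design D \<omega>)) (1 - \<alpha>)"
proof -
  define V where "V i \<omega> = cdf (cond_law (regr D i \<omega>)) (resp D i \<omega>)" for i \<omega>
  define E1 where "E1 = {\<omega> \<in> space (prob_of D). Lambda_stat (quants D) (nobs D) (\<lambda>i. regr D i \<omega>) (\<lambda>i. V i \<omega>)
    \<le> quantile (Lambda_law (quants D) (nobs D) (\<lambda>i. regr D i \<omega>)) (1 - \<alpha>)}"
  define h where "h z = (snd z, cdf (cond_law (snd z)) (fst z))" for z :: "real \<times> (real ^ 'p)"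
  have h: "h \<in> borel_measurable borel"
    unfolding h_def borel_prod[symmetric]
    by (intro measurable_Pair measurable_snd cdf_cond_law_measurable' measurable_fst)
  have "M.indep_vars (\<lambda>_. borel) (\<lambda>i \<omega>. (resp D i \<omega>, regr D i \<omega>)) {..<nobs D}"
    using D1 unfolding cond_D1_def by blast
  then have "M.indep_vars (\<lambda>_. borel) (\<lambda>i \<omega>. h (resp D i \<omega>, regr D i \<omega>)) {..<nobs D}"
    using h by (rule M.indep_vars_compose2)
  then have indep: "M.indep_vars (\<lambda>_. borel) (\<lambda>i \<omega>. (regr D i \<omega>, V i \<omega>)) {..<nobs D}"
    unfolding h_def V_def by simp
  have Vm: "V i \<in> borel_measurable (prob_of D)" if "i < nobs D" for i
    unfolding V_def using that by (intro cdf_cond_law_measurable' resp_measurable regr_measurable)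
  have \<tau>: "0 < 1 - \<alpha>" "1 - \<alpha> < 1" using \<alpha> by auto
  note E1 = Lambda_le_quantile_prob[OF quants nobs_pos \<tau> M.prob_space_axioms regr_measurable Vm indep
    N.prob_space_axioms sets_x_law, folded E1_def, unfolded V_def, OF _ _ distr_regr_cdf]
  have "AE \<omega> in prob_of D. \<forall>i\<in>{..<nobs D}. regular (regr D i \<omega>)"
  proof (rule AE_finite_allI)
    fix i assume i: "i \<in> {..<nobs D}"
    then have "AE v in distr (prob_of D) borel (regr D i). regular v"
      using AE_regular by (subst distr_regr) auto
    then show "AE \<omega> in prob_of D. regular (regr D i \<omega>)"
      using i by (intro AE_distrD[OF regr_measurable]) auto
  qed simp
  then obtain Z where Z: "{\<omega> \<in> space (prob_of D). \<not> (\<forall>i\<in>{..<nobs D}. regular (regr D i \<omega>))} \<subseteq> Z"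
    "emeasure (prob_of D) Z = 0" "Z \<in> sets (prob_of D)" by (rule AE_E)
  show ?thesis
  proof
    show "E1 - Z \<in> sets (prob_of D)" using E1(1) Z(3) unfolding V_def E1_def by auto
    have "measure (prob_of D) (E1 - Z) = measure (prob_of D) E1"
      using E1(1) Z(2,3) unfolding V_def E1_def by (intro measure_Diff_null_set) (auto intro: null_setsI)
    then show "1 - \<alpha> \<le> measure (prob_of D) (E1 - Z)" using E1(2) unfolding V_def E1_def by simp
    fix \<omega> u j assume \<omega>: "\<omega> \<in> E1 - Z" and u: "u \<in> quants D"
    have reg: "regular (regr D i \<omega>)" if "i < nobs D" for i using \<omega> Z(1) that unfolding E1_def by blast
    have "(\<Sum>i<nobs D. design D \<omega> i $ j * (u - of_bool (response D \<omega> i \<le> design D \<omega> i \<bullet> coef D u)) /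
        (sigma_hat (nobs D) (design D \<omega>) j * sqrt (u * (1 - u)))) =
      (\<Sum>i<nobs D. design D \<omega> i $ j * (u - of_bool (V i \<omega> \<le> u)) /
        (sigma_hat (nobs D) (design D \<omega>) j * sqrt (u * (1 - u))))"
      using cdf_cond_law_le_iff[OF reg u] by (intro sum.cong) (auto simp: V_def design_def response_def)
    then have "\<bar>\<Sum>i<nobs D. design D \<omega> i $ j * (u - of_bool (response D \<omega> i \<le> design D \<omega> i \<bullet> coef D u)) /
        (sigma_hat (nobs D) (design D \<omega>) j * sqrt (u * (1 - u)))\<bar>
      = score (nobs D) (design D \<omega>) (\<lambda>i. V i \<omega>) j u" unfolding score_def by simp
    also have "\<dots> \<le> quantile (Lambda_law (quants D) (nobs D) (design D \<omega>)) (1 - \<alpha>)"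
      using \<omega> u unfolding E1_def Lambda_stat_le_iff[OF quants nobs_pos] design_def by blast
    finally show "\<bar>\<Sum>i<nobs D. design D \<omega> i $ j * (u - of_bool (response D \<omega> i \<le> design D \<omega> i \<bullet> coef D u)) /
        (sigma_hat (nobs D) (design D \<omega>) j * sqrt (u * (1 - u)))\<bar>
      \<le> quantile (Lambda_law (quants D) (nobs D) (design D \<omega>)) (1 - \<alpha>)" .
  qed
qed

end


section \<open>Identifiability\<close>

lemma quadratic_form_integral:
  fixes d :: "real ^ 'p::finite"
  assumes int: "\<And>i j. integrable N (\<lambda>v. g v * (v $ i * v $ j))"
  shows "d \<bullet> ((\<chi> i j. \<integral>v. g v * (v $ i * v $ j) \<partial>N) *v d) = (\<integral>v. g v * (v \<bullet> d)\<^sup>2 \<partial>N)"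
proof -
  have "g v * (v \<bullet> d)\<^sup>2 = (\<Sum>i\<in>UNIV. \<Sum>j\<in>UNIV. d $ i * d $ j * (g v * (v $ i * v $ j)))" for v
    by (simp add: inner_vec_def power2_eq_square sum_product sum_distrib_left mult_ac)
  moreover have "(\<integral>v. (\<Sum>i\<in>UNIV. \<Sum>j\<in>UNIV. d $ i * d $ j * (g v * (v $ i * v $ j))) \<partial>N)
      = (\<Sum>i\<in>UNIV. \<Sum>j\<in>UNIV. d $ i * d $ j * (\<integral>v. g v * (v $ i * v $ j) \<partial>N))"
    using int by (subst Bochner_Integration.integral_sum, simp)+ simp
  ultimately show ?thesis
    by (simp add: inner_vec_def matrix_vector_mult_def sum_distrib_left mult_ac)
qed

context sparse_quantile_model
begin

lemma integrable_norm_sq: "integrable (x_law D) (\<lambda>v. (norm v)\<^sup>2)"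
proof -
  have "integrable (x_law D) (\<lambda>v. (v $ j)\<^sup>2)" for j
  proof (rule ccontr)
    assume "\<not> integrable (x_law D) (\<lambda>v. (v $ j)\<^sup>2)"
    \<comment> \<open>The integral of a non-integrable function is 0 by default, so the
      normalization to 1 already contains integrability.\<close>
    then have "(\<integral>v. (v $ j)\<^sup>2 \<partial>x_law D) = 0" by (rule not_integrable_integral_eq)
    then show False using D3 unfolding cond_D3_def by simp
  qed
  then have "integrable (x_law D) (\<lambda>v. \<Sum>j\<in>UNIV. (v $ j)\<^sup>2)" by simp
  moreover have "(\<Sum>j\<in>UNIV. (v $ j)\<^sup>2) = (norm v)\<^sup>2" for v :: "real ^ 'p"
    unfolding power2_norm_eq_inner by (simp add: inner_vec_def power2_eq_square)
  ultimately show ?thesis by simp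
qed

lemma integrable_inner_sq: "integrable (x_law D) (\<lambda>v. (v \<bullet> d)\<^sup>2)"
proof (rule Bochner_Integration.integrable_bound)
  show "integrable (x_law D) (\<lambda>v. (norm v)\<^sup>2 * (norm d)\<^sup>2)" using integrable_norm_sq by simp
  have "(v \<bullet> d)\<^sup>2 \<le> (norm v)\<^sup>2 * (norm d)\<^sup>2" for v
    using Cauchy_Schwarz_ineq[of v d] by (simp add: power2_norm_eq_inner)
  then show "AE v in x_law D. norm ((v \<bullet> d)\<^sup>2) \<le> norm ((norm v)\<^sup>2 * (norm d)\<^sup>2)" by simp
qed measurable

lemma integrable_inner: "integrable (x_law D) (\<lambda>v. v \<bullet> d)"
proof (rule Bochner_Integration.integrable_bound)
  show "integrable (x_law D) (\<lambda>v. 1 + (v \<bullet> d)\<^sup>2)" using integrable_inner_sq by simp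
  have "\<bar>x\<bar> \<le> 1 + x\<^sup>2" for x :: real
  proof -
    have "0 \<le> (\<bar>x\<bar> - 1)\<^sup>2" by simp
    then have "2 * \<bar>x\<bar> \<le> 1 + x\<^sup>2" unfolding power2_diff by simp
    then show ?thesis using abs_ge_zero[of x] by linarith
  qed
  then show "AE v in x_law D. norm (v \<bullet> d) \<le> norm (1 + (v \<bullet> d)\<^sup>2)" by (simp add: abs_of_nonneg)
qed measurable

lemma cdens_at_measurable [measurable]: "(\<lambda>v. cdens D v (v \<bullet> b)) \<in> borel_measurable (x_law D)"
proof -
  have "(\<lambda>v. (v, v \<bullet> b)) \<in> x_law D \<rightarrow>\<^sub>M x_law D \<Otimes>\<^sub>M lborel" by measurable
  from measurable_compose[OF this cdens_measurable] show ?thesis by simp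
qed

lemma integrable_J: "integrable (x_law D) (\<lambda>v. cdens D v (v \<bullet> b) * (v $ i * v $ j))"
proof (rule Bochner_Integration.integrable_bound)
  show "integrable (x_law D) (\<lambda>v. fbar D * (norm v)\<^sup>2)" using integrable_norm_sq by simp
  have "AE v in x_law D. v \<in> law_support (x_law D)"
    by (rule AE_law_support) (auto simp: N.finite_measure_axioms)
  then show "AE v in x_law D. norm (cdens D v (v \<bullet> b) * (v $ i * v $ j)) \<le> norm (fbar D * (norm v)\<^sup>2)"
  proof eventually_elim
    case (elim v)
    have f: "\<bar>cdens D v (v \<bullet> b)\<bar> \<le> fbar D" using cdens_le[OF elim] .
    then have "\<bar>cdens D v (v \<bullet> b)\<bar> * (\<bar>v $ i\<bar> * \<bar>v $ j\<bar>) \<le> fbar D * (norm v * norm v)"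
      using abs_ge_zero[of "cdens D v (v \<bullet> b)"] by (intro mult_mono component_le_norm_cart) auto
    then show ?case using f by (simp add: abs_mult power2_eq_square)
  qed
qed measurable

lemma Gram_form: "d \<bullet> (Gram D *v d) = (\<integral>v. (v \<bullet> d)\<^sup>2 \<partial>x_law D)"
proof -
  have "integrable (x_law D) (\<lambda>v. 1 * (v $ i * v $ j))" for i j
  proof (rule Bochner_Integration.integrable_bound[OF integrable_norm_sq])
    have "\<bar>v $ i\<bar> * \<bar>v $ j\<bar> \<le> norm v * norm v" for v :: "real ^ 'p"
      by (intro mult_mono component_le_norm_cart) auto
    then show "AE v in x_law D. norm (1 * (v $ i * v $ j)) \<le> norm ((norm v)\<^sup>2)"
      by (simp add: abs_mult power2_eq_square)
  qed measurable
  from quadratic_form_integral[OF this, of d] show ?thesis unfolding Gram_def by simp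
qed

lemma J_norm_sq: "(J_norm D u d)\<^sup>2 = (\<integral>v. cdens D v (v \<bullet> coef D u) * (v \<bullet> d)\<^sup>2 \<partial>x_law D)"
proof -
  have form: "e \<bullet> (J_of D u *v e) = (\<integral>v. cdens D v (v \<bullet> coef D u) * (v \<bullet> e)\<^sup>2 \<partial>x_law D)" for e
    unfolding J_of_def by (rule quadratic_form_integral[OF integrable_J])
  have sym: "transpose (J_of D u) = J_of D u"
    unfolding J_of_def transpose_def by (simp add: vec_eq_iff mult.commute)
  have psd: "0 \<le> e \<bullet> (J_of D u *v e)" for e
    unfolding form using cdens_nonneg by (intro integral_nonneg_AE) simp
  show ?thesis unfolding J_norm_def norm_psd_sqrt_mult_vec[OF sym psd] by (rule form)
qed

lemma integrable_J_form: "integrable (x_law D) (\<lambda>v. cdens D v (v \<bullet> b) * (v \<bullet> d)\<^sup>2)"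
proof -
  have "cdens D v (v \<bullet> b) * (v \<bullet> d)\<^sup>2 = (\<Sum>i\<in>UNIV. \<Sum>j\<in>UNIV. d $ i * d $ j * (cdens D v (v \<bullet> b) * (v $ i * v $ j)))" for v
    by (simp add: inner_vec_def power2_eq_square sum_product sum_distrib_left mult_ac)
  then show ?thesis using integrable_J by simp
qed

text \<open>Converts the norm of J_u into the prediction norm; this is the origin of the extra
  factor 1 / sqrt(\<open>flow D\<close>) in the second and third bound.\<close>

lemma flow_Gram_le_J:
  assumes u: "u \<in> quants D"
  shows "flow D * (\<integral>v. (v \<bullet> d)\<^sup>2 \<partial>x_law D) \<le> (J_norm D u d)\<^sup>2"
proof -
  have "AE v in x_law D. v \<in> law_support (x_law D)"
    by (rule AE_law_support) (auto simp: N.finite_measure_axioms)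
  then have "AE v in x_law D. flow D * (v \<bullet> d)\<^sup>2 \<le> cdens D v (v \<bullet> coef D u) * (v \<bullet> d)\<^sup>2"
    by eventually_elim (intro mult_right_mono less_imp_le[OF flow_less] u, auto)
  then have "(\<integral>v. flow D * (v \<bullet> d)\<^sup>2 \<partial>x_law D) \<le> (J_norm D u d)\<^sup>2"
    unfolding J_norm_sq using integrable_inner_sq integrable_J_form by (intro integral_mono_AE) auto
  then show ?thesis by simp
qed

lemma J_norm_nonneg: "0 \<le> J_norm D u d"
  unfolding J_norm_def by simp

lemma J_norm_scaleR: "J_norm D u (c *\<^sub>R d) = \<bar>c\<bar> * J_norm D u d"
  unfolding J_norm_def by (simp add: matrix_vector_mult_scaleR)

text \<open>The one-dimensional expansion is applied conditionally on x with z = x'd and then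
  integrated. The loss is 1-Lipschitz, so its increments are dominated by |x'd|, which justifies
  Fubini whatever the tails of the response.\<close>

lemma pop_loss_diff_ge_cubic:
  assumes u: "u \<in> quants D" and cubic: "integrable (x_law D) (\<lambda>v. \<bar>v \<bullet> d\<bar> ^ 3)"
  shows "(J_norm D u d)\<^sup>2 / 2 - fbar' D / 6 * (\<integral>v. \<bar>v \<bullet> d\<bar> ^ 3 \<partial>x_law D)
    \<le> pop_loss_diff D u (coef D u + d) (coef D u)"
proof -
  interpret P: pair_sigma_finite "x_law D" lborel ..
  have u01: "0 \<le> u" "u \<le> 1" using u quants(3) by auto
  define b where "b = coef D u"
  define g where "g x = check_loss u (snd x - fst x \<bullet> (b + d)) - check_loss u (snd x - fst x \<bullet> b)" for x
  have gm[measurable]: "g \<in> borel_measurable (x_law D \<Otimes>\<^sub>M lborel)" unfolding g_def check_loss_def by measurable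
  have gb: "\<bar>g x\<bar> \<le> \<bar>fst x \<bullet> d\<bar>" for x
    unfolding g_def using abs_check_loss_diff_le[OF u01, of "snd x - fst x \<bullet> (b + d)" "snd x - fst x \<bullet> b"]
    by (simp add: inner_add_right)
  have "integrable (prob_of D) (\<lambda>\<omega>. regr D 0 \<omega> \<bullet> d)"
    using integrable_inner[of d] unfolding x_law_def by (subst (asm) integrable_distr_eq) auto
  then have "integrable (prob_of D) (\<lambda>\<omega>. g (regr D 0 \<omega>, resp D 0 \<omega>))"
  proof (rule Bochner_Integration.integrable_bound)
    show "(\<lambda>\<omega>. g (regr D 0 \<omega>, resp D 0 \<omega>)) \<in> borel_measurable (prob_of D)"
      unfolding g_def check_loss_def by simp measurable
    show "AE \<omega> in prob_of D. norm (g (regr D 0 \<omega>, resp D 0 \<omega>)) \<le> norm (regr D 0 \<omega> \<bullet> d)"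
      using gb[of "(regr D 0 _, resp D 0 _)"] by simp
  qed
  then have int: "integrable (x_law D \<Otimes>\<^sub>M lborel) (\<lambda>x. cdens D (fst x) (snd x) * g x)"
    using distributed_integrable[OF distributed_regr_resp gm] cdens_nonneg by simp
  have "pop_loss_diff D u (b + d) b = (\<integral>\<omega>. g (regr D 0 \<omega>, resp D 0 \<omega>) \<partial>prob_of D)"
    unfolding pop_loss_diff_def g_def by simp
  also have "\<dots> = (\<integral>x. cdens D (fst x) (snd x) * g x \<partial>(x_law D \<Otimes>\<^sub>M lborel))"
    using distributed_integral[OF distributed_regr_resp gm] cdens_nonneg by simp
  also have "\<dots> = (\<integral>v. \<integral>t. cdens D v t * g (v, t) \<partial>lborel \<partial>x_law D)"
    using P.integral_fst'[OF int] by simp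
  finally have eq: "pop_loss_diff D u (b + d) b = (\<integral>v. \<integral>t. cdens D v t * g (v, t) \<partial>lborel \<partial>x_law D)" .
  have "(\<integral>v. cdens D v (v \<bullet> b) * (v \<bullet> d)\<^sup>2 / 2 - fbar' D / 6 * \<bar>v \<bullet> d\<bar> ^ 3 \<partial>x_law D)
    \<le> (\<integral>v. \<integral>t. cdens D v t * g (v, t) \<partial>lborel \<partial>x_law D)"
  proof (rule integral_mono_AE)
    show "integrable (x_law D) (\<lambda>v. cdens D v (v \<bullet> b) * (v \<bullet> d)\<^sup>2 / 2 - fbar' D / 6 * \<bar>v \<bullet> d\<bar> ^ 3)"
      using integrable_J_form[of b d] cubic by simp
    show "integrable (x_law D) (\<lambda>v. \<integral>t. cdens D v t * g (v, t) \<partial>lborel)"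
      using P.integrable_fst'[OF int] by simp
    show "AE v in x_law D. cdens D v (v \<bullet> b) * (v \<bullet> d)\<^sup>2 / 2 - fbar' D / 6 * \<bar>v \<bullet> d\<bar> ^ 3
      \<le> (\<integral>t. cdens D v t * g (v, t) \<partial>lborel)"
      using AE_regular
    proof eventually_elim
      case (elim v)
      then have vs: "v \<in> law_support (x_law D)" and v1: "(\<integral>\<^sup>+t. ennreal (cdens D v t) \<partial>lborel) = 1"
        and vq: "measure (density lborel (\<lambda>t. ennreal (cdens D v t))) {..v \<bullet> b} = u"
        using u unfolding regular_def cdf_def cond_law_def b_def by auto
      have "(cdens D v has_real_derivative deriv (cdens D v) t) (at t)" for t
        using cdens_differentiable[OF vs] unfolding C1_differentiable_on_eq
        by (simp add: DERIV_deriv_iff_real_differentiable)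
      from expected_check_loss_diff_ge[OF cdens_nonneg v1 u01 this deriv_cdens_le[OF vs] vq, of "v \<bullet> d"]
      show ?case unfolding g_def by (simp add: inner_add_right)
    qed
  qed
  moreover have "(\<integral>v. cdens D v (v \<bullet> b) * (v \<bullet> d)\<^sup>2 / 2 - fbar' D / 6 * \<bar>v \<bullet> d\<bar> ^ 3 \<partial>x_law D)
    = (J_norm D u d)\<^sup>2 / 2 - fbar' D / 6 * (\<integral>v. \<bar>v \<bullet> d\<bar> ^ 3 \<partial>x_law D)"
    unfolding J_norm_sq b_def using integrable_J_form[of "coef D u" d] cubic by simp
  ultimately show ?thesis using eq unfolding b_def by simp
qed

text \<open>The definition of q is scaled for this: with t = J_norm and E3 the third moment of
  |x'd|, it gives (8/3) q fbar' E3 \<le> t^3, and t \<le> 4 q makes the cubic remainder fbar' E3 / 6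
  at most t^2 / 4, half of the quadratic term.\<close>

lemma pop_loss_diff_ge:
  assumes u: "u \<in> quants D" and d: "d \<in> A_of D u" "d \<noteq> 0" and small: "J_norm D u d \<le> 4 * q_of D"
  shows "(J_norm D u d)\<^sup>2 / 4 \<le> pop_loss_diff D u (coef D u + d) (coef D u)"
proof -
  define E2 where "E2 = (\<integral>v. \<bar>v \<bullet> d\<bar> ^ 2 \<partial>x_law D)"
  define E3 where "E3 = (\<integral>v. \<bar>v \<bullet> d\<bar> ^ 3 \<partial>x_law D)"
  define I where "I = (INF u\<in>quants D. INF d\<in>A_of D u - {0}.
       ereal ((\<integral>v. \<bar>v \<bullet> d\<bar> ^ 2 \<partial>x_law D) powr (3 / 2) / (\<integral>v. \<bar>v \<bullet> d\<bar> ^ 3 \<partial>x_law D)))"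
  define F where "F = flow D powr (3 / 2)"
  define q where "q = q_of D"
  define t where "t = J_norm D u d"
  have q: "q = 3 / 8 * (F / fbar' D) * real_of_ereal I" "0 < q"
    using D4 unfolding q_def q_of_def I_def F_def cond_D4_def by auto
  have F0: "0 < F" unfolding F_def using flow_pos by simp
  have I0: "0 \<le> I" unfolding I_def by (intro INF_greatest) (simp add: integral_nonneg_AE)
  \<comment> \<open>\<open>real_of_ereal\<close> sends infinity to 0, so q > 0 also shows that the
    infimum is finite.\<close>
  have "real_of_ereal I \<noteq> 0" using q by auto
  moreover have "0 \<le> real_of_ereal I" using I0 by (simp add: real_of_ereal_pos)
  ultimately have R0: "0 < real_of_ereal I" by simp
  have Ifin: "ereal (real_of_ereal I) = I" using R0 by (cases I) auto
  \<comment> \<open>For a non-positive \<open>fbar' D\<close> the quotient, hence q, would not be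
    positive; division by 0 gives 0.\<close>
  have K0: "0 < fbar' D"
  proof (rule ccontr)
    assume "\<not> 0 < fbar' D"
    then have "F / fbar' D \<le> 0" using F0 by (simp add: divide_nonneg_nonpos)
    then have "3 / 8 * (F / fbar' D) \<le> 0" by linarith
    from mult_nonpos_nonneg[OF this less_imp_le[OF R0]] show False using q by linarith
  qed
  have "I \<le> ereal (E2 powr (3 / 2) / E3)"
    unfolding I_def E2_def E3_def using u d by (intro INF_lower2[OF u] INF_lower) auto
  then have le: "real_of_ereal I \<le> E2 powr (3 / 2) / E3" using Ifin by (metis ereal_less_eq(3))
  \<comment> \<open>A vanishing denominator would make the ratio 0, below its positive infimum. A
    non-zero Bochner integral in turn certifies that the third moment is finite.\<close>
  have "E3 \<noteq> 0" using less_le_trans[OF R0 le] by auto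
  then have cubic: "integrable (x_law D) (\<lambda>v. \<bar>v \<bullet> d\<bar> ^ 3)"
    unfolding E3_def using not_integrable_integral_eq by blast
  have "0 \<le> E3" unfolding E3_def by (simp add: integral_nonneg_AE)
  with \<open>E3 \<noteq> 0\<close> have E3: "0 < E3" by simp
  have E2: "0 \<le> E2" unfolding E2_def by (simp add: integral_nonneg_AE)
  have t0: "0 \<le> t" unfolding t_def by (rule J_norm_nonneg)
  have "flow D * E2 \<le> t\<^sup>2" using flow_Gram_le_J[OF u, of d] unfolding E2_def t_def by simp
  then have "(flow D * E2) powr (3 / 2) \<le> (t\<^sup>2) powr (3 / 2)"
    using flow_pos E2 by (intro powr_mono2) auto
  also have "(t\<^sup>2) powr (3 / 2) = t ^ 3"
  proof (cases "t = 0")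
    case False
    then have "(t\<^sup>2) powr (3 / 2) = (t powr 2) powr (3 / 2)" using t0 by (simp add: powr_numeral)
    also have "\<dots> = t powr 3" by (simp add: powr_powr)
    finally show ?thesis using False t0 by (simp add: powr_numeral)
  qed simp
  finally have pw: "F * E2 powr (3 / 2) \<le> t ^ 3" unfolding F_def using flow_pos E2 by (simp add: powr_mult)
  have "real_of_ereal I * E3 \<le> E2 powr (3 / 2)" using le E3 by (simp add: pos_le_divide_eq)
  then have "F * (real_of_ereal I * E3) \<le> t ^ 3" using pw F0 by (meson mult_left_mono less_imp_le order_trans)
  moreover have "F * real_of_ereal I = 8 / 3 * q * fbar' D" using q(1) K0 by (simp add: field_simps)
  ultimately have "8 / 3 * q * (fbar' D * E3) \<le> t ^ 3" by (simp add: mult.assoc[symmetric])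
  also have "t ^ 3 \<le> t\<^sup>2 * (4 * q)"
    using small t0 unfolding t_def q_def by (simp add: power3_eq_cube power2_eq_square mult_left_mono mult.assoc)
  finally have "q * (8 / 3 * (fbar' D * E3)) \<le> q * (4 * t\<^sup>2)" by (simp add: mult_ac)
  then have "8 / 3 * (fbar' D * E3) \<le> 4 * t\<^sup>2" using q(2) by (simp only: mult_le_cancel_left_pos)
  then have "fbar' D / 6 * E3 \<le> t\<^sup>2 / 4" by simp
  then show ?thesis
    using pop_loss_diff_ge_cubic[OF u cubic] unfolding E3_def t_def by simp
qed

text \<open>The infimum over an empty family is infinite; finiteness for m = 0 shows that some A_u
  contains a non-zero vector, and that vector bounds the infimum for every m.\<close>

lemma kappa_sq_finite: "kappa_sq D m < \<infinity>"
proof -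
  have "kappa_sq D 0 < \<infinity>" using D4 unfolding cond_D4_def by blast
  then obtain u d where "u \<in> quants D" "d \<in> A_of D u - {0}"
    unfolding kappa_sq_def INF_less_iff by blast
  then have "kappa_sq D m \<le> ereal (d \<bullet> (Gram D *v d) / (norm (restrict_vec (T_of D u \<union> top_outside (T_of D u) m d) d))\<^sup>2)"
    unfolding kappa_sq_def by (intro INF_lower2[of u] INF_lower)
  then show ?thesis using ereal_infty_less(1) order_le_less_trans by fastforce
qed

lemma kappa_sq_nonneg: "0 \<le> kappa_sq D m"
  unfolding kappa_sq_def Gram_form by (intro INF_greatest) (simp add: integral_nonneg_AE)

lemma kappa_mult_norm_le:
  assumes u: "u \<in> quants D" and d: "d \<in> A_of D u"
  shows "kappa D m * norm (restrict_vec (T_of D u \<union> top_outside (T_of D u) m d) d) \<le> sqrt (\<integral>v. (v \<bullet> d)\<^sup>2 \<partial>x_law D)"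
proof (cases "restrict_vec (T_of D u \<union> top_outside (T_of D u) m d) d = 0")
  case False
  define w where "w = norm (restrict_vec (T_of D u \<union> top_outside (T_of D u) m d) d)"
  have w: "0 < w" unfolding w_def using False by simp
  have "d \<noteq> 0" using False unfolding restrict_vec_def by (auto simp: vec_eq_iff split: if_splits)
  then have "kappa_sq D m \<le> ereal (d \<bullet> (Gram D *v d) / w\<^sup>2)"
    unfolding kappa_sq_def w_def using u d by (intro INF_lower2[of u] INF_lower) auto
  then have "real_of_ereal (kappa_sq D m) \<le> (\<integral>v. (v \<bullet> d)\<^sup>2 \<partial>x_law D) / w\<^sup>2"
    unfolding Gram_form using kappa_sq_finite[of m] kappa_sq_nonneg[of m] by (cases "kappa_sq D m") auto
  then have "real_of_ereal (kappa_sq D m) * w\<^sup>2 \<le> (\<integral>v. (v \<bullet> d)\<^sup>2 \<partial>x_law D)"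
    using w by (simp add: pos_le_divide_eq)
  then have "sqrt (real_of_ereal (kappa_sq D m) * w\<^sup>2) \<le> sqrt (\<integral>v. (v \<bullet> d)\<^sup>2 \<partial>x_law D)" by simp
  then show ?thesis using w unfolding kappa_def w_def by (simp add: real_sqrt_mult)
qed (simp add: integral_nonneg_AE)

end


section \<open>Rate of convergence\<close>

lemma W_max_ge_2:
  assumes "compact U" "U \<noteq> {}" "U \<subseteq> {0<..<1}"
  shows "2 \<le> W_max U"
proof -
  obtain u where u: "u \<in> U" using assms(2) by blast
  obtain b where b: "0 < b" "\<And>u. u \<in> U \<Longrightarrow> b \<le> sqrt (u * (1 - u))"
    using sqrt_var_lower_bound[OF assms(1,3)] by blast
  have "0 < u * (1 - u)" using u assms(3) by auto
  moreover have "u * (1 - u) \<le> 1 / 4"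
    using zero_le_power2[of "u - 1 / 2"] by (simp add: power2_eq_square algebra_simps)
  ultimately have "0 < sqrt (u * (1 - u))" "sqrt (u * (1 - u)) \<le> 1 / 2"
    using real_sqrt_le_mono[of "u * (1 - u)" "1 / 4"] by (auto simp: real_sqrt_divide)
  then have "2 \<le> 1 / sqrt (u * (1 - u))" by (simp add: field_simps)
  also have "\<dots> \<le> W_max U" unfolding W_max_def
    using b by (intro cSUP_upper u bdd_aboveI2[of _ _ "1 / b"]) (auto intro: frac_le)
  finally show ?thesis .
qed

context sparse_quantile_model
begin

lemma log_pn_ge_1: "1 \<le> log_pn D"
proof -
  have "1 \<le> ln (3 :: real)" using exp_le by (subst ln_ge_iff) auto
  also have "\<dots> \<le> log_pn D" unfolding log_pn_def dim_of_def using card_ge_3 by (subst ln_le_cancel_iff) auto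
  finally show ?thesis .
qed

lemma ln_dim_le_log_pn: "ln (dim_of D) \<le> log_pn D"
  and ln_nobs_le_log_pn: "ln (real (nobs D)) \<le> log_pn D"
  and ln_dim_pos: "0 < ln (dim_of D)"
  unfolding log_pn_def dim_of_def using card_ge_3 nobs_pos by (auto simp: max_def)

lemma czero_ge_9: "9 \<le> czero D"
  using D4 unfolding cond_D4_def by blast

lemma W_ge_2: "2 \<le> W_of D"
  unfolding W_of_def by (rule W_max_ge_2[OF quants])

text \<open>Both the first bound of the theorem and the radius at which the empirical process bound
  is invoked.\<close>

definition rate :: "real \<Rightarrow> real \<Rightarrow> real" where
  "rate C A = 8 * C * ((1 + czero D) * W_of D * A / (sqrt (flow D) * kappa D 0)) * sqrt (spars D * log_pn D / nobs D)"

lemma A_of_scaleR: "d \<in> A_of D u \<Longrightarrow> c *\<^sub>R d \<in> A_of D u"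
proof -
  assume d: "d \<in> A_of D u"
  have n1: "norm1 (restrict_vec T (c *\<^sub>R d)) = \<bar>c\<bar> * norm1 (restrict_vec T d)" for T
    unfolding norm1_restrict_vec by (simp add: abs_mult sum_distrib_left)
  have "norm0 (restrict_vec T (c *\<^sub>R d)) \<le> norm0 (restrict_vec T d)" for T
    unfolding norm0_def by (rule card_mono) (auto simp: vsupport_def restrict_vec_def)
  moreover have "\<bar>c\<bar> * norm1 (restrict_vec (- T_of D u) d) \<le> \<bar>c\<bar> * (czero D * norm1 (restrict_vec (T_of D u) d))"
    using d unfolding A_of_def restricted_set_def by (intro mult_left_mono) auto
  ultimately show ?thesis
    using d unfolding A_of_def restricted_set_def by (simp add: n1 mult.left_commute) (meson order_trans)
qed

text \<open>The deterministic core: an error beyond the radius is shrunk onto the sphere, where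
  quadratic growth contradicts the noise and penalty bounds. Everything is stated for a fixed
  sample; randomness enters only through the assumed bounds on the weights and on the empirical
  process.\<close>

lemma pen_loss_rate:
  assumes C: "1 / 4 < C" and A: "1 < A" and C_E: "C_E * sqrt (max 1 (CL D + Cf D + 1 / 2)) < C"
    and growth: "2 * C * (1 + czero D) * W_of D * A * sqrt (spars D * log_pn D)
           < q_of D * sqrt (flow D) * kappa D 0 * sqrt (nobs D)"
  shows rate_pos: "0 < rate C A" and kappa_pos: "0 < kappa D 0"
    and J_norm_le_rate: "\<And>u X Y lam b.
      u \<in> quants D \<Longrightarrow> 0 < lam \<Longrightarrow> lam \<le> C * W_of D * sqrt (nobs D * ln (dim_of D)) \<Longrightarrow>
      (\<And>j. sigma_hat (nobs D) X j \<le> 3 / 2) \<Longrightarrow>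
      pen_loss (nobs D) X Y lam u b \<le> pen_loss (nobs D) X Y lam u (coef D u) \<Longrightarrow>
      b - coef D u \<in> A_of D u \<Longrightarrow>
      (\<And>d. d \<in> A_of D u \<Longrightarrow> J_norm D u d \<le> rate C A \<Longrightarrow>
         \<bar>emp_loss (nobs D) X Y u (coef D u + d) - emp_loss (nobs D) X Y u (coef D u)
           - pop_loss_diff D u (coef D u + d) (coef D u)\<bar>
         \<le> rate C A * C_E * ((1 + czero D) * A / (sqrt (flow D) * kappa D 0)) *
             sqrt (spars D * ln (max (dim_of D) (lip D * sqrt (flow D) * kappa D 0 / rate C A)) / nobs D)) \<Longrightarrow>
      J_norm D u (b - coef D u) \<le> rate C A"
proof -
  define n where "n = real (nobs D)"
  define a where "a = 1 + czero D"
  define W where "W = W_of D"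
  define l where "l = log_pn D"
  define s where "s = real (spars D)"
  define K where "K = sqrt (flow D) * kappa D 0"
  define r where "r = sqrt (s * l / n)"
  define t where "t = rate C A"
  define mx where "mx = max 1 (CL D + Cf D + 1 / 2)"
  have n: "0 < n" unfolding n_def using nobs_pos by simp
  have a: "10 \<le> a" unfolding a_def using czero_ge_9 by simp
  have W: "2 \<le> W" unfolding W_def by (rule W_ge_2)
  have l: "1 \<le> l" unfolding l_def by (rule log_pn_ge_1)
  have s: "1 \<le> s" unfolding s_def using D2 unfolding cond_D2_def by simp
  have r: "0 < r" unfolding r_def using s l n by simp
  have q: "0 < q_of D" using D4 unfolding cond_D4_def by blast
  have f: "0 < flow D" by (rule flow_pos)
  have C0: "0 < C" using C by simp
  have sl: "1 \<le> sqrt (s * l)" using mult_mono[OF s l] s by simp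
  have aWA: "20 \<le> a * W * A"
  proof -
    have "10 * 2 * 1 \<le> a * W * A" using a W A by (intro mult_mono) auto
    then show ?thesis by simp
  qed
  have CaWA: "0 < 2 * C * a * W * A * sqrt (s * l)"
    using C0 a W A sl by (intro mult_pos_pos) auto
  have gr: "2 * C * a * W * A * sqrt (s * l) < q_of D * K * sqrt n"
    using growth unfolding a_def W_def s_def l_def K_def n_def by (simp add: mult.assoc)
  \<comment> \<open>The left side of the growth condition is positive, so the condition also yields
    positivity of \<open>kappa D 0\<close>.\<close>
  have "0 < q_of D * K * sqrt n" using CaWA gr by linarith
  then have K: "0 < K" using q n by (simp add: zero_less_mult_iff)
  then show kappa: "0 < kappa D 0" unfolding K_def using f by (simp add: zero_less_mult_iff)
  have t: "t = 8 * C * (a * W * A / K) * r"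
    unfolding t_def rate_def a_def W_def K_def r_def s_def l_def n_def ..
  have t0: "0 < t" unfolding t using C0 a W A K r by (intro mult_pos_pos divide_pos_pos) auto
  then show "0 < rate C A" unfolding t_def .
  have rs: "r * sqrt n = sqrt (s * l)" unfolding r_def using n by (simp add: real_sqrt_divide)
  \<comment> \<open>The growth condition, multiplied by 4, says exactly that the radius is below 4
    q, the range of the quadratic lower bound.\<close>
  have tq: "t \<le> 4 * q_of D"
  proof -
    have "t * (K * sqrt n) = 4 * (2 * C * a * W * A * (r * sqrt n))" unfolding t using K by simp
    also have "\<dots> \<le> 4 * (q_of D * K * sqrt n)" unfolding rs by (rule mult_left_mono[OF less_imp_le[OF gr]]) simp
    finally have "t * (K * sqrt n) \<le> (4 * q_of D) * (K * sqrt n)" by (simp add: mult.assoc)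
    then show ?thesis using K n by simp
  qed
  have L: "0 < lip D" "ln (lip D) \<le> CL D * l" and fk: "ln (flow D * (kappa D 0)\<^sup>2) \<le> Cf D * l"
    using D2 D4 unfolding cond_D2_def cond_D4_def l_def by auto
  \<comment> \<open>Since C > 1/4, the quantity t K sqrt n = 8 C a W A sqrt(s l) is at least 1, so 1
    / t \<le> K sqrt n. The argument of the logarithm is then at most L \<open>flow D\<close>
    \<kappa>_0^2 sqrt n, whose three factors account for C_L, C_f and 1/2.\<close>
  have log: "ln (max (dim_of D) (lip D * sqrt (flow D) * kappa D 0 / t)) \<le> mx * l"
  proof -
    define x where "x = lip D * sqrt (flow D) * kappa D 0 / t"
    have x: "x = lip D * K / t" unfolding x_def K_def by (simp add: mult.assoc)
    have x0: "0 < x" unfolding x using L(1) K t0 by simp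
    have "1 \<le> 8 * C * (a * W * A) * sqrt (s * l)"
    proof -
      have "1 * 1 * 1 \<le> (8 * C) * (a * W * A) * sqrt (s * l)"
        using C aWA sl by (intro mult_mono) auto
      then show ?thesis by simp
    qed
    also have "8 * C * (a * W * A) * sqrt (s * l) = t * (K * sqrt n)"
      unfolding t rs[symmetric] using K by simp
    finally have "lip D * K * 1 \<le> lip D * K * (t * (K * sqrt n))"
      using L(1) K by (intro mult_left_mono) auto
    then have "x \<le> lip D * (K * K) * sqrt n"
      unfolding x using t0 by (simp add: pos_divide_le_eq mult_ac)
    also have "K * K = flow D * (kappa D 0)\<^sup>2" unfolding K_def using f by (simp add: power2_eq_square)
    finally have "ln x \<le> ln (lip D * (flow D * (kappa D 0)\<^sup>2) * sqrt n)" using x0 by (subst ln_le_cancel_iff) auto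
    also have "\<dots> = ln (lip D) + ln (flow D * (kappa D 0)\<^sup>2) + ln n / 2"
      using L(1) f kappa n by (simp add: ln_mult ln_sqrt)
    also have "\<dots> \<le> CL D * l + Cf D * l + l / 2"
      using L(2) fk ln_nobs_le_log_pn unfolding n_def l_def by simp
    also have "\<dots> = (CL D + Cf D + 1 / 2) * l" by (simp add: algebra_simps)
    also have "\<dots> \<le> mx * l" unfolding mx_def using l by (intro mult_right_mono) auto
    finally have "ln x \<le> mx * l" .
    moreover have "ln (dim_of D) \<le> 1 * l" using ln_dim_le_log_pn unfolding l_def by simp
    then have "ln (dim_of D) \<le> mx * l"
      by (rule order_trans) (use l in \<open>intro mult_right_mono, auto simp: mx_def\<close>)
    ultimately show ?thesis unfolding x_def by (simp add: max_def)
  qed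
  have err: "t * C_E * (a * A / K) * sqrt (s * ln (max (dim_of D) (lip D * sqrt (flow D) * kappa D 0 / t)) / n)
      \<le> t * C * (a * A / K) * r" (is "t * C_E * _ * ?z \<le> _")
  proof -
    have "0 \<le> ln (max (dim_of D) (lip D * sqrt (flow D) * kappa D 0 / t))"
      using card_ge_3 unfolding dim_of_def by (intro ln_ge_zero) (auto simp: max_def)
    then have z0: "0 \<le> ?z" using s n by simp
    have "?z \<le> sqrt (mx * (s * l / n))"
      using mult_left_mono[OF log, of s] s n by (intro real_sqrt_le_mono) (simp add: divide_right_mono mult_ac)
    then have z: "?z \<le> sqrt mx * r" unfolding r_def by (simp only: real_sqrt_mult)
    have "C_E * ?z \<le> C * r"
    \<comment> \<open>\<open>is_C_E\<close> does not fix the sign of the constant; for a negative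
      one the bound is trivial.\<close>
    proof (cases "0 \<le> C_E")
      case True
      then have "C_E * ?z \<le> (C_E * sqrt mx) * r" using z by (simp add: mult_left_mono mult.assoc)
      also have "\<dots> \<le> C * r" using C_E r unfolding mx_def by (intro mult_right_mono) auto
      finally show ?thesis .
    next
      case False
      then have "C_E * ?z \<le> 0" using z0 by (simp add: mult_nonpos_nonneg)
      also have "0 \<le> C * r" using C0 r by simp
      finally show ?thesis .
    qed
    then have "(t * (a * A / K)) * (C_E * ?z) \<le> (t * (a * A / K)) * (C * r)"
      using t0 a A K by (intro mult_left_mono) auto
    then show ?thesis by (simp add: mult_ac)
  qed
  fix u X Y lam b
  assume u: "u \<in> quants D" and lam: "0 < lam" "lam \<le> C * W_of D * sqrt (nobs D * ln (dim_of D))"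
    and sig: "\<And>j. sigma_hat (nobs D) X j \<le> 3 / 2"
    and min: "pen_loss (nobs D) X Y lam u b \<le> pen_loss (nobs D) X Y lam u (coef D u)"
    and cone: "b - coef D u \<in> A_of D u"
    and dev: "\<And>d. d \<in> A_of D u \<Longrightarrow> J_norm D u d \<le> rate C A \<Longrightarrow>
         \<bar>emp_loss (nobs D) X Y u (coef D u + d) - emp_loss (nobs D) X Y u (coef D u)
           - pop_loss_diff D u (coef D u + d) (coef D u)\<bar>
         \<le> rate C A * C_E * ((1 + czero D) * A / (sqrt (flow D) * kappa D 0)) *
             sqrt (spars D * ln (max (dim_of D) (lip D * sqrt (flow D) * kappa D 0 / rate C A)) / nobs D)"
  show "J_norm D u (b - coef D u) \<le> rate C A"
  proof (rule ccontr)
    assume "\<not> J_norm D u (b - coef D u) \<le> rate C A"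
    then have big: "t < J_norm D u (b - coef D u)" unfolding t_def by simp
    \<comment> \<open>Shrinks the error onto the sphere of radius t. The cone is stable under
      scaling, and by convexity the penalized loss at the shrunken point does not exceed its value
      at the truth.\<close>
    define c where "c = t / J_norm D u (b - coef D u)"
    have c: "0 \<le> c" "c \<le> 1" unfolding c_def using big t0 by auto
    define d where "d = c *\<^sub>R (b - coef D u)"
    have dA: "d \<in> A_of D u" unfolding d_def using cone by (rule A_of_scaleR)
    have Jd: "J_norm D u d = t" unfolding d_def J_norm_scaleR using c(1) big t0 unfolding c_def by simp
    have d0: "d \<noteq> 0" using Jd t0 unfolding J_norm_def by auto
    have u01: "u \<in> {0<..<1}" using u quants(3) by blast
    have sig0: "0 \<le> sigma_hat (nobs D) X j" for j unfolding sigma_hat_def emp_mean_def by (simp add: sum_nonneg)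
    define T where "T = T_of D u"
    define k where "k = lam * sqrt (u * (1 - u)) / n"
    have k0: "0 \<le> k" unfolding k_def using lam(1) u01 n by simp
    define P where "P w = (\<Sum>j\<in>UNIV. sigma_hat (nobs D) X j * \<bar>w $ j\<bar>)" for w
    define S where "S = (\<Sum>j\<in>T. sigma_hat (nobs D) X j * \<bar>d $ j\<bar>)"
    have "pen_loss (nobs D) X Y lam u (coef D u + d)
      \<le> (1 - c) * pen_loss (nobs D) X Y lam u (coef D u) + c * pen_loss (nobs D) X Y lam u b"
      unfolding d_def using c lam(1) u01 by (intro pen_loss_convex) auto
    also have "\<dots> \<le> (1 - c) * pen_loss (nobs D) X Y lam u (coef D u) + c * pen_loss (nobs D) X Y lam u (coef D u)"
      using min c(1) by (intro add_left_mono mult_left_mono)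
    also have "\<dots> = pen_loss (nobs D) X Y lam u (coef D u)" by (simp add: algebra_simps)
    finally have pen: "emp_loss (nobs D) X Y u (coef D u + d) - emp_loss (nobs D) X Y u (coef D u)
      \<le> - (k * (P (coef D u + d) - P (coef D u)))"
      unfolding pen_loss_def k_def P_def n_def by (simp add: algebra_simps)
    have "- S \<le> P (coef D u + d) - P (coef D u)"
      using penalty_diff_ge[where s = "sigma_hat (nobs D) X" and b = "coef D u" and d = d] sig0
        sum_nonneg[of "- T" "\<lambda>j. sigma_hat (nobs D) X j * \<bar>d $ j\<bar>"]
      unfolding P_def S_def T_def T_of_def by simp
    from mult_left_mono[OF this k0] have "- (k * (P (coef D u + d) - P (coef D u))) \<le> k * S" by linarith
    moreover have "t\<^sup>2 / 4 \<le> pop_loss_diff D u (coef D u + d) (coef D u)"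
      using pop_loss_diff_ge[OF u dA d0] tq unfolding Jd by simp
    moreover have "\<bar>emp_loss (nobs D) X Y u (coef D u + d) - emp_loss (nobs D) X Y u (coef D u)
           - pop_loss_diff D u (coef D u + d) (coef D u)\<bar> \<le> t * C * (a * A / K) * r"
      using dev[OF dA] err unfolding Jd a_def K_def s_def n_def t_def by simp
    ultimately have main: "t\<^sup>2 / 4 \<le> t * C * (a * A / K) * r + k * S" using pen by linarith
    have "S \<le> (\<Sum>j\<in>T. 3 / 2 * \<bar>d $ j\<bar>)" unfolding S_def by (intro sum_mono mult_right_mono sig) auto
    also have "\<dots> = 3 / 2 * norm1 (restrict_vec T d)" by (simp add: norm1_restrict_vec sum_distrib_left)
    \<comment> \<open>Cauchy-Schwarz on the at most s indices of T, then \<kappa>_0 to reach the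
      prediction norm and \<open>flow D\<close> to reach the norm of J_u.\<close>
    also have "norm1 (restrict_vec T d) \<le> sqrt s * (t / K)"
    proof -
      have "kappa D 0 * norm (restrict_vec T d) \<le> kappa D 0 * norm (restrict_vec (T \<union> top_outside T 0 d) d)"
        using kappa by (intro mult_left_mono norm_restrict_vec_mono) auto
      also have "\<dots> \<le> sqrt (\<integral>v. (v \<bullet> d)\<^sup>2 \<partial>x_law D)"
        unfolding T_def by (rule kappa_mult_norm_le[OF u dA])
      finally have "sqrt (flow D) * (kappa D 0 * norm (restrict_vec T d)) \<le> sqrt (flow D) * sqrt (\<integral>v. (v \<bullet> d)\<^sup>2 \<partial>x_law D)"
        using f by (intro mult_left_mono) auto
      also have "\<dots> = sqrt (flow D * (\<integral>v. (v \<bullet> d)\<^sup>2 \<partial>x_law D))" by (simp add: real_sqrt_mult)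
      also have "\<dots> \<le> sqrt (t\<^sup>2)" by (rule real_sqrt_le_mono[OF flow_Gram_le_J[OF u, of d, unfolded Jd]])
      finally have "norm (restrict_vec T d) \<le> t / K" using t0 K unfolding K_def by (simp add: pos_le_divide_eq mult_ac)
      moreover have "real (card T) \<le> s"
        using D2 u unfolding cond_D2_def T_def T_of_def norm0_def s_def by simp
      ultimately have "sqrt (card T) * norm (restrict_vec T d) \<le> sqrt s * (t / K)" using s by (intro mult_mono) auto
      then show ?thesis using norm1_restrict_vec_le_norm order_trans by blast
    qed
    finally have S: "S \<le> 3 / 2 * (sqrt s * (t / K))" by simp
    \<comment> \<open>The bound 1/2 for sqrt(u (1 - u)) and the weight bound 3/2 together produce
      the factor 3/4 of the penalty term.\<close>
    have "k \<le> C * W * sqrt (n * l) * (1 / 2) / n"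
    proof -
      have "u * (1 - u) \<le> 1 / 4"
        using zero_le_power2[of "u - 1 / 2"] by (simp add: power2_eq_square algebra_simps)
      then have "sqrt (u * (1 - u)) \<le> 1 / 2"
        using real_sqrt_le_mono[of "u * (1 - u)" "1 / 4"] by (simp add: real_sqrt_divide)
      moreover have "sqrt (n * ln (dim_of D)) \<le> sqrt (n * l)" using ln_dim_le_log_pn n unfolding l_def by simp
      then have "C * W * sqrt (n * ln (dim_of D)) \<le> C * W * sqrt (n * l)" using C0 W by (intro mult_left_mono) auto
      then have "lam \<le> C * W * sqrt (n * l)" using lam(2) unfolding W_def n_def by linarith
      ultimately show ?thesis unfolding k_def using lam(1) n u01
        by (intro divide_right_mono mult_mono) auto
    qed
    then have "k * (3 / 2 * (sqrt s * (t / K))) \<le> (C * W * sqrt (n * l) * (1 / 2) / n) * (3 / 2 * (sqrt s * (t / K)))"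
      using s t0 K by (intro mult_right_mono) auto
    with mult_left_mono[OF S k0]
    have "k * S \<le> (C * W * sqrt (n * l) * (1 / 2) / n) * (3 / 2 * (sqrt s * (t / K)))" by linarith
    also have "\<dots> = 3 / 4 * C * W * (sqrt (n * l) * sqrt s / n) * (t / K)" by simp
    also have "sqrt (n * l) * sqrt s / n = r"
    proof -
      have "r * n = r * sqrt n * sqrt n" using n by simp
      also have "\<dots> = sqrt (n * l) * sqrt s" unfolding rs by (simp add: real_sqrt_mult mult_ac)
      finally show ?thesis using n by (simp add: divide_eq_eq)
    qed
    finally have "t\<^sup>2 / 4 \<le> t * C * (a * A / K) * r + 3 / 4 * C * W * r * (t / K)" using main by linarith
    also have "\<dots> = (t * C * r / K) * (a * A + 3 / 4 * W)" using K by (simp add: field_simps)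
    also have "t\<^sup>2 / 4 = t / 4 * t" by (simp add: power2_eq_square)
    also have "\<dots> = t / 4 * (8 * C * (a * W * A / K) * r)" by (subst (2) t) (rule refl)
    also have "\<dots> = (t * C * r / K) * (2 * (a * W * A))" by simp
    \<comment> \<open>The common factor C t r / K cancels. What remains is impossible for a \<ge>
      10, W \<ge> 2 and A > 1, since a A is at most half and W at most a tenth of a W A.\<close>
    finally have "2 * (a * W * A) \<le> a * A + 3 / 4 * W"
      using t0 C0 r K by (simp only: mult_le_cancel_left_pos divide_pos_pos mult_pos_pos)
    moreover have "2 * (a * A) \<le> a * W * A"
    proof -
      have "(a * A) * 2 \<le> (a * A) * W" using W a A by (intro mult_left_mono) auto
      then show ?thesis by (simp add: mult_ac)
    qed
    moreover have "W * 10 \<le> W * (a * A)"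
    proof -
      have "10 * 1 \<le> a * A" using a A by (intro mult_mono) auto
      then show ?thesis using W by (intro mult_left_mono) auto
    qed
    then have "10 * W \<le> a * W * A" by (simp add: mult_ac)
    moreover have "0 < a * A" using a A by simp
    ultimately show False using W by linarith
  qed
qed

section \<open>From the sample events to the error bounds\<close>

lemma qr_error_in_A:
  assumes u: "u \<in> quants D" and lam: "0 < lam" "(czero D + 3) / (czero D - 3) * Q \<le> lam"
    and sig: "\<And>j. \<bar>sigma_hat (nobs D) X j - 1\<bar> \<le> 1 / 2"
    and score: "\<And>j. \<bar>\<Sum>i<nobs D. X i $ j * (u - of_bool (Y i \<le> X i \<bullet> coef D u)) /
        (sigma_hat (nobs D) X j * sqrt (u * (1 - u)))\<bar> \<le> Q"
    and est: "is_qr_estimator (nobs D) X Y lam u b"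
  shows "b - coef D u \<in> A_of D u"
    and "pen_loss (nobs D) X Y lam u b \<le> pen_loss (nobs D) X Y lam u (coef D u)"
proof -
  show min: "pen_loss (nobs D) X Y lam u b \<le> pen_loss (nobs D) X Y lam u (coef D u)"
    using est unfolding is_qr_estimator_def is_arg_min_linorder by blast
  have u01: "u \<in> {0<..<1}" using u quants(3) by blast
  have s: "1 / 2 \<le> sigma_hat (nobs D) X j" "sigma_hat (nobs D) X j \<le> 3 / 2" for j
    using abs_le_D1[OF sig[of j]] abs_le_D2[OF sig[of j]] by linarith+
  have c: "3 < czero D" using czero_ge_9 by simp
  have Q: "Q \<le> lam * ((czero D - 3) / (czero D + 3))" using lam(2) c by (simp add: field_simps)
  have "\<bar>\<Sum>i<nobs D. X i $ j * (u - of_bool (Y i \<le> X i \<bullet> coef D u))\<bar>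
      \<le> sigma_hat (nobs D) X j * sqrt (u * (1 - u)) * (lam * ((czero D - 3) / (czero D + 3)))" for j
  proof -
    have w: "0 < sigma_hat (nobs D) X j * sqrt (u * (1 - u))" using s(1)[of j] u01 by simp
    have "\<bar>\<Sum>i<nobs D. X i $ j * (u - of_bool (Y i \<le> X i \<bullet> coef D u))\<bar> / (sigma_hat (nobs D) X j * sqrt (u * (1 - u))) \<le> Q"
      using score[of j] w by (simp flip: sum_divide_distrib)
    then have "\<bar>\<Sum>i<nobs D. X i $ j * (u - of_bool (Y i \<le> X i \<bullet> coef D u))\<bar> \<le> Q * (sigma_hat (nobs D) X j * sqrt (u * (1 - u)))"
      using w by (simp only: pos_divide_le_eq)
    also have "\<dots> \<le> lam * ((czero D - 3) / (czero D + 3)) * (sigma_hat (nobs D) X j * sqrt (u * (1 - u)))"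
      using Q w by (intro mult_right_mono) auto
    finally show ?thesis by (simp only: mult.commute)
  qed
  from qr_estimator_cone[OF min nobs_pos lam(1) u01 c s this]
  have "norm1 (restrict_vec (- T_of D u) (b - coef D u)) \<le> czero D * norm1 (restrict_vec (T_of D u) (b - coef D u))"
    unfolding T_of_def .
  moreover have "norm0 (restrict_vec (- T_of D u) (b - coef D u)) \<le> norm0 b"
    unfolding norm0_def by (rule card_mono) (auto simp: vsupport_def restrict_vec_def T_of_def)
  then have "norm0 (restrict_vec (- T_of D u) (b - coef D u)) \<le> nobs D"
    using norm0_qr_estimator_le[OF est] by simp
  ultimately show "b - coef D u \<in> A_of D u" unfolding A_of_def restricted_set_def by simp
qed

lemma sigma_hat_event:
  "{\<omega> \<in> space (prob_of D). (MAX j\<in>UNIV. \<bar>sigma_hat (nobs D) (design D \<omega>) j - 1\<bar>) \<le> 1 / 2} \<in> sets (prob_of D)"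
proof -
  have [measurable]: "(\<lambda>\<omega>. sigma_hat (nobs D) (design D \<omega>) j) \<in> borel_measurable (prob_of D)" for j
    unfolding design_def using regr_measurable by (rule borel_measurable_sigma_hat)
  have "{\<omega> \<in> space (prob_of D). \<forall>j\<in>UNIV. \<bar>sigma_hat (nobs D) (design D \<omega>) j - 1\<bar> \<le> 1 / 2} \<in> sets (prob_of D)"
    by (rule sets.sets_Collect_finite_All) auto
  then show ?thesis by simp
qed

lemma l2_error_le:
  assumes u: "u \<in> quants D" and d: "d \<in> A_of D u" and t: "sqrt (\<integral>v. (v \<bullet> d)\<^sup>2 \<partial>x_law D) \<le> t" "0 < t"
  shows "ereal (norm d) \<le> l2_factor D * ereal t"
proof (cases "mtop D = 0")
  \<comment> \<open>For m = 0 the factor is infinite, and t > 0 keeps the product infinite.\<close>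
  case True
  then show ?thesis using t(2) unfolding l2_factor_def by simp
next
  case False
  define w where "w = norm (restrict_vec (T_of D u \<union> top_outside (T_of D u) (mtop D) d) d)"
  have c0: "0 \<le> 1 + czero D * sqrt (spars D / mtop D)" using czero_ge_9 by simp
  have "0 < kappa_sq D (mtop D)" using D4 unfolding cond_D4_def by blast
  then have kap: "0 < kappa D (mtop D)"
    unfolding kappa_def using kappa_sq_finite[of "mtop D"] by (cases "kappa_sq D (mtop D)") auto
  have "kappa D (mtop D) * w \<le> t" using kappa_mult_norm_le[OF u d, of "mtop D"] t(1) unfolding w_def by simp
  then have w: "w \<le> t / kappa D (mtop D)" using kap by (simp add: pos_le_divide_eq mult.commute)
  have "card (T_of D u) \<le> spars D" using D2 u unfolding cond_D2_def T_of_def norm0_def by blast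
  then have "norm d \<le> (1 + czero D * sqrt (spars D / mtop D)) * w"
    unfolding w_def using d False czero_ge_9
    by (intro norm_le_top_outside) (auto simp: A_of_def restricted_set_def)
  also have "\<dots> \<le> (1 + czero D * sqrt (spars D / mtop D)) * (t / kappa D (mtop D))"
    using w c0 by (rule mult_left_mono)
  finally show ?thesis using False unfolding l2_factor_def by simp
qed

end

theorem theorem2:
  fixes D :: "('w, 'p::finite) qr_model"
    and \<alpha> A C C_Lambda C_E :: real
  assumes "cond_setup D" and "cond_D1 D" and "cond_D2 D" and "cond_D3 D" and "cond_D4 D"
    and "is_C_Lambda TYPE('p) C_Lambda"
    and "is_C_E TYPE(('w, 'p) qr_model) C_E"
    and "0 < \<alpha>" and "\<alpha> < 1" and "1 < A"
    and "max (2 * C_Lambda * sqrt (1 + ln (1 / \<alpha>) / ln (dim_of D)))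
             (C_E * sqrt (max 1 (CL D + Cf D + 1 / 2))) < C"
    and "2 * C * (1 + czero D) * W_of D * A * sqrt (spars D * log_pn D)
           < q_of D * sqrt (flow D) * kappa D 0 * sqrt (nobs D)"
  shows "with_prob_ge (prob_of D) (1 - \<alpha> - 4 * gamma_n D - 3 * dim_of D powr (- A\<^sup>2)) (\<lambda>\<omega>.
    \<forall>lam bhat.
      0 < lam \<and> lambda0 D \<alpha> \<omega> \<le> lam \<and> lam \<le> C * W_of D * sqrt (nobs D * ln (dim_of D)) \<and>
      (\<forall>u\<in>quants D. is_qr_estimator (nobs D) (design D \<omega>) (response D \<omega>) lam u (bhat u)) \<longrightarrow>
      (SUP u\<in>quants D. ereal (J_norm D u (bhat u - coef D u)))
        \<le> ereal (8 * C * ((1 + czero D) * W_of D * A / (sqrt (flow D) * kappa D 0)) *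
                 sqrt (spars D * log_pn D / nobs D)) \<and>
      (SUP u\<in>quants D. ereal (sqrt (\<integral>v. (v \<bullet> (bhat u - coef D u))\<^sup>2 \<partial>x_law D)))
        \<le> ereal (8 * C * ((1 + czero D) * W_of D * A / (flow D * kappa D 0)) *
                 sqrt (spars D * log_pn D / nobs D)) \<and>
      (SUP u\<in>quants D. ereal (norm (bhat u - coef D u)))
        \<le> l2_factor D * ereal (8 * C * ((1 + czero D) * W_of D * A / (flow D * kappa D 0)) *
                 sqrt (spars D * log_pn D / nobs D)))"
proof -
  interpret Q: sparse_quantile_model D
    using assms(1-5) by unfold_locales
  define t where "t = Q.rate C A"
  have "0 < ln (dim_of D)" by (rule Q.ln_dim_pos)
  then have "1 \<le> sqrt (1 + ln (1 / \<alpha>) / ln (dim_of D))"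
    using \<open>0 < \<alpha>\<close> \<open>\<alpha> < 1\<close> by simp
  moreover have "1 / 8 < C_Lambda"
    using C_Lambda_lower_bound[OF \<open>is_C_Lambda TYPE('p) C_Lambda\<close> Q.card_ge_3] .
  \<comment> \<open>The lower bound 1/8 for \<open>C_Lambda\<close>, doubled, and a square root of
    at least 1 give the bound on C that the logarithmic estimate requires.\<close>
  ultimately have "1 / 4 * 1 < 2 * C_Lambda * sqrt (1 + ln (1 / \<alpha>) / ln (dim_of D))"
    by (intro mult_less_le_imp_less) auto
  then have C: "1 / 4 < C" using assms(11) by simp
  have C_E: "C_E * sqrt (max 1 (CL D + Cf D + 1 / 2)) < C" using assms(11) by simp
  note rate = Q.rate_pos[OF C \<open>1 < A\<close> C_E assms(12)] Q.kappa_pos[OF C \<open>1 < A\<close> C_E assms(12)]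
    Q.J_norm_le_rate[OF C \<open>1 < A\<close> C_E assms(12)]
  have t0: "0 < t" unfolding t_def by (rule rate(1))
  have t_flow: "t / sqrt (flow D) = 8 * C * ((1 + czero D) * W_of D * A / (flow D * kappa D 0)) * sqrt (spars D * log_pn D / nobs D)"
  proof -
    have "sqrt (flow D) * kappa D 0 * sqrt (flow D) = (sqrt (flow D) * sqrt (flow D)) * kappa D 0"
      by (simp only: mult_ac)
    then have "sqrt (flow D) * kappa D 0 * sqrt (flow D) = flow D * kappa D 0" using Q.flow_pos by simp
    then have "x / (sqrt (flow D) * kappa D 0) / sqrt (flow D) = x / (flow D * kappa D 0)" for x
      unfolding divide_divide_eq_left by (rule arg_cong)
    moreover have "8 * C * x * y / z = 8 * C * (x / z) * y" for x y z :: real by simp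
    ultimately show ?thesis unfolding t_def Q.rate_def by (simp only:)
  qed
  obtain E1 where E1: "E1 \<in> sets (prob_of D)" "1 - \<alpha> \<le> measure (prob_of D) E1"
    "\<And>\<omega> u j. \<omega> \<in> E1 \<Longrightarrow> u \<in> quants D \<Longrightarrow>
      \<bar>\<Sum>i<nobs D. design D \<omega> i $ j * (u - of_bool (response D \<omega> i \<le> design D \<omega> i \<bullet> coef D u)) /
        (sigma_hat (nobs D) (design D \<omega>) j * sqrt (u * (1 - u)))\<bar>
      \<le> quantile (Lambda_law (quants D) (nobs D) (design D \<omega>)) (1 - \<alpha>)"
    using Q.score_event[OF \<open>0 < \<alpha>\<close> \<open>\<alpha> < 1\<close>] by blast
  define E2 where "E2 = {\<omega> \<in> space (prob_of D). (MAX j\<in>UNIV. \<bar>sigma_hat (nobs D) (design D \<omega>) j - 1\<bar>) \<le> 1 / 2}"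
  have E2: "E2 \<in> sets (prob_of D)" "1 - gamma_n D \<le> measure (prob_of D) E2"
    unfolding E2_def using Q.sigma_hat_event assms(4) unfolding cond_D3_def by blast+
  have "with_prob_ge (prob_of D) (1 - 3 * gamma_n D - 3 * dim_of D powr (- A\<^sup>2)) (\<lambda>\<omega>.
        (SUP (u, d)\<in>{(u, d). u \<in> quants D \<and> d \<in> A_of D u \<and> J_norm D u d \<le> t}.
           ereal \<bar>emp_loss (nobs D) (design D \<omega>) (response D \<omega>) u (coef D u + d)
                  - emp_loss (nobs D) (design D \<omega>) (response D \<omega>) u (coef D u)
                  - pop_loss_diff D u (coef D u + d) (coef D u)\<bar>)
        \<le> ereal (t * C_E * ((1 + czero D) * A / (sqrt (flow D) * kappa D 0)) *
             sqrt (spars D * ln (max (dim_of D) (lip D * sqrt (flow D) * kappa D 0 / t)) / nobs D)))"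
    using assms(7)[unfolded is_C_E_def, rule_format, of D t A] assms(1-5) t0 \<open>1 < A\<close> by blast
  then obtain E3 where E3: "E3 \<in> sets (prob_of D)" "1 - 3 * gamma_n D - 3 * dim_of D powr (- A\<^sup>2) \<le> measure (prob_of D) E3"
    "\<And>\<omega>. \<omega> \<in> E3 \<Longrightarrow> (SUP (u, d)\<in>{(u, d). u \<in> quants D \<and> d \<in> A_of D u \<and> J_norm D u d \<le> t}.
           ereal \<bar>emp_loss (nobs D) (design D \<omega>) (response D \<omega>) u (coef D u + d)
                  - emp_loss (nobs D) (design D \<omega>) (response D \<omega>) u (coef D u)
                  - pop_loss_diff D u (coef D u + d) (coef D u)\<bar>)
        \<le> ereal (t * C_E * ((1 + czero D) * A / (sqrt (flow D) * kappa D 0)) *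
             sqrt (spars D * ln (max (dim_of D) (lip D * sqrt (flow D) * kappa D 0 / t)) / nobs D))"
    unfolding with_prob_ge_def by blast
  have dev: "\<bar>emp_loss (nobs D) (design D \<omega>) (response D \<omega>) u (coef D u + d)
          - emp_loss (nobs D) (design D \<omega>) (response D \<omega>) u (coef D u)
          - pop_loss_diff D u (coef D u + d) (coef D u)\<bar>
        \<le> t * C_E * ((1 + czero D) * A / (sqrt (flow D) * kappa D 0)) *
             sqrt (spars D * ln (max (dim_of D) (lip D * sqrt (flow D) * kappa D 0 / t)) / nobs D)"
    if "\<omega> \<in> E3" "u \<in> quants D" "d \<in> A_of D u" "J_norm D u d \<le> t" for \<omega> u d
    using SUP_le_iff[THEN iffD1, OF E3(3)[OF that(1)], rule_format, of "(u, d)"] that by simp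
  define E where "E = E1 \<inter> E2 \<inter> E3"
  have E: "E \<in> sets (prob_of D)" unfolding E_def using E1(1) E2(1) E3(1) by blast
  \<comment> \<open>Union bound: the score costs \<alpha>, the weights cost \<gamma>, and the
    empirical process costs 3 \<gamma> + 3 p^(-A^2). The event is fixed before any penalty level or
    estimator is chosen.\<close>
  have prob: "1 - \<alpha> - 4 * gamma_n D - 3 * dim_of D powr (- A\<^sup>2) \<le> measure (prob_of D) E"
  proof -
    have inter: "measure (prob_of D) S + measure (prob_of D) S' - 1 \<le> measure (prob_of D) (S \<inter> S')"
      if "S \<in> sets (prob_of D)" "S' \<in> sets (prob_of D)" for S S'
      using Q.M.finite_measure_Union'[OF that] Q.M.finite_measure_Diff'[OF that(2,1)] Q.M.prob_le_1[of "S \<union> S'"]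
      by (simp add: Int_commute)
    show ?thesis
      using inter[OF E1(1) E2(1)] inter[OF sets.Int[OF E1(1) E2(1)] E3(1)] E1(2) E2(2) E3(2)
      unfolding E_def by linarith
  qed
  have bound: "J_norm D u (b - coef D u) \<le> t" "b - coef D u \<in> A_of D u"
    if \<omega>: "\<omega> \<in> E" and lam: "0 < lam" "lambda0 D \<alpha> \<omega> \<le> lam" "lam \<le> C * W_of D * sqrt (nobs D * ln (dim_of D))"
      and u: "u \<in> quants D" and est: "is_qr_estimator (nobs D) (design D \<omega>) (response D \<omega>) lam u b"
    for \<omega> lam u b
  proof -
    have sig: "\<bar>sigma_hat (nobs D) (design D \<omega>) j - 1\<bar> \<le> 1 / 2" for j
    proof -
      have "(MAX j\<in>UNIV. \<bar>sigma_hat (nobs D) (design D \<omega>) j - 1\<bar>) \<le> 1 / 2"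
        using \<omega> unfolding E_def E2_def by blast
      then show ?thesis by (rule order_trans[OF Max_ge, rotated 2]) auto
    qed
    have \<omega>1: "\<omega> \<in> E1" and \<omega>3: "\<omega> \<in> E3" using \<omega> unfolding E_def by auto
    note err = Q.qr_error_in_A[OF u lam(1) lam(2)[unfolded lambda0_def] sig E1(3)[OF \<omega>1 u] est]
    show "b - coef D u \<in> A_of D u" by (rule err(1))
    have sig2: "sigma_hat (nobs D) (design D \<omega>) j \<le> 3 / 2" for j
      using abs_le_D1[OF sig[of j]] by linarith
    show "J_norm D u (b - coef D u) \<le> t" unfolding t_def
      by (rule rate(3)[OF u lam(1,3) sig2 err(2,1)]) (rule dev[OF \<omega>3 u, unfolded t_def])
  qed
  have l2: "sqrt (\<integral>v. (v \<bullet> d)\<^sup>2 \<partial>x_law D) \<le> t / sqrt (flow D)" if "u \<in> quants D" "J_norm D u d \<le> t" for u d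
  proof -
    have "sqrt (flow D * (\<integral>v. (v \<bullet> d)\<^sup>2 \<partial>x_law D)) \<le> sqrt ((J_norm D u d)\<^sup>2)"
      by (rule real_sqrt_le_mono[OF Q.flow_Gram_le_J[OF that(1)]])
    also have "\<dots> \<le> t" using that(2) Q.J_norm_nonneg by simp
    finally show ?thesis using Q.flow_pos by (simp add: real_sqrt_mult pos_le_divide_eq mult.commute)
  qed
  \<comment> \<open>After rewriting, all three right-hand sides are multiples of the one radius t: t
    itself, t / sqrt(\<open>flow D\<close>), and the latter times
    \<open>l2_factor D\<close>.\<close>
  show ?thesis
    unfolding with_prob_ge_def t_flow[symmetric] Q.rate_def[symmetric] t_def[symmetric]
  proof (intro bexI[OF _ E] conjI prob ballI allI impI)
    fix \<omega> lam bhat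
    assume \<omega>: "\<omega> \<in> E" and H: "0 < lam \<and> lambda0 D \<alpha> \<omega> \<le> lam \<and> lam \<le> C * W_of D * sqrt (nobs D * ln (dim_of D)) \<and>
      (\<forall>u\<in>quants D. is_qr_estimator (nobs D) (design D \<omega>) (response D \<omega>) lam u (bhat u))"
    have J: "J_norm D u (bhat u - coef D u) \<le> t" and cone: "bhat u - coef D u \<in> A_of D u" if "u \<in> quants D" for u
      using bound[OF \<omega>, of lam u "bhat u"] H that by blast+
    show "(SUP u\<in>quants D. ereal (J_norm D u (bhat u - coef D u))) \<le> ereal t"
      using J by (intro SUP_least) simp
    show "(SUP u\<in>quants D. ereal (sqrt (\<integral>v. (v \<bullet> (bhat u - coef D u))\<^sup>2 \<partial>x_law D))) \<le> ereal (t / sqrt (flow D))"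
      using l2[OF _ J] by (intro SUP_least) simp
    show "(SUP u\<in>quants D. ereal (norm (bhat u - coef D u))) \<le> l2_factor D * ereal (t / sqrt (flow D))"
      using t0 Q.flow_pos cone J by (intro SUP_least Q.l2_error_le l2) auto
  qed
qed

end
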